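(* Let $\delta\in(0,1/3]$ and let the basic particle $P$ be either the slit $(1,1+\delta]$ or the disc $\{z:|z-1-\delta/2|\le\delta/2\}\setminus\{1\}$. Let $c=\mathrm{cap}(K_0\cup P)$ and let $(\Theta_n)$, $(K_n)$, $(P_n)$ be the associated Hastings–Levitov HL(0) random variables, clusters and particles (see context). For $\varepsilon\in(0,1]$ and $m\in\mathbb N$ let $\Omega[m,\varepsilon]$ be the event that all of the following hold: for all $1\le n\le m$, $|z-e^{cn+i\Theta_n}|\le\varepsilon e^{cn}$ for all $z\in P_n$; for all $0\le n\le m$, $\mathrm{dist}(w,K_n)\le\varepsilon e^{cn}$ whenever $|w|\le e^{cn}$; and for all $n'\ge m+1$, $|z|\ge(1-\varepsilon)e^{cm}$ for all $z\in P_{n'}$. Take $\varepsilon=\delta^{2/3}(\log(1/\delta))^8$ and $m=\lfloor\delta^{-6}\rfloor$. Then $\mathbb P(\Omega[m,\varepsilon])\to1$ as $\delta\to0$.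
   Context: $K_0$ is the closed unit disc and $D_0=(\mathbb C\cup\{\infty\})\setminus K_0$. Given $P$, set $K=K_0\cup P$, $D=(\mathbb C\cup\{\infty\})\setminus K$; $F:D_0\to D$ is the unique conformal bijection with $F(z)=e^{c}z+O(1)$ as $|z|\to\infty$, $c\in\mathbb R$; $c=\mathrm{cap}(K)$ is the logarithmic capacity of $K$. Let $(\Theta_n:n\in\mathbb N)$ be i.i.d. uniform on $[0,2\pi)$, $F_n(z)=e^{i\Theta_n}F(e^{-i\Theta_n}z)$, $\Phi_n=F_1\circ\dots\circ F_n$ ($\Phi_0=\mathrm{id}$), $K_n=(\mathbb C\cup\{\infty\})\setminus\Phi_n(D_0)$, and $P_{n}=\Phi_{n-1}(e^{i\Theta_{n}}P)$ for $n\ge1$, so $K_n=K_0\cup P_1\cup\dots\cup P_n$. *)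

theory Defs
  imports "HOL-Probability.Probability" "HOL-Complex_Analysis.Complex_Analysis"
begin

text \<open>Hastings--Levitov HL(0). The Riemann sphere is represented by the complex
plane; the point at infinity is handled through the normalisation at infinity.\<close>

definition K0 :: "complex set" where "K0 = cball 0 1"

definition D0 :: "complex set" where "D0 = {z. 1 < norm z}"

definition slit_particle :: "real \<Rightarrow> complex set" where
  "slit_particle \<delta> = {complex_of_real x | x. 1 < x \<and> x \<le> 1 + \<delta>}"

definition disc_particle :: "real \<Rightarrow> complex set" where
  "disc_particle \<delta> = cball (complex_of_real (1 + \<delta> / 2)) (\<delta> / 2) - {1}"

definition is_HL_map :: "complex set \<Rightarrow> (complex \<Rightarrow> complex) \<Rightarrow> real \<Rightarrow> bool" where
  "is_HL_map P F c \<longleftrightarrow>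
     F holomorphic_on D0 \<and> inj_on F D0 \<and> F ` D0 = - (K0 \<union> P) \<and>
     (\<exists>B. \<forall>\<^sub>F z in at_infinity. norm (F z - exp c * z) \<le> B)"

definition HL_pair :: "complex set \<Rightarrow> (complex \<Rightarrow> complex) \<times> real" where
  "HL_pair P = (SOME (F, c). is_HL_map P F c)"

definition HL_F :: "complex set \<Rightarrow> complex \<Rightarrow> complex" where
  "HL_F P = fst (HL_pair P)"

definition HL_cap :: "complex set \<Rightarrow> real" where
  "HL_cap P = snd (HL_pair P)"

definition HL_Fn :: "complex set \<Rightarrow> (nat \<Rightarrow> real) \<Rightarrow> nat \<Rightarrow> complex \<Rightarrow> complex" where
  "HL_Fn P \<theta> n z = cis (\<theta> n) * HL_F P (cis (- \<theta> n) * z)"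

primrec HL_Phi :: "complex set \<Rightarrow> (nat \<Rightarrow> real) \<Rightarrow> nat \<Rightarrow> complex \<Rightarrow> complex" where
  "HL_Phi P \<theta> 0 = id"
| "HL_Phi P \<theta> (Suc n) = HL_Phi P \<theta> n \<circ> HL_Fn P \<theta> (Suc n)"

definition HL_K :: "complex set \<Rightarrow> (nat \<Rightarrow> real) \<Rightarrow> nat \<Rightarrow> complex set" where
  "HL_K P \<theta> n = - (HL_Phi P \<theta> n ` D0)"

definition HL_P :: "complex set \<Rightarrow> (nat \<Rightarrow> real) \<Rightarrow> nat \<Rightarrow> complex set" where
  "HL_P P \<theta> n = HL_Phi P \<theta> (n - 1) ` ((\<lambda>z. cis (\<theta> n) * z) ` P)"

text \<open>The event Omega[m, eps], as a predicate of the angle sequence theta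
(theta 0 is unused; the angles are theta 1, theta 2, ...).\<close>
definition HL_Omega :: "complex set \<Rightarrow> nat \<Rightarrow> real \<Rightarrow> (nat \<Rightarrow> real) \<Rightarrow> bool" where
  "HL_Omega P m \<epsilon> \<theta> \<longleftrightarrow>
     (let c = HL_cap P in
       (\<forall>n\<in>{1..m}. \<forall>z\<in>HL_P P \<theta> n.
          norm (z - exp (c * real n) * cis (\<theta> n)) \<le> \<epsilon> * exp (c * real n)) \<and>
       (\<forall>n\<le>m. \<forall>w. norm w \<le> exp (c * real n) \<longrightarrow>
          infdist w (HL_K P \<theta> n) \<le> \<epsilon> * exp (c * real n)) \<and>
       (\<forall>n'\<ge>m + 1. \<forall>z\<in>HL_P P \<theta> n'. norm z \<ge> (1 - \<epsilon>) * exp (c * real m)))"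

end

(*
  In the coordinate 1/z the basic map is F(z) = z exp(f(1/z)) with f holomorphic on the unit
  disc, f(0) = c, Re f >= 0, f = O(delta), and f' controlled by the distance to the two points
  of the circle that F sends to 1. Hence Phi_n(z) = z exp(H_n(1/z)), where H_n is the sum of f
  along a Markov chain in the disc driven by the angles, and the event says that H_n is close
  to cn on the image of the particle.

  Since a uniform rotation averages f to f(0) = c, the process H_n - cn is a martingale.
  Exponential moments give |H_n - cn| <= delta^(2/3) at a given point, up to a stretched
  exponentially small probability: Re f <= C delta makes the chain leave the circle at
  speed c, after which the increments are O(1/k).

  To pass to all points of the particle at once, split the particle into the part at distance
  at least kappa from its base point, where a net and a Lipschitz bound suffice, and a pocket
  of size kappa, which is compared with one reference point. Under the chain the pocket
  expands by at most the product of the factors 1 + 2 C delta / dist(., singularities); its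
  moments of order p < 1 are finite because |1 - u|^(-p) is integrable on the circle, so for
  tiny kappa the pocket stays small until the reference point has moved away from the circle.
  The scales can be chosen so that the bad events for all n have summable probabilities with
  sum O(delta^6). Finally the disc of radius exp(cn) is filled because among any
  delta^(-4/3) consecutive angles some fall in every arc of length delta^(2/3).
*)
theory Submission
  imports Defs "HOL-Real_Asymp.Real_Asymp"
begin

section \<open>Averages over the circle\<close>

text \<open>\<open>HL_Phi\<close> applies the newest map first, so every \<open>n\<close> needs a
  chain of its own with the angles reversed, and the chains for different \<open>n\<close> are not
  initial pieces of one another. The failures are therefore added up over all \<open>n\<close>. As
  the last clause of the event concerns all later particles, they must be summable, which forces
  scales depending on \<open>n\<close>. The exponent 2/3: as \<open>Re f\<close> has mean
  \<open>c\<close>, of order \<open>d^2\<close>, and is at most \<open>C * d\<close>, one step has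
  variance of order \<open>d^3\<close>. Running \<open>k0\<close> steps with this variance and
  bounding the later increments by \<open>1 / k\<close> gives a total of order
  \<open>k0 * d^3 + 1 / k0\<close>, balanced at \<open>k0 = d^(-3/2)\<close>. The standard deviation
  \<open>d^(3/4)\<close> lies below \<open>d^(2/3)\<close> by the factor \<open>d^(1/12)\<close>,
  and this margin yields tails small enough to pay for nets of stretched exponential size. In the
  filling step \<open>d^(-4/3)\<close> particles change the radius by a relative amount of order
  \<open>c * d^(-4/3)\<close>, again \<open>d^(2/3)\<close>. The power of the logarithm absorbs the
  constants.\<close>

abbreviation (input) circ :: "real measure" where
  "circ \<equiv> uniform_measure lborel {0..<2 * pi}"

lemma prob_space_circ: "prob_space circ"
  by (rule prob_space_uniform_measure) auto

lemma circ_eq_density: "circ = density lborel (\<lambda>x. ennreal (indicator {0..<2*pi} x / (2*pi)))"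
proof -
  have "indicator {0..<2*pi} x / emeasure lborel {0..<2*pi} = ennreal (indicator {0..<2*pi} x / (2*pi))"
    for x :: real
    by (auto simp: indicator_def divide_ennreal[symmetric] simp flip: ennreal_1)
  then show ?thesis
    unfolding uniform_measure_def by (intro density_cong) auto
qed

text \<open>The mean value property: Cauchy's formula for
  \<open>w \<mapsto> h (w * \<zeta>)\<close>, which is holomorphic on the closed disc because
  \<open>norm \<zeta> < 1\<close>.\<close>

lemma circle_mean:
  assumes h: "h holomorphic_on ball 0 1" and z: "norm \<zeta> < 1"
  shows "has_bochner_integral circ (\<lambda>\<theta>. h (cis \<theta> * \<zeta>)) (h 0)"
proof -
  define g where "g w = h (w * \<zeta>)" for w
  have inb: "norm (w * \<zeta>) < 1" if "norm w \<le> 1" for w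
  proof -
    have "norm (w * \<zeta>) \<le> 1 * norm \<zeta>"
      unfolding norm_mult by (intro mult_right_mono) (use that in auto)
    then show ?thesis using z by simp
  qed
  have hol: "g holomorphic_on cball 0 1"
    unfolding g_def
    by (rule holomorphic_on_compose_gen[OF _ h, of "\<lambda>w. w * \<zeta>", unfolded o_def])
       (auto intro!: holomorphic_intros simp: inb)
  have "((\<lambda>u. g u / (u - 0)) has_contour_integral (2 * of_real pi * \<i> * g 0)) (circlepath 0 1)"
    by (rule Cauchy_integral_circlepath_simple[OF hol]) auto
  then have "((\<lambda>t. g (cis t) * \<i>) has_integral (2 * of_real pi * \<i> * g 0)) {0..2*pi}"
    unfolding circlepath_def by (subst (asm) has_contour_integral_part_circlepath_iff) auto
  then have "((\<lambda>t. \<i> * g (cis t)) has_integral (\<i> * (2 * of_real pi * g 0))) {0..2*pi}"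
    by (simp add: mult_ac)
  from has_integral_mult_right[OF this, of "- \<i>"]
  have *: "((\<lambda>t. g (cis t)) has_integral (2 * of_real pi * g 0)) {0..2*pi}"
    by (simp add: mult.assoc[symmetric])
  have "continuous_on (cball 0 1) g" using hol by (rule holomorphic_on_imp_continuous_on)
  then have cont: "continuous_on {0..2*pi} (\<lambda>t. g (cis t))"
    by (rule continuous_on_compose2) (auto intro!: continuous_intros)
  have si: "set_integrable lborel {0..2*pi} (\<lambda>t. g (cis t))"
    by (rule borel_integrable_atLeastAtMost'[OF cont])
  have val: "set_lebesgue_integral lborel {0..2*pi} (\<lambda>t. g (cis t)) = 2 * of_real pi * g 0"
    using set_borel_integral_eq_integral(2)[OF si] * by (simp add: integral_unique)
  \<comment> \<open>The contour integral lives on the closed interval, \<open>circ\<close> on the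
    half-open one; they differ in a null set.\<close>
  have ae: "AE x in lborel. indicator {0..2*pi} x *\<^sub>R g (cis x) = indicator {0..<2*pi} x *\<^sub>R g (cis x)"
    using AE_lborel_singleton[of "2*pi"] by eventually_elim (auto simp: indicator_def)
  have "has_bochner_integral lborel (\<lambda>t. indicator {0..2*pi} t *\<^sub>R g (cis t)) (2 * of_real pi * g 0)"
    using si val unfolding set_integrable_def set_lebesgue_integral_def
    by (simp add: has_bochner_integral_iff)
  have bm: "(\<lambda>x. indicator {0..<2*pi} x *\<^sub>R g (cis x)) \<in> borel_measurable borel"
  proof -
    have "(\<lambda>x. if x \<in> {0..<2*pi} then g (cis x) else 0) \<in> borel_measurable borel"
    proof (rule measurable_If_set)
      show "(\<lambda>x. g (cis x)) \<in> borel_measurable borel"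
      proof (rule borel_measurable_continuous_onI)
        show "continuous_on UNIV (\<lambda>x. g (cis x))"
          by (rule continuous_on_compose2[OF \<open>continuous_on (cball 0 1) g\<close>]) (auto intro!: continuous_intros)
      qed
    qed auto
    then show ?thesis by (rule measurable_cong[THEN iffD1, rotated]) (auto simp: indicator_def)
  qed
  have hb: "has_bochner_integral lborel (\<lambda>t. indicator {0..<2*pi} t *\<^sub>R g (cis t)) (2 * of_real pi * g 0)"
    using has_bochner_integral_cong_AE[THEN iffD1, OF _ _ ae] bm
      \<open>has_bochner_integral lborel (\<lambda>t. indicator {0..2*pi} t *\<^sub>R g (cis t)) _\<close>
    by (auto simp: has_bochner_integral_iff)
  have hb2: "has_bochner_integral lborel (\<lambda>t. (indicator {0..<2*pi} t / (2*pi)) *\<^sub>R g (cis t)) (g 0)"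
  proof -
    have "has_bochner_integral lborel (\<lambda>t. (1/(2*pi)) *\<^sub>R (indicator {0..<2*pi} t *\<^sub>R g (cis t)))
       ((1/(2*pi)) *\<^sub>R (2 * of_real pi * g 0))"
      by (rule has_bochner_integral_scaleR_right) (use hb in auto)
    then show ?thesis by (simp add: scaleR_conv_of_real)
  qed
  have "has_bochner_integral circ (\<lambda>\<theta>. g (cis \<theta>)) (g 0)"
    unfolding circ_eq_density
  proof (rule has_bochner_integral_density)
    show "(\<lambda>x. g (cis x)) \<in> borel_measurable lborel"
    proof -
      have "continuous_on UNIV (\<lambda>x. g (cis x))"
        by (rule continuous_on_compose2[OF \<open>continuous_on (cball 0 1) g\<close>]) (auto intro!: continuous_intros)
      then show ?thesis by (simp add: borel_measurable_continuous_onI)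
    qed
  qed (use hb2 in \<open>auto simp: indicator_def\<close>)
  then show ?thesis by (simp add: g_def)
qed

lemma circle_mean_Re:
  assumes h: "h holomorphic_on ball 0 1" and z: "norm \<zeta> < 1"
  shows "has_bochner_integral circ (\<lambda>\<theta>. Re (h (cis \<theta> * \<zeta>))) (Re (h 0))"
  using has_bochner_integral_bounded_linear[OF bounded_linear_Re circle_mean[OF assms]] .

text \<open>For \<open>p < 1\<close> the function \<open>(1 - w) powr -p\<close> has argument at most \<open>p * pi / 2\<close> on the disc,
  so its modulus is controlled by its real part, whose mean is its value at the origin.\<close>

lemma circle_kernel_bound:
  fixes p :: real
  assumes p: "0 < p" "p < 1" and a: "norm a = 1" and z: "norm \<zeta> < 1"
  shows "(\<integral>\<^sup>+\<theta>. ennreal (norm (cis \<theta> * \<zeta> - a) powr (- p)) \<partial>circ) \<le> ennreal (1 / cos (p * pi / 2))"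
proof -
  define h where "h w = (1 - cnj a * w) powr (- of_real p)" for w
  have aa: "a * cnj a = 1" using a by (simp add: complex_norm_square[symmetric])
  have pos: "0 < Re (1 - cnj a * w)" if "norm w < 1" for w
  proof -
    have "Re (cnj a * w) \<le> norm (cnj a * w)" by (rule complex_Re_le_cmod)
    also have "\<dots> < 1" using that a by (simp add: norm_mult)
    finally show ?thesis by simp
  qed
  have h0: "h 0 = 1" by (simp add: h_def)
  have hol: "h holomorphic_on ball 0 1"
    unfolding h_def using pos
    by (auto intro!: holomorphic_intros simp: complex_nonpos_Reals_iff) (metis less_le_not_le)
  have ppi: "0 < p * pi" "p * pi < 1 * pi" using p by auto
  have cpos: "0 < cos (p * pi / 2)"
    by (rule cos_gt_zero_pi) (use ppi in linarith)+
  have le: "norm (w - a) powr (- p) \<le> Re (h w) / cos (p * pi / 2)" if w: "norm w < 1" for w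
  proof -
    let ?u = "1 - cnj a * w"
    have u0: "?u \<noteq> 0"
    proof
      assume "?u = 0"
      then have "Re ?u = 0" by (simp only: zero_complex.sel)
      with pos[OF w] show False by linarith
    qed
    have nu: "norm ?u = norm (w - a)"
    proof -
      have "w - a = - a * ?u" using aa by (simp add: algebra_simps)
      then show ?thesis using a by (metis mult_1 norm_minus_cancel norm_mult)
    qed
    have im: "\<bar>Im (Ln ?u)\<bar> < pi/2" using Re_Ln_pos_lt[OF u0] pos[OF w] by simp
    have "Re (h w) = exp (- p * ln (norm ?u)) * cos (p * Im (Ln ?u))"
      unfolding h_def powr_def using u0 by (simp add: Re_exp)
    also have "exp (- p * ln (norm ?u)) = norm (w - a) powr (- p)"
      unfolding nu[symmetric] using u0 by (simp add: powr_def)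
    finally have eq: "Re (h w) = norm (w - a) powr (- p) * cos (p * Im (Ln ?u))" .
    have "cos (p * pi / 2) \<le> cos (p * \<bar>Im (Ln ?u)\<bar>)"
    proof (rule cos_monotone_0_pi_le)
      have "p * \<bar>Im (Ln ?u)\<bar> \<le> p * (pi / 2)" by (rule mult_left_mono) (use im p in auto)
      then show "p * \<bar>Im (Ln ?u)\<bar> \<le> p * pi / 2" by simp
      have "p * pi \<le> 1 * pi" by (rule mult_right_mono) (use p in auto)
      then show "p * pi / 2 \<le> pi" using pi_gt_zero by linarith
    qed (use p in auto)
    also have "cos (p * \<bar>Im (Ln ?u)\<bar>) = cos (p * Im (Ln ?u))" by (cases "Im (Ln ?u) \<ge> 0") auto
    finally have "norm (w - a) powr (- p) * cos (p * pi / 2) \<le> Re (h w)"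
      unfolding eq by (rule mult_left_mono) auto
    then show ?thesis using cpos by (simp add: field_simps)
  qed
  have inb: "norm (cis \<theta> * \<zeta>) < 1" for \<theta> using z by (simp add: norm_mult)
  have hb: "has_bochner_integral circ (\<lambda>\<theta>. Re (h (cis \<theta> * \<zeta>)) / cos (p*pi/2)) (1 / cos (p*pi/2))"
    using has_bochner_integral_divide_zero[OF circle_mean_Re[OF hol z], of "cos (p*pi/2)"] h0 by simp
  have nn: "0 \<le> Re (h (cis \<theta> * \<zeta>)) / cos (p*pi/2)" for \<theta>
    using le[OF inb[of \<theta>]] by (meson order_trans powr_ge_zero)
  have "(\<integral>\<^sup>+\<theta>. ennreal (norm (cis \<theta> * \<zeta> - a) powr (- p)) \<partial>circ)
      \<le> (\<integral>\<^sup>+\<theta>. ennreal (Re (h (cis \<theta> * \<zeta>)) / cos (p*pi/2)) \<partial>circ)"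
    by (intro nn_integral_mono ennreal_leI le inb)
  also have "\<dots> = ennreal (1 / cos (p*pi/2))"
    using hb nn by (subst nn_integral_eq_integral) (auto simp: has_bochner_integral_iff)
  finally show ?thesis .
qed

section \<open>Conformal maps through the half plane\<close>

text \<open>The Moebius involution exchanging the exterior of the disc with the right half plane. It
  swaps 1 and infinity: the base point of the particle goes to infinity, and the normalisation at
  infinity becomes one at 1.\<close>

definition kap :: "complex \<Rightarrow> complex" where "kap z = (z + 1) / (z - 1)"

abbreviation rhp :: "complex set" where "rhp \<equiv> {w. 0 < Re w}"

lemma kap_minus_1: "z \<noteq> 1 \<Longrightarrow> kap z - 1 = 2 / (z - 1)"
  by (simp add: kap_def field_simps)

lemma kap_neq_1: "z \<noteq> 1 \<Longrightarrow> kap z \<noteq> 1"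
  using kap_minus_1[of z] by auto

lemma kap_kap: "z \<noteq> 1 \<Longrightarrow> kap (kap z) = z"
  using kap_minus_1[of z] kap_neq_1[of z] by (simp add: kap_def field_simps)

lemma Re_kap:
  assumes "z \<noteq> 1"
  shows "Re (kap z) = ((norm z)\<^sup>2 - 1) / (norm (z - 1))\<^sup>2"
proof -
  have "Re (kap z) = Re ((z + 1) * cnj (z - 1)) / (norm (z - 1))\<^sup>2"
    unfolding kap_def by (subst complex_div_cnj) simp
  also have "Re ((z + 1) * cnj (z - 1)) = (norm z)\<^sup>2 - 1"
    unfolding cmod_power2 by (simp add: algebra_simps power2_eq_square)
  finally show ?thesis .
qed

lemma Re_kap_pos_iff: "z \<noteq> 1 \<Longrightarrow> 0 < Re (kap z) \<longleftrightarrow> 1 < norm z"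
  by (simp add: Re_kap zero_less_divide_iff power2_less_eq_zero_iff)
     (metis abs_norm_cancel abs_one one_power2 power2_le_iff_abs_le norm_ge_zero linorder_not_less zero_le_one one_less_power pos2)

lemma kap_image_D0: "kap ` D0 = rhp - {1}"
proof (intro equalityI subsetI)
  fix w assume "w \<in> kap ` D0"
  then obtain z where z: "1 < norm z" "w = kap z" by (auto simp: D0_def)
  then have "z \<noteq> 1" by auto
  then show "w \<in> rhp - {1}" using z Re_kap_pos_iff kap_neq_1 by auto
next
  fix w assume w: "w \<in> rhp - {1}"
  then have "kap w \<noteq> 1" "kap (kap w) = w" using kap_neq_1 kap_kap by auto
  then show "w \<in> kap ` D0" using Re_kap_pos_iff[of "kap w"] w
    by (intro image_eqI[of _ _ "kap w"]) (auto simp: D0_def)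
qed

lemma inj_on_kap: "1 \<notin> A \<Longrightarrow> inj_on kap A"
  by (rule inj_on_inverseI[of _ kap]) (metis kap_kap)

text \<open>Transports the image condition of \<open>is_HL_map\<close> to the half plane. The point
  1 is taken out of \<open>T\<close> because it stands for infinity, which \<open>D0\<close> does
  not contain.\<close>

lemma kap_image_Diff:
  assumes "T \<subseteq> rhp" "1 \<in> T" "P \<subseteq> D0" and "kap ` P = rhp - T"
  shows "kap ` (T - {1}) = - (K0 \<union> P)"
proof -
  have eq: "- (K0 \<union> P) = D0 - P" by (auto simp: K0_def D0_def)
  have D1: "1 \<notin> D0" by (auto simp: D0_def)
  have "kap ` (D0 - P) = (rhp - {1}) - kap ` P"
    using inj_on_image_set_diff[OF inj_on_kap[OF D1], of D0 P] assms(3) kap_image_D0 by auto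
  also have "\<dots> = T - {1}" using assms by auto
  finally have "kap ` (T - {1}) = kap ` kap ` (D0 - P)" by simp
  also have "\<dots> = D0 - P"
  proof -
    have "kap (kap z) = z" if "z \<in> D0 - P" for z using that D1 by (intro kap_kap) auto
    then show ?thesis by (force simp: image_image)
  qed
  finally show ?thesis using eq by simp
qed

text \<open>What is needed of a particle: \<open>F z = z * exp (f (1 / z))\<close>, where \<open>f\<close> is small and its
  derivative is controlled by the distance to the two points of the unit circle which \<open>F\<close>
  sends to the base point of the particle.\<close>

definition hl_map_est ::
    "complex set \<Rightarrow> real \<Rightarrow> real \<Rightarrow> real \<Rightarrow> (complex \<Rightarrow> complex) \<Rightarrow> bool" where
  "hl_map_est P C d c f \<longleftrightarrow>
     is_HL_map P (\<lambda>z. z * exp (f (1 / z))) c \<and> f holomorphic_on ball 0 1 \<and>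
     f \<in> borel_measurable borel \<and> f 0 = of_real c \<and>
     (\<forall>z. norm z < 1 \<longrightarrow> 0 \<le> Re (f z) \<and> norm (f z) \<le> C * d) \<and>
     (\<exists>a b. norm a = 1 \<and> norm b = 1 \<and>
        (\<forall>z. norm z < 1 \<longrightarrow> norm (deriv f z) * min (norm (z - a)) (norm (z - b)) \<le> C * d)) \<and>
     d\<^sup>2 \<le> C * c \<and> c \<le> C * d\<^sup>2"

text \<open>The exterior map is \<open>kap \<circ> S \<circ> kap\<close>; the values of
  \<open>S\<close> and \<open>S'\<close> at 1 say that infinity is fixed and that the leading
  coefficient is \<open>exp c\<close>. Hypothesis \<open>k1\<close> amounts to
  \<open>norm (exp (- f z) - 1) \<le> B * d\<close>, and \<open>q\<close> bounds
  \<open>z * deriv f z\<close>, both rewritten in \<open>R = (1 + z) / (1 - z)\<close>, so that each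
  particle only has to supply estimates for an elementary function.\<close>

lemma hl_map_from_halfplane:
  fixes S S' :: "complex \<Rightarrow> complex"
  assumes der: "\<And>R. 0 < Re R \<Longrightarrow> (S has_field_derivative S' R) (at R)"
    and inj: "inj_on S rhp" and im: "S ` rhp = T" and T: "T \<subseteq> rhp"
    and S1: "S 1 = 1" and S'1: "S' 1 = of_real (exp (- c))"
    and P: "P \<subseteq> D0" "kap ` P = rhp - T"
    and B: "0 < B" "0 < d" "d \<le> 1" "B * d \<le> 1 / 4"
    and k1: "\<And>R. 0 < Re R \<Longrightarrow> 2 * norm (S R - R) \<le> B * d * norm (S R + 1) * norm (R - 1)"
    and ab: "norm a = 1" "norm b = 1"
    and q: "\<And>z R. norm z < 1 \<Longrightarrow> z \<noteq> 0 \<Longrightarrow> R = (1 + z) / (1 - z) \<Longrightarrow> 0 < Re R \<Longrightarrow> 1/2 \<le> norm z \<Longrightarrow>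
        norm (1 - S' R * (R\<^sup>2 - 1) / ((S R)\<^sup>2 - 1)) * min (norm (z - a)) (norm (z - b)) \<le> B * d"
    and c: "d\<^sup>2 \<le> B * c" "c \<le> B * d\<^sup>2"
  shows "\<exists>f. hl_map_est P (8 * B) d c f"
proof -
  define R where "R z = (1 + z) / (1 - z)" for z :: complex
  \<comment> \<open>\<open>g z\<close> is \<open>1 / F (1 / z)\<close>, and \<open>k\<close>, which
    will be \<open>exp (- f)\<close>, is \<open>g z / z\<close> with the removable singularity at 0
    filled.\<close>
  define g where "g z = (S (R z) - 1) / (S (R z) + 1)" for z
  define k where "k z = (if z = 0 then deriv g 0 else g z / z)" for z
  \<comment> \<open>The value 0 off the disc makes \<open>f\<close> Borel measurable on the whole
    plane.\<close>
  define f where "f z = (if norm z < 1 then - Ln (k z) else 0)" for z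
  have c0: "0 < c" using c(1) B by (metis zero_less_mult_pos zero_less_power less_le_trans)
  have ne1: "1 - z \<noteq> 0" if "norm z < 1" for z :: complex using that by auto
  have ReR: "0 < Re (R z)" if z: "norm z < 1" for z
  proof -
    have "Re (R z) = Re ((1 + z) * cnj (1 - z)) / (norm (1 - z))\<^sup>2"
      unfolding R_def by (subst complex_div_cnj) simp
    also have "Re ((1 + z) * cnj (1 - z)) = 1 - (norm z)\<^sup>2"
      unfolding cmod_power2 by (simp add: algebra_simps power2_eq_square)
    finally have e: "Re (R z) = (1 - (norm z)\<^sup>2) / (norm (1 - z))\<^sup>2" .
    have "(norm z)\<^sup>2 < 1" using z by (simp add: abs_square_less_1)
    then show ?thesis unfolding e using ne1[OF z] by (intro divide_pos_pos) auto
  qed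
  have ReS: "0 < Re (S w)" if "0 < Re w" for w using im T that by blast
  have S_p1: "S w + 1 \<noteq> 0" if "0 < Re w" for w using ReS[OF that] by (auto simp: complex_eq_iff)
  have R_p1: "w + 1 \<noteq> 0" if "0 < Re w" for w :: complex using that by (auto simp: complex_eq_iff)
  have S_eq1: "S w = 1 \<longleftrightarrow> w = 1" if "0 < Re w" for w
    using inj S1 that by (metis (mono_tags, lifting) inj_onD mem_Collect_eq one_complex.sel(1) zero_less_one)
  have R_der: "(R has_field_derivative 2 / (1 - z)\<^sup>2) (at z)" if "norm z < 1" for z
    unfolding R_def using ne1[OF that]
    by (auto intro!: derivative_eq_intros simp: power2_eq_square field_simps)
  have g_der: "(g has_field_derivative 2 * S' (R z) * (2 / (1 - z)\<^sup>2) / (S (R z) + 1)\<^sup>2) (at z)"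
    if z: "norm z < 1" for z
  proof -
    define D where "D = S' (R z) * (2 / (1 - z)\<^sup>2)"
    have "((\<lambda>z. S (R z)) has_field_derivative D) (at z)"
      unfolding D_def by (rule DERIV_chain2[OF der[OF ReR[OF z]] R_der[OF z]])
    then have "(g has_field_derivative 2 * D / (S (R z) + 1)\<^sup>2) (at z)"
      unfolding g_def using S_p1[OF ReR[OF z]]
      by (auto intro!: derivative_eq_intros simp: power2_eq_square divide_simps) (simp add: algebra_simps)
    then show ?thesis by (simp add: D_def mult.assoc)
  qed
  have g_hol: "g holomorphic_on ball 0 1"
    by (rule holomorphic_onI) (use g_der in \<open>auto simp: field_differentiable_def intro: has_field_derivative_at_within\<close>)
  have g0: "g 0 = 0" by (simp add: g_def R_def S1)
  have dg0: "deriv g 0 = of_real (exp (- c))"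
    using DERIV_imp_deriv[OF g_der[of 0]] by (simp add: R_def S1 S'1)
  have R_m1: "R z - 1 = 2 * z / (1 - z)" "R z + 1 = 2 / (1 - z)" if "norm z < 1" for z
    using ne1[OF that] by (auto simp: R_def field_simps)
  have zR: "z = (R z - 1) / (R z + 1)" if "norm z < 1" for z
    using ne1[OF that] R_m1[OF that] by simp
  have g_lt: "norm (g z) < 1" if z: "norm z < 1" for z
  proof -
    have r: "0 < Re (S (R z))" by (rule ReS[OF ReR[OF z]])
    have "norm (S (R z) - 1) < norm (S (R z) + 1)"
    proof (rule power2_less_imp_less)
      show "(norm (S (R z) - 1))\<^sup>2 < (norm (S (R z) + 1))\<^sup>2"
        using r unfolding cmod_power2 by (simp add: power2_eq_square algebra_simps)
    qed auto
    then show ?thesis using S_p1[OF ReR[OF z]] by (simp add: g_def norm_divide divide_less_eq)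
  qed
  have k_hol: "k holomorphic_on ball 0 1"
    by (rule pole_theorem_open_0[OF g_hol, of 0]) (auto simp: k_def g0)
  have k_bound: "norm (k z - 1) \<le> B * d" if z: "norm z < 1" for z
  proof (cases "z = 0")
    case True
    have "norm (k z - 1) = \<bar>exp (- c) - 1\<bar>"
      using True dg0 by (simp add: k_def) (metis norm_of_real of_real_1 of_real_diff)
    also have "\<dots> \<le> c" using c0 exp_ge_add_one_self[of "- c"] by auto
    also have "\<dots> \<le> B * d"
      using c(2) B power2_eq_square[of d] mult_left_le[of d d] by (smt (verit) mult_left_mono)
    finally show ?thesis .
  next
    case False
    let ?r = "R z"
    have r: "0 < Re ?r" by (rule ReR[OF z])
    have r1: "?r \<noteq> 1" using R_m1(1)[OF z] False ne1[OF z] by auto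
    have alg: "((s - 1) / (s + 1)) / ((r - 1) / (r + 1)) - 1 = 2 * (s - r) / ((s + 1) * (r - 1))"
      if "s + 1 \<noteq> 0" "r + 1 \<noteq> 0" "r \<noteq> 1" for s r :: complex
      using that by (simp add: divide_simps) (simp add: algebra_simps)
    have "k z = g z / ((?r - 1) / (?r + 1))" using False zR[OF z] by (simp add: k_def)
    then have "k z - 1 = 2 * (S ?r - ?r) / ((S ?r + 1) * (?r - 1))"
      unfolding g_def by (simp only: alg[OF S_p1[OF r] R_p1[OF r] r1])
    then have "norm (k z - 1) = 2 * norm (S ?r - ?r) / (norm (S ?r + 1) * norm (?r - 1))"
      by (simp only: norm_divide norm_mult norm_numeral)
    also have "\<dots> \<le> B * d"
      using k1[OF r] S_p1[OF r] r1 by (simp add: divide_le_eq mult_ac)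
    finally show ?thesis .
  qed
  have k_Re: "0 < Re (k z)" if "norm z < 1" for z
    using k_bound[OF that] B(4) abs_Re_le_cmod[of "k z - 1"] by simp
  have k_ne: "k z \<noteq> 0" if "norm z < 1" for z using k_Re[OF that] by auto
  have k_nonpos: "k z \<notin> \<real>\<^sub>\<le>\<^sub>0" if "norm z < 1" for z
    using k_Re[OF that] by (auto simp: complex_nonpos_Reals_iff)
  have f_hol: "f holomorphic_on ball 0 1"
  proof -
    have "(\<lambda>z. - Ln (k z)) holomorphic_on ball 0 1"
      by (intro holomorphic_intros k_hol) (use k_nonpos in auto)
    then show ?thesis by (rule holomorphic_transform) (auto simp: f_def)
  qed
  have f_bound: "norm (f z) \<le> 2 * B * d" if "norm z < 1" for z
    using norm_Ln_le[of "k z - 1"] k_bound[OF that] B(4) that by (simp add: f_def)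
  have exp_f: "exp (- f z) = k z" if "norm z < 1" for z
    using that k_ne[OF that] by (simp add: f_def)
  \<comment> \<open>The Schwarz lemma for \<open>g\<close>. This is the source of
    \<open>0 \<le> Re (f z)\<close>.\<close>
  have k_le: "norm (k z) \<le> 1" if z: "norm z < 1" for z
    using Schwarz_Lemma(1)[OF g_hol g0 g_lt z] Schwarz_Lemma(2)[OF g_hol g0 g_lt z]
    by (auto simp: k_def norm_divide divide_le_eq)
  have f_Re: "0 \<le> Re (f z)" if z: "norm z < 1" for z
  proof -
    have "exp (Re (- f z)) = norm (k z)" using exp_f[OF z] by (metis norm_exp_eq_Re)
    then have "exp (Re (- f z)) \<le> exp 0" using k_le[OF z] by simp
    then show ?thesis by simp
  qed
  have f0: "f 0 = of_real c"
    using dg0 by (simp add: f_def k_def Ln_of_real)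
  have meas: "f \<in> borel_measurable borel"
  proof -
    have "(\<lambda>z. indicator (ball 0 1) z *\<^sub>R f z) \<in> borel_measurable borel"
      by (intro borel_measurable_continuous_on_indicator holomorphic_on_imp_continuous_on f_hol) auto
    moreover have "(\<lambda>z. indicator (ball 0 1) z *\<^sub>R f z) = f" by (auto simp: f_def indicator_def fun_eq_iff)
    ultimately show ?thesis by simp
  qed
  have f_deriv: "norm (deriv f z) * min (norm (z - a)) (norm (z - b)) \<le> 8 * B * d" if z: "norm z < 1" for z
  proof (cases "1/2 \<le> norm z")
    case True
    let ?r = "R z"
    have z0: "z \<noteq> 0" using True by auto
    have r: "0 < Re ?r" by (rule ReR[OF z])
    have r1: "?r \<noteq> 1" using R_m1(1)[OF z] z0 ne1[OF z] by auto
    have kd: "(k has_field_derivative (deriv g z * z - g z) / z\<^sup>2) (at z)"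
    proof (rule has_field_derivative_transform_within_open[of "\<lambda>z. g z / z" _ _ "- {0}"])
      have gd: "(g has_field_derivative deriv g z) (at z)"
        using g_der[OF z] DERIV_imp_deriv by metis
      show "((\<lambda>z. g z / z) has_field_derivative (deriv g z * z - g z) / z\<^sup>2) (at z)"
        using DERIV_divide[OF gd DERIV_ident z0] by (simp add: power2_eq_square)
    qed (use z0 in \<open>auto simp: k_def\<close>)
    have "(f has_field_derivative - ((deriv g z * z - g z) / z\<^sup>2 / k z)) (at z)"
    proof (rule has_field_derivative_transform_within_open[of "\<lambda>z. - Ln (k z)" _ _ "ball 0 1"])
      show "((\<lambda>z. - Ln (k z)) has_field_derivative - ((deriv g z * z - g z) / z\<^sup>2 / k z)) (at z)"
        using k_nonpos[OF z] k_ne[OF z]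
          by (auto intro!: derivative_eq_intros kd simp: divide_inverse mult_ac)
    qed (use z in \<open>auto simp: f_def\<close>)
    then have "deriv f z = - ((deriv g z * z - g z) / z\<^sup>2 / k z)" by (rule DERIV_imp_deriv)
    then have df: "z * deriv f z = 1 - z * deriv g z / g z"
      proof -
      have alg: "z * (- ((y * z - x) / z\<^sup>2 / (x / z))) = 1 - z * y / x" if "x \<noteq> 0" for x y
        using z0 that by (simp add: divide_simps power2_eq_square)
      have kg: "k z = g z / z" and "g z \<noteq> 0" using z0 k_ne[OF z] by (auto simp: k_def)
      then show ?thesis unfolding \<open>deriv f z = _\<close> kg by (intro alg)
    qed
    have Sp: "S ?r + 1 \<noteq> 0" by (rule S_p1[OF r])
    have zz: "z * (4 / (1 - z)\<^sup>2) = ?r\<^sup>2 - 1"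
    proof -
      have "?r\<^sup>2 - 1 = (?r - 1) * (?r + 1)" by (simp add: power2_eq_square algebra_simps)
      also have "\<dots> = z * (4 / (1 - z)\<^sup>2)"
        unfolding R_m1[OF z] by (simp add: power2_eq_square)
      finally show ?thesis by simp
    qed
    have "deriv g z = S' ?r * (4 / (1 - z)\<^sup>2) / (S ?r + 1)\<^sup>2"
      using DERIV_imp_deriv[OF g_der[OF z]] by simp
    then have "z * deriv g z / g z = S' ?r * (z * (4 / (1 - z)\<^sup>2)) / ((S ?r + 1)\<^sup>2 * g z)"
      by (simp add: mult_ac)
    also have "(S ?r + 1)\<^sup>2 * g z = (S ?r)\<^sup>2 - 1"
      proof -
      have "(S ?r + 1)\<^sup>2 * g z = (S ?r + 1) * (S ?r - 1)" using Sp by (simp add: g_def power2_eq_square)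
      then show ?thesis by (simp add: power2_eq_square algebra_simps)
    qed
    finally have "z * deriv f z = 1 - S' ?r * (?r\<^sup>2 - 1) / ((S ?r)\<^sup>2 - 1)"
      unfolding zz df by (rule arg_cong)
    then have "norm z * norm (deriv f z) * min (norm (z - a)) (norm (z - b)) \<le> B * d"
      using q[OF z z0 R_def r True] by (simp only: norm_mult[symmetric])
    then have "norm z * (norm (deriv f z) * min (norm (z - a)) (norm (z - b))) \<le> B * d"
      by (simp only: mult.assoc)
    moreover have "1/2 * (norm (deriv f z) * min (norm (z - a)) (norm (z - b)))
        \<le> norm z * (norm (deriv f z) * min (norm (z - a)) (norm (z - b)))"
      by (rule mult_right_mono[OF True]) auto
    ultimately show ?thesis using mult_pos_pos[OF B(1,2)] by argo
  next
    case False
    \<comment> \<open>Away from the circle the bound \<open>2 * B * d\<close> on \<open>f\<close>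
      and Cauchy's inequality at radius 1/2 give \<open>4 * B * d\<close>, and the distance to a
      singular point is at most 2: hence the factor 8.\<close>
    have sub: "cball z (1/2) \<subseteq> ball 0 1"
    proof
      fix w assume "w \<in> cball z (1/2)"
      then have "norm w \<le> norm z + 1/2"
        using norm_triangle_ineq[of z "w - z"] by (simp add: dist_norm norm_minus_commute)
      then show "w \<in> ball 0 1" using False by simp
    qed
    have "norm ((deriv ^^ 1) f z) \<le> fact 1 * (2 * B * d) / (1/2) ^ 1"
    proof (rule Cauchy_inequality)
      show "f holomorphic_on ball z (1/2)" using f_hol sub ball_subset_cball by (blast intro: holomorphic_on_subset)
      show "continuous_on (cball z (1/2)) f"
        using holomorphic_on_imp_continuous_on[OF f_hol] sub continuous_on_subset by blast
      show "norm (f w) \<le> 2 * B * d" if "norm (z - w) = 1/2" for w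
      proof -
        have "w \<in> cball z (1/2)" using that by (simp add: dist_norm)
        then show ?thesis using sub f_bound by auto
      qed
    qed simp
    then have "norm (deriv f z) \<le> 4 * B * d" by simp
    moreover have "min (norm (z - a)) (norm (z - b)) \<le> 2"
      using norm_triangle_ineq4[of z a] ab z by simp
    ultimately have "norm (deriv f z) * min (norm (z - a)) (norm (z - b)) \<le> (4 * B * d) * 2"
      by (intro mult_mono) (use B in auto)
    then show ?thesis by simp
  qed
  define F where "F z = z * exp (f (1 / z))" for z
  have inv_lt: "norm (1 / z) < 1" "z \<noteq> 0" "z \<noteq> 1" if "z \<in> D0" for z
    using that by (auto simp: D0_def norm_divide divide_less_eq)
  have F_eq: "F z = kap (S (kap z))" if z: "z \<in> D0" for z
  proof -
    have kz: "R (1 / z) = kap z" using inv_lt[OF z] by (simp add: R_def kap_def field_simps)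
    have "exp (f (1 / z)) = 1 / k (1 / z)"
      using exp_f[OF inv_lt(1)[OF z]] by (metis exp_minus inverse_eq_divide inverse_inverse_eq)
    then have "F z = 1 / g (1 / z)" using inv_lt[OF z] by (simp add: F_def k_def)
    then show ?thesis by (simp add: g_def kz kap_def)
  qed
  have Sne: "S w \<noteq> 1" if "w \<in> rhp - {1}" for w using S_eq1[of w] that by auto
  have SI: "S ` (rhp - {1}) = T - {1}"
    using im S_eq1 S1 by auto
  have Fim: "F ` D0 = - (K0 \<union> P)"
  proof -
    have "F ` D0 = kap ` S ` kap ` D0" unfolding image_image by (rule image_cong) (auto simp: F_eq)
    also have "\<dots> = kap ` (T - {1})" by (simp only: kap_image_D0 SI)
    also have "\<dots> = - (K0 \<union> P)"
      by (rule kap_image_Diff[OF T _ P]) (use im S1 in force)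
    finally show ?thesis .
  qed
  have "inj_on (kap \<circ> (S \<circ> kap)) D0"
  proof (intro comp_inj_on)
    show "inj_on kap D0" by (rule inj_on_kap) (auto simp: D0_def)
    show "inj_on S (kap ` D0)" unfolding kap_image_D0 using inj by (rule inj_on_subset) auto
    show "inj_on kap ((S \<circ> kap) ` D0)"
      by (rule inj_on_kap) (use kap_image_D0 Sne in fastforce)
  qed
  then have Finj: "inj_on F D0" by (rule inj_on_cong[THEN iffD1, rotated]) (auto simp: F_eq)
  have Fhol: "F holomorphic_on D0"
  proof -
    have "(f \<circ> (\<lambda>z. 1 / z)) holomorphic_on D0"
      by (rule holomorphic_on_compose_gen[OF _ f_hol]) (use inv_lt in \<open>auto intro!: holomorphic_intros\<close>)
    then show ?thesis unfolding F_def o_def by (auto intro!: holomorphic_intros)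
  qed
  \<comment> \<open>In the variable \<open>w = 1 / z\<close> this is a difference quotient of
    \<open>exp \<circ> f\<close> at 0, so it converges and is bounded.\<close>
  have norm_inf: "\<exists>B. \<forall>\<^sub>F z :: complex in at_infinity. norm (F z - of_real (exp c) * z) \<le> B"
  proof -
    define h where "h z = exp (f z)" for z
    have "h holomorphic_on ball 0 1" unfolding h_def by (intro holomorphic_intros f_hol)
    then have "h field_differentiable (at 0)" by (simp add: holomorphic_on_imp_differentiable_at)
    then have "(h has_field_derivative deriv h 0) (at 0)" by (simp add: field_differentiable_derivI)
    then have "((\<lambda>w. (h w - h 0) / w) \<longlongrightarrow> deriv h 0) (at 0)"
      by (simp add: has_field_derivative_iff)
    moreover have "((\<lambda>z. F z - of_real (exp c) * z) \<circ> inverse) w = (h w - h 0) / w" for w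
      by (simp add: F_def h_def f0 divide_inverse algebra_simps exp_of_real)
    ultimately have "((\<lambda>z. F z - of_real (exp c) * z) \<longlongrightarrow> deriv h 0) at_infinity"
      unfolding lim_at_infinity_0 by (simp add: o_def)
    from tendsto_norm[OF this] have "\<forall>\<^sub>F z in at_infinity. norm (F z - of_real (exp c) * z) < norm (deriv h 0) + 1"
      by (rule order_tendstoD) simp
    then show ?thesis by (auto elim: eventually_mono intro!: exI[of _ "norm (deriv h 0) + 1"])
  qed
  have C: "d\<^sup>2 \<le> 8 * B * c" "c \<le> 8 * B * d\<^sup>2"
    using c c0 B by (auto intro: order_trans)
  have hl: "is_HL_map P F c"
    unfolding is_HL_map_def using Fhol Finj Fim norm_inf by blast
  have "norm (f z) \<le> 8 * B * d" if "norm z < 1" for z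
    using f_bound[OF that] mult_pos_pos[OF B(1,2)] by argo
  then have "hl_map_est P (8 * B) d c f"
    unfolding hl_map_est_def using hl[unfolded F_def[abs_def]] f_hol meas f0 f_Re f_deriv C ab by blast
  then show ?thesis by blast
qed

section \<open>The slit map\<close>

lemma csqrt_Re_pos: "z \<notin> \<real>\<^sub>\<le>\<^sub>0 \<Longrightarrow> 0 < Re (csqrt z)"
proof (rule ccontr)
  assume z: "z \<notin> \<real>\<^sub>\<le>\<^sub>0" and "\<not> 0 < Re (csqrt z)"
  then have "Re (csqrt z) = 0" using csqrt_principal[of z] by auto
  then have "csqrt z = \<i> * of_real (Im (csqrt z))" by (simp add: complex_eq_iff)
  then have "z = (\<i> * of_real (Im (csqrt z)))\<^sup>2" by (metis power2_csqrt)
  then have "z = of_real (- (Im (csqrt z))\<^sup>2)" by (simp add: power_mult_distrib)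
  then have "z \<in> \<real>\<^sub>\<le>\<^sub>0" by (metis nonpos_Reals_of_real_iff neg_le_0_iff_le zero_le_power2)
  with z show False by simp
qed

lemma Re_pos_power2: "0 < Re v \<Longrightarrow> v\<^sup>2 \<notin> \<real>\<^sub>\<le>\<^sub>0"
  by (auto simp: complex_nonpos_Reals_iff power2_eq_square mult_le_0_iff)

lemma Re_inverse_pos: "0 < Re v \<Longrightarrow> 0 < Re (1 / v)"
  by (auto simp: Re_divide power2_eq_square intro!: divide_pos_pos add_pos_nonneg)

lemma norm_plus_ge:
  assumes "0 \<le> Re (x * cnj y)"
  shows "norm x \<le> norm (x + y)" "norm y \<le> norm (x + y)"
proof -
  have e: "(norm (x + y))\<^sup>2 = (norm x)\<^sup>2 + (norm y)\<^sup>2 + 2 * Re (x * cnj y)"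
    unfolding cmod_power2 by (simp add: power2_eq_square algebra_simps)
  show "norm x \<le> norm (x + y)" "norm y \<le> norm (x + y)"
    by (rule power2_le_imp_le; use e assms in simp)+
qed

text \<open>In the half plane the slit is the ray from \<open>1 / t\<close> to infinity. The values
  \<open>(1 / u)^2\<close> fill the plane cut along the nonpositive axis, the affine map fixing 1
  moves the tip of the cut from 0 to \<open>t^2\<close>, and root and inverse lead back to the half
  plane. The estimates hold with \<open>B = 9\<close>, whence \<open>72 = 8 * 9\<close> and
  \<open>d \<le> 1 / 36\<close>.\<close>

lemma slit_estimates:
  assumes d: "0 < d" "d \<le> 1 / 36"
  shows "\<exists>c f. hl_map_est (slit_particle d) 72 d c f"
proof -
  \<comment> \<open>\<open>1 / t\<close> is \<open>kap (1 + d)\<close>, the image of the tip of the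
    slit.\<close>
  define t where "t = d / (2 + d)"
  have t: "0 < t" "t \<le> d / 2" "d / 3 \<le> t" using d by (auto simp: t_def field_simps)
  have t1: "t < 1/2" using t d by linarith
  have t2: "t\<^sup>2 < 1/4" using t t1 power_strict_mono[of t "1/2" 2] by (simp add: power2_eq_square)
  have inv_t: "1 / t = 1 + 2 / d" using d by (simp add: t_def field_simps)
  define c where "c = - ln (1 - t\<^sup>2)"
  define E where "E u = of_real (t\<^sup>2) + of_real (1 - t\<^sup>2) * (1 / u)\<^sup>2" for u :: complex
  define D where "D u = csqrt (E u)" for u
  define S where "S u = 1 / D u" for u
  define S' where "S' u = of_real (1 - t\<^sup>2) * (S u) ^ 3 / u ^ 3" for u
  have ct: "complex_of_real (1 - t\<^sup>2) \<noteq> 0" using t2 by (metis of_real_eq_0_iff diff_gt_0_iff_gt less_trans less_irrefl one_less_numeral_iff semiring_norm(76) divide_less_eq_1_pos zero_less_numeral)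
  have E_np: "E u \<notin> \<real>\<^sub>\<le>\<^sub>0" if u: "0 < Re u" for u
  proof
    assume "E u \<in> \<real>\<^sub>\<le>\<^sub>0"
    then obtain x where x: "E u = of_real x" "x \<le> 0" by (auto elim: nonpos_Reals_cases)
    have "(1 / u)\<^sup>2 = of_real ((x - t\<^sup>2) / (1 - t\<^sup>2))"
      using x(1) ct unfolding E_def of_real_divide of_real_diff[of x] by (simp add: field_simps)
    moreover have "(x - t\<^sup>2) / (1 - t\<^sup>2) \<le> 0" using x(2) t2 by (intro divide_nonpos_pos) (auto intro: order_trans[OF _ zero_le_power2])
    ultimately have "(1/u)\<^sup>2 \<in> \<real>\<^sub>\<le>\<^sub>0" by (metis nonpos_Reals_of_real_iff)
    then show False using Re_pos_power2[OF Re_inverse_pos[OF u]] by simp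
  qed
  have ReD: "0 < Re (D u)" if "0 < Re u" for u
    unfolding D_def by (rule csqrt_Re_pos[OF E_np[OF that]])
  have D0: "D u \<noteq> 0" if "0 < Re u" for u using ReD[OF that] by auto
  have D2: "(D u)\<^sup>2 = E u" for u by (simp add: D_def)
  have ReS: "0 < Re (S u)" if "0 < Re u" for u
    unfolding S_def by (rule Re_inverse_pos[OF ReD[OF that]])
  have u0: "u \<noteq> 0" if "0 < Re u" for u using that by auto
  have S0: "S u \<noteq> 0" if "0 < Re u" for u using ReS[OF that] by auto
  have der: "(S has_field_derivative S' u) (at u)" if u: "0 < Re u" for u
  proof -
    have "(E has_field_derivative of_real (1 - t\<^sup>2) * (- 2 / u ^ 3)) (at u)"
      unfolding E_def using u0[OF u]
      by (auto intro!: derivative_eq_intros simp: power2_eq_square power3_eq_cube field_simps)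
    then have "(D has_field_derivative inverse (2 * D u) * (of_real (1 - t\<^sup>2) * (- 2 / u ^ 3))) (at u)"
      unfolding D_def by (rule DERIV_chain2[where f = csqrt and g = E, OF has_field_derivative_csqrt[OF E_np[OF u]]])
    then have "(S has_field_derivative - (inverse (2 * D u) * (of_real (1 - t\<^sup>2) * (- 2 / u ^ 3))) / (D u)\<^sup>2) (at u)"
      unfolding S_def using D0[OF u]
      by (auto intro!: derivative_eq_intros simp: power2_eq_square)
    also have "- (inverse (2 * D u) * (of_real (1 - t\<^sup>2) * (- 2 / u ^ 3))) / (D u)\<^sup>2 = S' u"
      using D0[OF u] u0[OF u] by (simp add: S'_def S_def power2_eq_square power3_eq_cube field_simps)
    finally show ?thesis .
  qed
  text \<open>\<open>S\<close> keeps the sign of the imaginary part, so that \<open>u\<close> and \<open>S u\<close> never point in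
    opposite directions.\<close>
  have acute: "0 \<le> Re (S u * cnj u)" if u: "0 < Re u" for u
  proof -
    define v where "v = 1 / u"
    have v: "0 < Re v" unfolding v_def by (rule Re_inverse_pos[OF u])
    have "Im ((D u)\<^sup>2) = (1 - t\<^sup>2) * Im (v\<^sup>2)" unfolding D2 E_def v_def[symmetric] by simp
    then have e: "Re (D u) * Im (D u) = (1 - t\<^sup>2) * (Re v * Im v)" by (simp add: power2_eq_square algebra_simps)
    have "0 \<le> Im (D u) * Im v"
    proof -
      have "Im (D u) * Im v = (1 - t\<^sup>2) * Re v * (Im v)\<^sup>2 / Re (D u)"
        proof -
        have "Im (D u) = (1 - t\<^sup>2) * (Re v * Im v) / Re (D u)" unfolding e[symmetric] using ReD[OF u] by simp
        then show ?thesis by (simp add: power2_eq_square)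
      qed
      also have "\<dots> \<ge> 0" using v ReD[OF u] t2 by simp
      finally show ?thesis .
    qed
    then have "0 \<le> Re (D u * cnj v)" using v ReD[OF u] by simp
    moreover have "Re (S u * cnj u) = Re (D u * cnj v) * (norm (S u))\<^sup>2 * (norm u)\<^sup>2"
    proof -
      have su: "S u = cnj (D u) * of_real ((norm (S u))\<^sup>2)"
      proof -
        have "complex_of_real ((norm (S u))\<^sup>2) = 1 / of_real ((norm (D u))\<^sup>2)"
          by (simp add: S_def norm_divide power_divide)
        then show ?thesis using D0[OF u] by (simp only: complex_norm_square) (simp add: S_def)
      qed
      have uu: "cnj u = v * of_real ((norm u)\<^sup>2)"
        using u0[OF u] unfolding v_def complex_norm_square by simp
      have "S u * cnj u = cnj (D u * cnj v) * of_real ((norm (S u))\<^sup>2 * (norm u)\<^sup>2)"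
        by (subst su, subst uu) (simp add: mult_ac)
      then show ?thesis by (simp add: algebra_simps)
    qed
    ultimately show ?thesis by simp
  qed
  \<comment> \<open>Both estimates rest on this identity between squares. The non-obtuse angle
    between \<open>u\<close> and \<open>S u\<close> then allows division by \<open>S u + u\<close>
    in \<open>k1\<close> and a square root in \<open>q\<close>.\<close>
  have key: "u\<^sup>2 - (S u)\<^sup>2 = (S u)\<^sup>2 * of_real (t\<^sup>2) * (u\<^sup>2 - 1)" if u: "0 < Re u" for u
  proof -
    have "1 / (S u)\<^sup>2 = E u" unfolding S_def by (simp add: power_divide D2)
    then have "u\<^sup>2 = (S u)\<^sup>2 * (of_real (t\<^sup>2) * u\<^sup>2 + of_real (1 - t\<^sup>2))"
      using S0[OF u] u0[OF u] by (simp add: E_def field_simps)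
    then show ?thesis by (simp add: algebra_simps)
  qed
  have inj: "inj_on S rhp"
  proof (rule inj_onI)
    fix x y assume xy: "x \<in> rhp" "y \<in> rhp" "S x = S y"
    then have "D x = D y" by (simp add: S_def)
    then have "E x = E y" using D2 by metis
    then have "(1/x)\<^sup>2 = (1/y)\<^sup>2" using ct by (simp add: E_def)
    then have "1/x = 1/y \<or> 1/x = - (1/y)" by (simp add: power2_eq_iff)
    moreover have "1/x \<noteq> - (1/y)"
      using Re_inverse_pos[of x] Re_inverse_pos[of y] xy by (metis add.inverse_inverse less_asym mem_Collect_eq neg_less_0_iff_less uminus_complex.sel(1))
    ultimately show "x = y" by simp
  qed
  define T where "T = rhp - {of_real x | x. 1 / t \<le> x}"
  have im: "S ` rhp = T"
  proof (intro equalityI subsetI)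
    fix w assume "w \<in> S ` rhp"
    then obtain u where u: "0 < Re u" "w = S u" by auto
    have "w \<noteq> of_real x" if x: "1 / t \<le> x" for x
    proof
      assume w: "w = of_real x"
      have x0: "0 < x" using x t by (smt (verit) zero_less_divide_1_iff)
      have "D u = of_real (1/x)" using w u(2) D0[OF u(1)] x0 by (simp add: S_def field_simps)
      then have "E u = of_real ((1/x)\<^sup>2)" using D2[of u] by simp
      then have "(1/u)\<^sup>2 = of_real (((1/x)\<^sup>2 - t\<^sup>2) / (1 - t\<^sup>2))"
        using ct unfolding E_def of_real_divide of_real_diff[of "(1/x)\<^sup>2"] by (simp add: field_simps)
      moreover have "((1/x)\<^sup>2 - t\<^sup>2) / (1 - t\<^sup>2) \<le> 0"
      proof -
        have "1/x \<le> t" using x t x0 by (simp add: field_simps)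
        then have "(1/x)\<^sup>2 \<le> t\<^sup>2" using x0 by (intro power_mono) auto
        then show ?thesis using t2 by (simp add: divide_le_0_iff)
      qed
      ultimately have "(1/u)\<^sup>2 \<in> \<real>\<^sub>\<le>\<^sub>0" by (metis nonpos_Reals_of_real_iff)
      then show False using Re_pos_power2[OF Re_inverse_pos[OF u(1)]] by simp
    qed
    then show "w \<in> T" using ReS[OF u(1)] u(2) by (auto simp: T_def)
  next
    fix w assume "w \<in> T"
    then have w: "0 < Re w" "\<And>x. 1 / t \<le> x \<Longrightarrow> w \<noteq> of_real x" by (auto simp: T_def)
    define y where "y = ((1/w)\<^sup>2 - of_real (t\<^sup>2)) / of_real (1 - t\<^sup>2)"
    have ynp: "y \<notin> \<real>\<^sub>\<le>\<^sub>0"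
    proof
      assume "y \<in> \<real>\<^sub>\<le>\<^sub>0"
      then obtain s where s: "y = of_real s" "s \<le> 0" by (auto elim: nonpos_Reals_cases)
      define r where "r = s * (1 - t\<^sup>2) + t\<^sup>2"
      have wr: "(1/w)\<^sup>2 = of_real r" using s(1) ct unfolding y_def r_def by (simp add: field_simps)
      have "(1/w)\<^sup>2 \<notin> \<real>\<^sub>\<le>\<^sub>0" by (rule Re_pos_power2[OF Re_inverse_pos[OF w(1)]])
      then have r0: "0 < r" unfolding wr by (metis nonpos_Reals_of_real_iff not_le)
      have "(1/w)\<^sup>2 = (of_real (sqrt r))\<^sup>2" using r0 wr by (simp flip: of_real_power)
      then have "1/w = of_real (sqrt r) \<or> 1/w = - of_real (sqrt r)" by (simp add: power2_eq_iff)
      moreover have "1/w \<noteq> - of_real (sqrt r)"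
      proof
        assume "1/w = - of_real (sqrt r)"
        then have "Re (1/w) = - sqrt r" by (metis Re_complex_of_real uminus_complex.sel(1))
        then show False using Re_inverse_pos[OF w(1)] r0 real_sqrt_gt_zero[OF r0] by linarith
      qed
      ultimately have "w = of_real (1 / sqrt r)" using u0[OF w(1)] r0 by (auto simp: field_simps)
      moreover have "sqrt r \<le> t"
      proof -
        have "s * (1 - t\<^sup>2) \<le> 0" using s(2) t2 by (simp add: mult_nonpos_nonneg)
        then have "r \<le> t\<^sup>2" by (simp add: r_def)
        then show ?thesis using t by (metis real_sqrt_le_mono real_sqrt_unique less_imp_le)
      qed
      then have "1 / t \<le> 1 / sqrt r" using r0 by (simp add: frac_le)
      ultimately show False using w(2) by blast
    qed
    define u where "u = 1 / csqrt y"
    have u: "0 < Re u" unfolding u_def by (rule Re_inverse_pos[OF csqrt_Re_pos[OF ynp]])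
    have "(1/u)\<^sup>2 = y" by (simp add: u_def)
    then have "E u = (1/w)\<^sup>2" using ct by (simp add: E_def y_def)
    then have "(D u)\<^sup>2 = (1/w)\<^sup>2" by (simp add: D2)
    then have "D u = 1/w \<or> D u = - (1/w)" by (simp add: power2_eq_iff)
    moreover have "D u \<noteq> - (1/w)"
      using ReD[OF u] Re_inverse_pos[OF w(1)] by (metis add.inverse_inverse less_asym neg_less_0_iff_less uminus_complex.sel(1))
    ultimately have "S u = w" by (simp add: S_def)
    then show "w \<in> S ` rhp" using u by auto
  qed
  have E1: "E 1 = 1" by (simp add: E_def)
  have S1: "S 1 = 1" by (simp add: S_def D_def E1)
  have S'1: "S' 1 = of_real (exp (- c))" using t2 by (simp add: S'_def S1 c_def)
  have P0: "slit_particle d \<subseteq> D0" by (auto simp: slit_particle_def D0_def)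
  have kP: "kap ` slit_particle d = rhp - T"
  proof -
    have eq: "rhp - T = {of_real x | x. 1 / t \<le> x}"
      using t by (auto simp: T_def) (smt (verit) zero_less_divide_1_iff)
    have kr: "kap (of_real x) = of_real (1 + 2 / (x - 1))" if "1 < x" for x
    proof -
      have "kap (of_real x) = of_real ((x + 1) / (x - 1))" by (simp add: kap_def)
      also have "(x + 1) / (x - 1) = 1 + 2 / (x - 1)" using that by (simp add: field_simps)
      finally show ?thesis .
    qed
    show ?thesis unfolding eq
    proof (intro equalityI subsetI)
      fix w assume "w \<in> kap ` slit_particle d"
      then obtain x where x: "1 < x" "x \<le> 1 + d" "w = kap (of_real x)" by (auto simp: slit_particle_def)
      have "1 / t \<le> 1 + 2 / (x - 1)" unfolding inv_t using x d by (simp add: frac_le)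
      then show "w \<in> {of_real x | x. 1 / t \<le> x}"
        using kr[OF x(1)] x(3) by (intro CollectI exI[of _ "1 + 2 / (x - 1)"]) auto
    next
      fix w :: complex assume "w \<in> {of_real x | x. 1 / t \<le> x}"
      then obtain y where y: "1 + 2 / d \<le> y" "w = of_real y" unfolding inv_t by auto
      have y1: "1 < y" using y d by (smt (verit) divide_pos_pos)
      define x where "x = 1 + 2 / (y - 1)"
      have "2 / (y - 1) \<le> d" using y y1 d by (simp add: field_simps)
      then have "of_real x \<in> slit_particle d" using y1 unfolding slit_particle_def by (intro CollectI exI[of _ x]) (auto simp: x_def)
      moreover have "kap (of_real x) = w"
      proof -
        have "1 < x" using y1 by (simp add: x_def)
        from kr[OF this] show ?thesis using y y1 by (simp add: x_def field_simps)
      qed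
      ultimately show "w \<in> kap ` slit_particle d" by auto
    qed
  qed
  have k1: "2 * norm (S R - R) \<le> 9 * d * norm (S R + 1) * norm (R - 1)" if R: "0 < Re R" for R
  proof -
    let ?s = "S R"
    have sum1: "norm ?s \<le> norm (?s + R)" "norm R \<le> norm (?s + R)" by (rule norm_plus_ge[OF acute[OF R]])+
    have s1: "norm ?s \<le> norm (?s + 1)" using norm_plus_ge(1)[of ?s 1] ReS[OF R] by simp
    have sR: "?s + R \<noteq> 0" using sum1 u0[OF R] by auto
    have f: "(R - ?s) * (R + ?s) = ?s * ?s * of_real (t\<^sup>2) * ((R - 1) * (R + 1))"
      using key[OF R] by (simp add: power2_eq_square algebra_simps)
    have n: "norm (?s - R) * norm (?s + R) = norm ?s * norm ?s * t\<^sup>2 * (norm (R - 1) * norm (R + 1))"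
      using arg_cong[OF f, of norm] by (simp add: norm_mult norm_minus_commute norm_power add.commute)
    \<comment> \<open>\<open>S\<close> sends infinity to \<open>1 / t\<close>. So either
      \<open>R\<close> has norm at most \<open>2 / t\<close>, or it is far out and then
      \<open>S R\<close> has.\<close>
    have prod: "norm ?s * norm R \<le> 2 / t * norm (?s + R)"
    proof (cases "norm R \<le> 2 / t")
      case True
      have "norm ?s * norm R \<le> norm (?s + R) * (2 / t)" by (intro mult_mono sum1 True) auto
      then show ?thesis by (simp add: mult.commute)
    next
      case False
      have "1 / (norm ?s)\<^sup>2 = norm (E R)"
      proof -
        have "1 / ?s\<^sup>2 = E R" unfolding S_def by (simp add: power_divide D2)
        then show ?thesis by (metis norm_divide norm_one norm_power)
      qed
      also have "\<dots> \<ge> t\<^sup>2 - (1 - t\<^sup>2) * (norm (1 / R))\<^sup>2"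
      proof -
        have "norm (of_real (t\<^sup>2) :: complex) - norm (of_real (1 - t\<^sup>2) * (1/R)\<^sup>2) \<le> norm (E R)"
          unfolding E_def by (rule norm_diff_ineq)
        then show ?thesis using t2 unfolding norm_mult norm_power norm_of_real by simp
      qed
      finally have a: "t\<^sup>2 - (1 - t\<^sup>2) * (norm (1 / R))\<^sup>2 \<le> 1 / (norm ?s)\<^sup>2" by simp
      have "norm (1 / R) \<le> t / 2" using False t u0[OF R] by (simp add: norm_divide field_simps)
      then have "(norm (1 / R))\<^sup>2 \<le> (t/2)\<^sup>2" by (intro power_mono) auto
      then have "(1 - t\<^sup>2) * (norm (1 / R))\<^sup>2 \<le> 1 * (t/2)\<^sup>2" using t2 by (intro mult_mono) auto
      moreover have "(t/2)\<^sup>2 = t\<^sup>2 / 4" by (simp add: power_divide)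
      ultimately have b: "t\<^sup>2 / 4 \<le> 1 / (norm ?s)\<^sup>2" using a zero_le_power2[of t] by linarith
      have ns: "0 < norm ?s" using S0[OF R] by simp
      have "t\<^sup>2 / 4 * (norm ?s)\<^sup>2 \<le> 1" using b ns by (simp only: le_divide_eq zero_less_power if_True)
      then have "(t * norm ?s / 2)\<^sup>2 \<le> 1" by (simp add: power_mult_distrib power_divide)
      then have "t * norm ?s / 2 \<le> 1" using t ns by (simp add: abs_square_le_1)
      then have "norm ?s \<le> 2 / t" using t by (simp add: field_simps)
      then have "norm ?s * norm R \<le> 2 / t * norm (?s + R)" by (rule mult_mono[OF _ sum1(2)]) (use t in auto)
      then show ?thesis .
    qed
    have "norm ?s * norm (R + 1) \<le> norm ?s * (norm R + 1)"
      using norm_triangle_ineq[of R 1] by (intro mult_left_mono) auto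
    also have "\<dots> \<le> 2 / t * norm (?s + R) + norm (?s + R)" using prod sum1(1) by (simp add: algebra_simps)
    finally have "norm ?s * norm (R + 1) \<le> (2 / t + 1) * norm (?s + R)" by (simp add: algebra_simps)
    then have "norm ?s * (norm ?s * norm (R + 1)) \<le> norm (?s + 1) * ((2 / t + 1) * norm (?s + R))"
      by (rule mult_mono[OF s1]) auto
    then have "norm (R - 1) * t\<^sup>2 * (norm ?s * (norm ?s * norm (R + 1)))
        \<le> norm (R - 1) * t\<^sup>2 * (norm (?s + 1) * ((2 / t + 1) * norm (?s + R)))"
      by (rule mult_left_mono) auto
    then have "norm (?s - R) * norm (?s + R) \<le> (norm (R - 1) * t\<^sup>2 * (norm (?s + 1) * (2 / t + 1))) * norm (?s + R)"
      unfolding n by (simp add: mult_ac)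
    then have "norm (?s - R) \<le> norm (R - 1) * t\<^sup>2 * (norm (?s + 1) * (2 / t + 1))"
      using sR by (simp add: mult_le_cancel_right)
    also have "\<dots> = (2 * t + t\<^sup>2) * (norm (?s + 1) * norm (R - 1))" using t by (simp add: field_simps power2_eq_square)
    also have "\<dots> \<le> (3 * t) * (norm (?s + 1) * norm (R - 1))"
    proof (rule mult_right_mono)
      show "2 * t + t\<^sup>2 \<le> 3 * t" using t t1 by (simp add: power2_eq_square mult_left_le)
    qed auto
    finally have "2 * norm (?s - R) \<le> (6 * t) * (norm (?s + 1) * norm (R - 1))" by linarith
    also have "\<dots> \<le> (9 * d) * (norm (?s + 1) * norm (R - 1))" by (rule mult_right_mono) (use t d in auto)
    finally show ?thesis by (simp add: mult.assoc)
  qed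
  \<comment> \<open>\<open>a\<close> and \<open>cnj a\<close> are the zeros of
    \<open>t^2 * R^2 + 1 - t^2\<close> seen in the variable \<open>z\<close>. There \<open>S\<close>
    becomes infinite, that is, \<open>F\<close> takes the value 1.\<close>
  define a where "a = Complex (1 - 2 * t\<^sup>2) (2 * t * sqrt (1 - t\<^sup>2))"
  have sq: "(sqrt (1 - t\<^sup>2))\<^sup>2 = 1 - t\<^sup>2" using t2 by simp
  have na: "norm a = 1"
  proof -
    have "(2 * t * sqrt (1 - t\<^sup>2))\<^sup>2 = 4 * t\<^sup>2 * (1 - t\<^sup>2)" unfolding power_mult_distrib sq by simp
    then have "(norm a)\<^sup>2 = 1" unfolding a_def complex_norm by (simp add: power2_eq_square algebra_simps)
    then show ?thesis using power2_eq_imp_eq[of "norm a" 1] by simp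
  qed
  have ab_prod: "(z - a) * (z - cnj a) = (1 - z)\<^sup>2 + 4 * of_real (t\<^sup>2) * z" for z
  proof -
    have "(z - a) * (z - cnj a) = z\<^sup>2 - of_real (2 * Re a) * z + of_real ((norm a)\<^sup>2)"
      unfolding complex_norm_square complex_add_cnj[symmetric] by (simp add: power2_eq_square algebra_simps)
    then show ?thesis unfolding na by (simp add: a_def power2_eq_square algebra_simps)
  qed
  have q: "norm (1 - S' R * (R\<^sup>2 - 1) / ((S R)\<^sup>2 - 1)) * min (norm (z - a)) (norm (z - cnj a)) \<le> 9 * d"
    if z: "norm z < 1" "z \<noteq> 0" and Rz: "R = (1 + z) / (1 - z)" and R: "0 < Re R" for z R
  proof -
    have z1: "1 - z \<noteq> 0" using z by auto
    have "R\<^sup>2 - 1 = 4 * z / (1 - z)\<^sup>2"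
      using z1 unfolding Rz by (simp add: power_divide divide_simps) (simp add: power2_eq_square algebra_simps)
    then have R1n: "R\<^sup>2 - 1 \<noteq> 0" using z z1 by simp
    \<comment> \<open>The expression collapses to \<open>1 - Q\<close>. Its companion
      \<open>1 - Q^2\<close> is rational with simple poles at \<open>a\<close> and
      \<open>cnj a\<close>, and \<open>0 \<le> Re Q\<close> gives
      \<open>norm (1 - Q)^2 \<le> norm (1 - Q^2)\<close>. The square of the smaller distance is at
      most the product of both, so taking roots finishes the estimate.\<close>
    define Q where "Q = S R / R"
    have "(S R)\<^sup>2 - 1 = (S R)\<^sup>2 * of_real (1 - t\<^sup>2) * (R\<^sup>2 - 1) / R\<^sup>2"
      using key[OF R] u0[OF R] by (simp add: field_simps)
    then have Qeq: "S' R * (R\<^sup>2 - 1) / ((S R)\<^sup>2 - 1) = Q"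
      using S0[OF R] u0[OF R] R1n ct by (simp add: S'_def Q_def power2_eq_square power3_eq_cube)
    have ReQ: "0 \<le> Re Q"
    proof -
      have "Re Q = Re (S R * cnj R) / (norm R)\<^sup>2" unfolding Q_def by (subst complex_div_cnj) simp
      then show ?thesis using acute[OF R] by simp
    qed
    have "norm (1 - Q) \<le> norm (1 + Q)"
    proof (rule power2_le_imp_le)
      show "(norm (1 - Q))\<^sup>2 \<le> (norm (1 + Q))\<^sup>2"
        unfolding cmod_power2 using ReQ by (simp add: power2_eq_square algebra_simps)
    qed auto
    then have "(norm (1 - Q))\<^sup>2 \<le> norm (1 - Q) * norm (1 + Q)"
      unfolding power2_eq_square by (rule mult_left_mono) auto
    also have "\<dots> = norm (1 - Q\<^sup>2)" by (simp add: norm_mult[symmetric] power2_eq_square algebra_simps)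
    finally have le: "(norm (1 - Q))\<^sup>2 \<le> norm (1 - Q\<^sup>2)" .
    have "(1 - Q\<^sup>2) * ((z - a) * (z - cnj a)) = 4 * of_real (t\<^sup>2) * z"
    proof -
      have den: "(1 - z)\<^sup>2 * (of_real (t\<^sup>2) * R\<^sup>2 + of_real (1 - t\<^sup>2)) = (z - a) * (z - cnj a)"
      proof -
        have "(1 - z)\<^sup>2 * R\<^sup>2 = (1 + z)\<^sup>2" using z1 by (simp add: Rz power_divide)
        moreover have "(1 - z)\<^sup>2 * (of_real (t\<^sup>2) * R\<^sup>2 + of_real (1 - t\<^sup>2))
            = of_real (t\<^sup>2) * ((1 - z)\<^sup>2 * R\<^sup>2) + of_real (1 - t\<^sup>2) * (1 - z)\<^sup>2"
          by (simp add: algebra_simps)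
        ultimately show ?thesis unfolding ab_prod by (simp add: power2_eq_square algebra_simps)
      qed
      have SR: "(S R)\<^sup>2 * (of_real (t\<^sup>2) * R\<^sup>2 + of_real (1 - t\<^sup>2)) = R\<^sup>2"
        using key[OF R] by (simp add: algebra_simps)
      have "Q\<^sup>2 * (of_real (t\<^sup>2) * R\<^sup>2 + of_real (1 - t\<^sup>2)) = 1"
        using SR u0[OF R] by (simp add: Q_def power_divide)
      then have "Q\<^sup>2 * ((z - a) * (z - cnj a)) = (1 - z)\<^sup>2"
        unfolding den[symmetric] by (simp add: mult_ac)
      moreover have "(1 - Q\<^sup>2) * ((z - a) * (z - cnj a)) = (z - a) * (z - cnj a) - Q\<^sup>2 * ((z - a) * (z - cnj a))"
        by (simp only: left_diff_distrib mult_1)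
      ultimately have "(1 - Q\<^sup>2) * ((z - a) * (z - cnj a)) = (z - a) * (z - cnj a) - (1 - z)\<^sup>2" by (simp only:)
      then show ?thesis unfolding ab_prod by simp
    qed
    from arg_cong[OF this, of norm]
    have n: "norm (1 - Q\<^sup>2) * (norm (z - a) * norm (z - cnj a)) = 4 * t\<^sup>2 * norm z"
      by (simp add: norm_mult norm_power)
    let ?m = "min (norm (z - a)) (norm (z - cnj a))"
    have "(norm (1 - Q) * ?m)\<^sup>2 = (norm (1 - Q))\<^sup>2 * (?m * ?m)" by (simp add: power2_eq_square mult_ac)
    also have "\<dots> \<le> norm (1 - Q\<^sup>2) * (norm (z - a) * norm (z - cnj a))"
      by (intro mult_mono le) auto
    also have "\<dots> \<le> 4 * t\<^sup>2 * 1" unfolding n by (rule mult_left_mono) (use z in auto)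
    also have "\<dots> = (2 * t)\<^sup>2" by (simp add: power2_eq_square)
    finally have "norm (1 - Q) * ?m \<le> 2 * t" by (rule power2_le_imp_le) (use t in auto)
    then show ?thesis unfolding Qeq using t d by simp
  qed
  have cl: "t\<^sup>2 \<le> c" "c \<le> 2 * t\<^sup>2"
  proof -
    show "t\<^sup>2 \<le> c" using ln_le_minus_one[of "1 - t\<^sup>2"] t2 by (simp add: c_def)
    have "c = ln (1 / (1 - t\<^sup>2))" using t2 by (simp add: c_def ln_div)
    also have "\<dots> \<le> 1 / (1 - t\<^sup>2) - 1" using t2 by (intro ln_le_minus_one) auto
    also have "\<dots> = t\<^sup>2 / (1 - t\<^sup>2)" using t2 by (simp add: field_simps)
    also have "\<dots> \<le> t\<^sup>2 / (1/2)" using t2 by (intro divide_left_mono) auto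
    finally show "c \<le> 2 * t\<^sup>2" by simp
  qed
  have "(d/3)\<^sup>2 \<le> t\<^sup>2" "t\<^sup>2 \<le> (d/2)\<^sup>2" using t d by (auto intro!: power_mono)
  then have cb: "d\<^sup>2 \<le> 9 * c" "c \<le> 9 * d\<^sup>2" using cl by (auto simp: power_divide)
  have T: "T \<subseteq> rhp" by (auto simp: T_def)
  have "\<exists>f. hl_map_est (slit_particle d) (8 * 9) d c f"
    by (rule hl_map_from_halfplane[OF der inj im T S1 S'1 P0 kP _ _ _ _ k1 na _ q cb])
       (use d na in auto)
  then show ?thesis by auto
qed

section \<open>The disc map\<close>

text \<open>With \<open>Re_tan_pos\<close> this identifies the image of the right half plane under
  \<open>Arctan\<close> as the strip \<open>0 < Re s < pi / 2\<close>.\<close>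

lemma Re_Arctan_pos:
  assumes "0 < Re w"
  shows "0 < Re (Arctan w)" "Re (Arctan w) < pi / 2"
proof -
  have n0: "1 + \<i> * w \<noteq> 0"
  proof
    assume "1 + \<i> * w = 0"
    then have "Im (1 + \<i> * w) = 0" by (simp only: zero_complex.sel)
    then show False using assms by simp
  qed
  have "Im ((1 - \<i> * w) / (1 + \<i> * w)) = Im ((1 - \<i> * w) * cnj (1 + \<i> * w)) / (norm (1 + \<i> * w))\<^sup>2"
    by (subst complex_div_cnj) simp
  also have "Im ((1 - \<i> * w) * cnj (1 + \<i> * w)) = - 2 * Re w" by (simp add: algebra_simps)
  finally have im: "Im ((1 - \<i> * w) / (1 + \<i> * w)) < 0"
    using assms n0 by (simp add: divide_neg_pos)
  then have "(1 - \<i> * w) / (1 + \<i> * w) \<noteq> 0" by auto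
  then have "Im (Ln ((1 - \<i> * w) / (1 + \<i> * w))) < 0" using im Im_Ln_pos_le Im_Ln_le_pi by (smt (verit))
  then show "0 < Re (Arctan w)" by (simp add: Arctan_def)
  show "Re (Arctan w) < pi / 2" using Re_Arctan_bounds[of w] assms by auto
qed

lemma Re_tan_pos:
  assumes "0 < Re s" "Re s < pi / 2"
  shows "0 < Re (tan s)"
proof (rule ccontr)
  assume neg: "\<not> 0 < Re (tan s)"
  have s: "Arctan (tan s) = s" using assms by (intro Arctan_tan) auto
  have n0: "cos s \<noteq> 0"
  proof
    assume "cos s = 0"
    then have "Re (cos s) = 0" by simp
    then have "cos (Re s) * cosh (Im s) = 0" by (simp add: Re_cos cosh_def)
    then have "cos (Re s) = 0" by (simp add: less_imp_neq[OF cosh_real_pos, symmetric])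
    moreover have "0 < cos (Re s)" using assms by (intro cos_gt_zero_pi) auto
    ultimately show False by simp
  qed
  have "Re (tan s) = Re (sin s * cnj (cos s)) / (norm (cos s))\<^sup>2"
    unfolding tan_def by (subst complex_div_cnj) simp
  also have "Re (sin s * cnj (cos s)) = sin (Re s) * cos (Re s) * ((cosh (Im s))\<^sup>2 - (sinh (Im s))\<^sup>2)"
    by (simp add: Re_sin Re_cos Im_sin Im_cos cosh_def sinh_def power2_eq_square algebra_simps)
      (simp add: field_simps)
  also have "(cosh (Im s))\<^sup>2 - (sinh (Im s))\<^sup>2 = 1" by (simp add: hyperbolic_pythagoras)
  finally have "Re (tan s) = sin (Re s) * cos (Re s) / (norm (cos s))\<^sup>2" by simp
  moreover have "0 < sin (Re s)" "0 < cos (Re s)"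
    using assms by (auto intro: sin_gt_zero cos_gt_zero)
  ultimately show False using neg n0 by simp
qed

text \<open>The disc touches the unit circle at 1, so \<open>kap\<close> maps it to the half plane
  \<open>1 / t \<le> Re w\<close>, and what remains is a strip of width \<open>1 / t\<close>.
  \<open>Arctan\<close> maps onto a strip, \<open>al\<close> adjusts the width, and
  \<open>\<tau> = tan al\<close> makes 1 a fixed point. The estimates hold with
  \<open>B = 500\<close>, whence \<open>4000 = 8 * 500\<close>.\<close>

lemma disc_estimates:
  assumes d: "0 < d" "d \<le> 1 / 2000"
  shows "\<exists>c f. hl_map_est (disc_particle d) 4000 d c f"
proof -
  define t where "t = d / (2 + d)"
  have t: "0 < t" "t \<le> d / 2" "d / 3 \<le> t" using d by (auto simp: t_def field_simps)
  have inv_t: "1 / t = 1 + 2 / d" using d by (simp add: t_def field_simps)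
  define al where "al = pi * t / 2"
  have pi_b: "3 < pi" "pi < 4" using pi_gt3 pi_less_4 by auto
  have al: "0 < al" "t \<le> al" "al \<le> d" "al < pi / 4" "al * 2 / pi = t"
  proof -
    show "0 < al" using t by (simp add: al_def)
    have "2 * t \<le> pi * t" by (rule mult_right_mono) (use pi_b t in auto)
    then show "t \<le> al" by (simp add: al_def)
    have "pi * t \<le> 4 * (d/2)" by (rule mult_mono) (use pi_b t in auto)
    then show "al \<le> d" by (simp add: al_def)
    then show "al < pi / 4" using d pi_b by linarith
    show "al * 2 / pi = t" by (simp add: al_def)
  qed
  define \<tau> where "\<tau> = tan al"
  have at: "arctan \<tau> = al" unfolding \<tau>_def using al by (intro arctan_tan) auto
  have \<tau>1: "0 < \<tau>" "\<tau> < 1"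
  proof -
    show "0 < \<tau>" unfolding \<tau>_def using al by (intro tan_gt_zero) auto
    show "\<tau> < 1" using tan_monotone[of al "pi/4"] al by (simp add: \<tau>_def tan_45)
  qed
  have mvt: "\<exists>\<xi>. a < \<xi> \<and> \<xi> < b \<and> arctan b - arctan a = (b - a) * inverse (1 + \<xi>\<^sup>2)" if "a < b" for a b
    using MVT2[OF that DERIV_arctan] by auto
  have sqm: "x\<^sup>2 \<le> y\<^sup>2" if "0 \<le> x" "x \<le> y" for x y :: real using that by (intro power_mono)
  have al_\<tau>: "al \<le> \<tau>" "\<tau> \<le> al * (1 + \<tau>\<^sup>2)" "\<tau> \<le> 2 * al" "\<tau> \<le> 2 * d"
  proof -
    obtain \<xi> where xi: "0 < \<xi>" "\<xi> < \<tau>" "al = \<tau> * inverse (1 + \<xi>\<^sup>2)" using mvt[of 0 \<tau>] \<tau>1 at by auto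
    have e: "\<tau> = al * (1 + \<xi>\<^sup>2)" using xi(3) by (simp add: field_simps add_pos_nonneg[THEN less_imp_neq, symmetric])
    then have e': "\<tau> = al + al * \<xi>\<^sup>2" by (simp add: algebra_simps)
    show "al \<le> \<tau>" using e' al(1) by (smt (verit) mult_nonneg_nonneg zero_le_power2)
    show b: "\<tau> \<le> al * (1 + \<tau>\<^sup>2)" by (subst e) (use sqm[of \<xi> \<tau>] xi al in \<open>auto intro!: mult_left_mono\<close>)
    have "al * (1 + \<tau>\<^sup>2) \<le> al * (1 + 1)" by (rule mult_left_mono) (use sqm[of \<tau> 1] \<tau>1 al in auto)
    with b show "\<tau> \<le> 2 * al" by simp
    with al show "\<tau> \<le> 2 * d" by simp
  qed
  define \<rho> where "\<rho> = \<tau> / al / (1 + \<tau>\<^sup>2)"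
  have \<tau>2: "0 < 1 + \<tau>\<^sup>2" by (simp add: add_pos_nonneg)
  have \<rho>0: "0 < \<rho>" using \<tau>1 al \<tau>2 by (simp add: \<rho>_def)
  define c where "c = - ln \<rho>"
  have inv\<rho>: "1 / \<rho> = al * (1 + \<tau>\<^sup>2) / \<tau>" using \<tau>1 al \<tau>2 by (simp add: \<rho>_def)
  have cl: "\<tau>\<^sup>2 / 5 \<le> c" "c \<le> \<tau>\<^sup>2"
  proof -
    have c_eq: "c = ln (1 / \<rho>)" using \<rho>0 by (simp add: c_def ln_div)
    have "1 / \<rho> \<le> 1 + \<tau>\<^sup>2" unfolding inv\<rho> using al_\<tau>(1) \<tau>1 \<tau>2 by (simp add: divide_le_eq mult.commute)
    then show "c \<le> \<tau>\<^sup>2" using ln_le_minus_one[of "1 / \<rho>"] \<rho>0 c_eq by simp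
    \<comment> \<open>The mean value theorem on the whole interval from 0 to \<open>\<tau>\<close>
      would only give \<open>1 \<le> 1 / \<rho>\<close>. Splitting at \<open>\<tau> / 2\<close>
      gains a multiple of \<open>\<tau>^2\<close>, which becomes the lower bound for
      \<open>c\<close>.\<close>
    obtain x where x: "0 < x" "x < \<tau>/2" "arctan (\<tau>/2) = \<tau>/2 * inverse (1 + x\<^sup>2)" using mvt[of 0 "\<tau>/2"] \<tau>1 by auto
    obtain y where y: "\<tau>/2 < y" "y < \<tau>" "al - arctan (\<tau>/2) = \<tau>/2 * inverse (1 + y\<^sup>2)"
      using mvt[of "\<tau>/2" \<tau>] \<tau>1 at by (auto simp: field_simps)
    have "inverse (1 + (\<tau>/2)\<^sup>2) \<le> inverse (1 + x\<^sup>2)" "inverse (1 + \<tau>\<^sup>2) \<le> inverse (1 + y\<^sup>2)"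
      using sqm[of x "\<tau>/2"] sqm[of y \<tau>] x y \<tau>1 by (auto intro!: le_imp_inverse_le add_pos_nonneg)
    then have "\<tau>/2 * inverse (1 + (\<tau>/2)\<^sup>2) + \<tau>/2 * inverse (1 + \<tau>\<^sup>2) \<le> al"
      using x y \<tau>1 by (smt (verit) mult_left_mono)
    then have "(\<tau>/2 * inverse (1 + (\<tau>/2)\<^sup>2) + \<tau>/2 * inverse (1 + \<tau>\<^sup>2)) * (1 + \<tau>\<^sup>2) / \<tau> \<le> 1 / \<rho>"
      unfolding inv\<rho> using \<tau>1 \<tau>2 by (intro divide_right_mono mult_right_mono) auto
    moreover have "(\<tau>/2 * inverse (1 + (\<tau>/2)\<^sup>2) + \<tau>/2 * inverse (1 + \<tau>\<^sup>2)) * (1 + \<tau>\<^sup>2) / \<tau>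
        = ((1 + \<tau>\<^sup>2) / (1 + (\<tau>/2)\<^sup>2) + 1) / 2"
    proof -
      have "(\<tau>/2 * inverse A + \<tau>/2 * inverse B) * B / \<tau> = (B / A + 1) / 2" if "A \<noteq> 0" "B \<noteq> 0" for A B
        using \<tau>1 that by (simp add: field_simps)
      moreover have "1 + (\<tau>/2)\<^sup>2 \<noteq> 0" by (smt (verit) zero_le_power2)
      ultimately show ?thesis using \<tau>2 by simp
    qed
    moreover have "1 + 3/5 * \<tau>\<^sup>2 \<le> (1 + \<tau>\<^sup>2) / (1 + (\<tau>/2)\<^sup>2)"
    proof -
      have "(1 + 3/5 * \<tau>\<^sup>2) * (1 + (\<tau>/2)\<^sup>2) = 1 + (3/5 + 1/4) * \<tau>\<^sup>2 + 3/20 * (\<tau>\<^sup>2 * \<tau>\<^sup>2)"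
        by (simp add: power_divide field_simps)
      also have "\<tau>\<^sup>2 * \<tau>\<^sup>2 \<le> \<tau>\<^sup>2 * 1" using sqm[of \<tau> 1] \<tau>1 by (intro mult_left_mono) auto
      finally have "(1 + 3/5 * \<tau>\<^sup>2) * (1 + (\<tau>/2)\<^sup>2) \<le> 1 + \<tau>\<^sup>2" by simp
      then show ?thesis by (subst le_divide_eq) (smt (verit) zero_le_power2)
    qed
    ultimately have "1 + 3/5 * \<tau>\<^sup>2 \<le> (1 + \<tau>\<^sup>2) / (1 + (\<tau>/2)\<^sup>2)"
      "((1 + \<tau>\<^sup>2) / (1 + (\<tau>/2)\<^sup>2) + 1) / 2 \<le> 1 / \<rho>" by simp_all
    moreover have "1 + 3/10 * x \<le> z" if "1 + 3/5 * x \<le> y" "(y + 1) / 2 \<le> z" for x y z :: real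
      using that by (simp add: field_simps)
    ultimately have lo: "1 + 3/10 * \<tau>\<^sup>2 \<le> 1 / \<rho>" by blast
    have "ln \<rho> \<le> \<rho> - 1" using \<rho>0 by (rule ln_le_minus_one)
    then have "1 - \<rho> \<le> c" by (simp add: c_def)
    moreover have "\<tau>\<^sup>2 / 5 \<le> 1 - \<rho>"
    proof -
      have "(1 + 3/10 * \<tau>\<^sup>2) * \<rho> \<le> 1" using lo \<rho>0 by (simp add: le_divide_eq)
      moreover have "1 \<le> (1 + 3/10 * \<tau>\<^sup>2) * (1 - \<tau>\<^sup>2/5)"
      proof -
        have "(1 + 3/10 * x) * (1 - x/5) = 1 + 1/10 * x - 3/50 * (x * x)" for x :: real by (simp add: field_simps)
        note this[of "\<tau>\<^sup>2"]
        moreover have "\<tau>\<^sup>2 * \<tau>\<^sup>2 \<le> \<tau>\<^sup>2 * 1" using sqm[of \<tau> 1] \<tau>1 by (intro mult_left_mono) auto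
        ultimately show ?thesis using zero_le_power2[of \<tau>] by linarith
      qed
      ultimately have "(1 + 3/10 * \<tau>\<^sup>2) * \<rho> \<le> (1 + 3/10 * \<tau>\<^sup>2) * (1 - \<tau>\<^sup>2/5)" by linarith
      then have "\<rho> \<le> 1 - \<tau>\<^sup>2/5" by (simp add: mult_le_cancel_left add_pos_nonneg)
      then show ?thesis by simp
    qed
    ultimately show "\<tau>\<^sup>2 / 5 \<le> c" by linarith
  qed
  define S where "S u = Arctan (of_real \<tau> * u) / of_real al" for u
  define S' where "S' u = of_real (\<tau> / al) / (1 + (of_real \<tau> * u)\<^sup>2)" for u :: complex
  have Rw: "0 < Re (of_real \<tau> * u)" if "0 < Re u" for u using that \<tau>1 by simp
  have w2: "(of_real \<tau> * u)\<^sup>2 \<noteq> - 1" if "0 < Re u" for u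
    using Re_pos_power2[OF Rw[OF that]] by (metis nonpos_Reals_of_real_iff of_real_1 of_real_minus neg_le_0_iff_le zero_le_one)
  have w21: "1 + (of_real \<tau> * u)\<^sup>2 \<noteq> 0" if "0 < Re u" for u
    using w2[OF that] by (metis add.commute add_eq_0_iff)
  have ReS: "0 < Re (S u)" "Re (S u) < 1 / t" if u: "0 < Re u" for u
  proof -
    show "0 < Re (S u)" using Re_Arctan_pos(1)[OF Rw[OF u]] al by (simp add: S_def)
    have "Re (S u) < (pi / 2) / al"
      using Re_Arctan_pos(2)[OF Rw[OF u]] al(1) unfolding S_def Re_divide_of_real by (intro divide_strict_right_mono) auto
    also have "(pi/2) / al = 1 / t" using t by (simp add: al_def)
    finally show "Re (S u) < 1 / t" .
  qed
  have tanS: "tan (of_real al * S u) = of_real \<tau> * u" if u: "0 < Re u" for u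
    using tan_Arctan[OF w2[OF u]] al(1) by (simp add: S_def)
  have der: "(S has_field_derivative S' u) (at u)" if u: "0 < Re u" for u
  proof -
    have "((\<lambda>u. Arctan (of_real \<tau> * u)) has_field_derivative inverse (1 + (of_real \<tau> * u)\<^sup>2) * of_real \<tau>) (at u)"
      by (rule DERIV_chain2[OF has_field_derivative_Arctan])
         (use Rw[OF u] in \<open>auto intro!: derivative_eq_intros\<close>)
    then have "(S has_field_derivative inverse (1 + (of_real \<tau> * u)\<^sup>2) * of_real \<tau> / of_real al) (at u)"
      unfolding S_def by (rule DERIV_cdivide)
    then show ?thesis by (simp add: S'_def divide_inverse mult_ac)
  qed
  have inj: "inj_on S rhp"
  proof (rule inj_onI)
    fix x y assume "x \<in> rhp" "y \<in> rhp" "S x = S y"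
    then have "of_real \<tau> * x = of_real \<tau> * y" using tanS[of x] tanS[of y] by auto
    then show "x = y" using \<tau>1 by simp
  qed
  define T where "T = {w :: complex. 0 < Re w \<and> Re w < 1 / t}"
  have im: "S ` rhp = T"
  proof (intro equalityI subsetI)
    fix w assume "w \<in> T"
    then have w: "0 < Re w" "Re w < 1 / t" by (auto simp: T_def)
    define s where "s = of_real al * w"
    have s: "0 < Re s" "Re s < pi / 2"
    proof -
      show "0 < Re s" using w al by (simp add: s_def)
      have "al * Re w < al * (1 / t)" using w al by (intro mult_strict_left_mono)
      then show "Re s < pi / 2" using t by (simp add: s_def al_def)
    qed
    define u where "u = tan s / of_real \<tau>"
    have "0 < Re u" using Re_tan_pos[OF s] \<tau>1 by (simp add: u_def)
    moreover have "S u = w"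
      using Arctan_tan[of s] s \<tau>1 al by (simp add: S_def u_def s_def)
    ultimately show "w \<in> S ` rhp" by auto
  qed (use ReS in \<open>auto simp: T_def\<close>)
  have S1: "S 1 = 1" using at al by (simp add: S_def Arctan_of_real)
  have S'1: "S' 1 = of_real (exp (- c))"
  proof -
    have "exp (- c) = \<tau> / al / (1 + \<tau>\<^sup>2)" using \<rho>0 by (simp add: c_def \<rho>_def)
    then show ?thesis by (simp add: S'_def)
  qed
  have pt: "z \<in> disc_particle d \<longleftrightarrow> z \<noteq> 1 \<and> 1 / t \<le> Re (kap z)" for z
  proof (cases "z = 1")
    case False
    have e: "Re (kap z) = 1 + 2 * Re (z - 1) / (norm (z - 1))\<^sup>2"
    proof -
      have "Re (kap z) = 1 + Re (2 / (z - 1))" using kap_minus_1[OF False] by (metis Re_complex_of_real add.commute diff_add_cancel one_complex.sel(1) plus_complex.sel(1))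
      also have "Re (2 / (z - 1)) = Re (2 * cnj (z - 1)) / (norm (z - 1))\<^sup>2" by (subst complex_div_cnj) simp
      finally show ?thesis by simp
    qed
    have n: "0 < (norm (z - 1))\<^sup>2" using False by simp
    have "z \<in> disc_particle d \<longleftrightarrow> norm (z - of_real (1 + d/2)) \<le> d / 2"
      using False by (simp add: disc_particle_def dist_norm norm_minus_commute)
    also have "\<dots> \<longleftrightarrow> (norm (z - of_real (1 + d/2)))\<^sup>2 \<le> (d / 2)\<^sup>2"
      using d by (metis abs_le_square_iff abs_norm_cancel abs_of_nonneg half_gt_zero less_imp_le)
    also have "\<dots> \<longleftrightarrow> (norm (z - 1))\<^sup>2 \<le> d * Re (z - 1)"
      unfolding cmod_power2 by (simp add: power2_eq_square algebra_simps) argo?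
    also have "\<dots> \<longleftrightarrow> 1 / t \<le> Re (kap z)"
    proof -
      have "N \<le> d * x \<longleftrightarrow> 2 / d \<le> 2 * x / N" if "0 < N" for x N :: real
        using that d by (simp add: divide_simps mult.commute)
      then show ?thesis unfolding e inv_t add_le_cancel_left using n by blast
    qed
    finally show ?thesis using False by simp
  qed (simp add: disc_particle_def)
  have P0: "disc_particle d \<subseteq> D0"
  proof
    fix z assume "z \<in> disc_particle d"
    then have z: "z \<noteq> 1" "1 / t \<le> Re (kap z)" using pt by auto
    then have "0 < Re (kap z)" using t by (smt (verit) zero_less_divide_1_iff)
    then show "z \<in> D0" using Re_kap_pos_iff[OF z(1)] by (simp add: D0_def)
  qed
  have kP: "kap ` disc_particle d = rhp - T"
  proof (intro equalityI subsetI)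
    fix w assume "w \<in> rhp - T"
    then have w: "1 / t \<le> Re w" by (auto simp: T_def)
    have "1 < 1 / t" using inv_t d by simp
    then have "w \<noteq> 1" using w by auto
    then show "w \<in> kap ` disc_particle d"
      using w pt[of "kap w"] kap_kap kap_neq_1 by (intro image_eqI[of _ _ "kap w"]) auto
  next
    fix w assume "w \<in> kap ` disc_particle d"
    then obtain z where z: "z \<in> disc_particle d" "w = kap z" by auto
    then have "1 / t \<le> Re w" "0 < 1 / t" using pt t by auto
    then have "0 < Re w \<and> \<not> Re w < 1 / t" by linarith
    then show "w \<in> rhp - T" by (simp add: T_def)
  qed
  \<comment> \<open>The point of the circle belonging to \<open>R = \<i> / \<tau>\<close>, a
    logarithmic singularity of \<open>Arctan\<close>; the conjugate belongs to the other
    one.\<close>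
  define a where "a = Complex ((1 - \<tau>\<^sup>2) / (1 + \<tau>\<^sup>2)) (2 * \<tau> / (1 + \<tau>\<^sup>2))"
  have na: "norm a = 1"
  proof -
    have "(norm a)\<^sup>2 = ((1 - \<tau>\<^sup>2)\<^sup>2 + (2 * \<tau>)\<^sup>2) / (1 + \<tau>\<^sup>2)\<^sup>2"
      unfolding a_def cmod_power2 by (simp add: power_divide add_divide_distrib)
    also have "(1 - \<tau>\<^sup>2)\<^sup>2 + (2 * \<tau>)\<^sup>2 = (1 + \<tau>\<^sup>2)\<^sup>2" by (simp add: power2_eq_square algebra_simps)
    finally have "(norm a)\<^sup>2 = 1" using \<tau>2 by simp
    then show ?thesis using power2_eq_imp_eq[of "norm a" 1] by simp
  qed
  have a1: "norm (1 - a) \<le> 4 * \<tau>"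
  proof -
    have "norm (1 - a) \<le> \<bar>Re (1 - a)\<bar> + \<bar>Im (1 - a)\<bar>" by (rule cmod_le)
    also have "Re (1 - a) = 2 * \<tau>\<^sup>2 / (1 + \<tau>\<^sup>2)" using \<tau>2 by (simp add: a_def field_simps)
    also have "\<bar>2 * \<tau>\<^sup>2 / (1 + \<tau>\<^sup>2)\<bar> \<le> 2 * \<tau>"
    proof -
      have "2 * \<tau>\<^sup>2 / (1 + \<tau>\<^sup>2) \<le> 2 * \<tau>\<^sup>2 / 1" by (rule divide_left_mono) (use \<tau>2 in auto)
      also have "\<dots> \<le> 2 * \<tau>" using \<tau>1 by (simp add: power2_eq_square mult_left_le)
      finally show ?thesis using \<tau>2 by simp
    qed
    also have "\<bar>Im (1 - a)\<bar> \<le> 2 * \<tau>"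
    proof -
      have "2 * \<tau> / (1 + \<tau>\<^sup>2) \<le> 2 * \<tau> / 1" by (rule divide_left_mono) (use \<tau>1 \<tau>2 in auto)
      then show ?thesis using \<tau>1 \<tau>2 by (simp add: a_def)
    qed
    finally show ?thesis by simp
  qed
  have Rbig: "norm R \<le> norm (R + 1)" "1 \<le> norm (R + 1)" if "0 < Re R" for R :: complex
    using norm_plus_ge[of R 1] that by auto
  \<comment> \<open>Two regimes. While \<open>\<tau> * M\<close> is at most 1/4, \<open>S\<close> is
    a perturbation of the identity with an error of second order in \<open>\<tau> * M\<close>.
    Beyond that, \<open>reg2\<close> shows that \<open>S R\<close> has size at least of order
    \<open>1 / al\<close>, and crude bounds suffice.\<close>
  have reg1: "norm (S R - R) \<le> 8/3 * (\<tau> * M)\<^sup>2 * norm (R - 1)"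
             "norm (S' R - 1) \<le> 8/3 * (\<tau> * M)\<^sup>2"
    if R: "0 < Re R" and M: "norm R \<le> M" "1 \<le> M" "\<tau> * M \<le> 1/4" for R M
  proof -
    have S'b: "norm (S' z - 1) \<le> 8/3 * (\<tau> * M)\<^sup>2" if z: "0 < Re z" "norm z \<le> M" for z
    proof -
      let ?w = "(of_real \<tau> * z)\<^sup>2"
      have nw: "norm ?w \<le> (\<tau> * M)\<^sup>2"
        unfolding norm_power norm_mult norm_of_real using \<tau>1 z(2) by (intro power_mono mult_mono) auto
      have "(\<tau> * M)\<^sup>2 \<le> (1/4)\<^sup>2" using M \<tau>1 by (intro power_mono) auto
      then have M16: "(\<tau> * M)\<^sup>2 \<le> 1/16" by (simp add: power2_eq_square)
      have den: "15/16 \<le> norm (1 + ?w)" using norm_diff_ineq[of 1 ?w] nw M16 by simp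
      have "S' z - 1 = (of_real (\<tau> / al) - 1 - ?w) / (1 + ?w)"
        using w21[OF z(1)] by (simp add: S'_def field_simps)
      then have "norm (S' z - 1) = norm (of_real (\<tau> / al) - 1 - ?w) / norm (1 + ?w)" by (simp only: norm_divide)
      also have "norm (of_real (\<tau> / al) - 1 - ?w) \<le> norm (of_real (\<tau> / al - 1) :: complex) + norm ?w"
        using norm_triangle_ineq4[of "of_real (\<tau> / al) - 1" ?w] by simp
      also have "norm (of_real (\<tau> / al - 1) :: complex) \<le> \<tau>\<^sup>2"
        unfolding norm_of_real using al_\<tau> al(1) by (simp add: abs_if field_simps)
      also have "\<tau>\<^sup>2 \<le> (\<tau> * M)\<^sup>2" using M \<tau>1 by (intro power_mono) auto
      finally have "norm (S' z - 1) \<le> ((\<tau> * M)\<^sup>2 + norm ?w) / norm (1 + ?w)"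
        by (simp add: divide_right_mono)
      also have "\<dots> \<le> (2 * (\<tau> * M)\<^sup>2) / norm (1 + ?w)"
        by (rule divide_right_mono) (use nw in auto)
      also have "\<dots> \<le> (2 * (\<tau> * M)\<^sup>2) / (15/16)" using den by (intro divide_left_mono) auto
      also have "\<dots> \<le> 8/3 * (\<tau> * M)\<^sup>2" by simp
      finally show ?thesis .
    qed
    show "norm (S' R - 1) \<le> 8/3 * (\<tau> * M)\<^sup>2" by (rule S'b[OF R M(1)])
    have "norm ((S R - R) - (S 1 - 1)) \<le> 8/3 * (\<tau> * M)\<^sup>2 * norm (R - 1)"
    proof (rule field_differentiable_bound[where S = "rhp \<inter> cball 0 M" and f' = "\<lambda>z. S' z - 1"])
      show "convex (rhp \<inter> cball 0 M)" by (intro convex_Int convex_cball convex_halfspace_Re_gt)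
      show "((\<lambda>z. S z - z) has_field_derivative S' z - 1) (at z within rhp \<inter> cball 0 M)"
        if "z \<in> rhp \<inter> cball 0 M" for z
        using that by (intro derivative_intros has_field_derivative_at_within[OF der]) auto
    qed (use S'b R M in auto)
    then show "norm (S R - R) \<le> 8/3 * (\<tau> * M)\<^sup>2 * norm (R - 1)" using S1 by simp
  qed
  have reg1S: "2/3 * M \<le> norm (S R + 1)" "5/6 * norm (R - 1) \<le> norm (S R - 1)"
    if R: "0 < Re R" and M: "M = max 1 (norm R)" "\<tau> * M \<le> 1/4" for R M
  proof -
    have "(\<tau> * M)\<^sup>2 \<le> (1/4)\<^sup>2" using M \<tau>1 by (intro power_mono) auto
    then have "8/3 * (\<tau> * M)\<^sup>2 \<le> 1/6" by (simp add: power_divide)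
    then have h: "8/3 * (\<tau> * M)\<^sup>2 * norm (R - 1) \<le> 1/6 * norm (R - 1)" by (rule mult_right_mono) auto
    have Mb: "norm R \<le> M" "1 \<le> M" using M by auto
    have b: "norm (S R - R) \<le> 1/6 * norm (R - 1)"
      by (rule order_trans[OF reg1(1)[OF R Mb M(2)] h])
    have "norm (R - 1) \<le> norm (S R - R) + norm (S R - 1)"
      using norm_triangle_ineq4[of "S R - 1" "S R - R"] by simp
    with b show "5/6 * norm (R - 1) \<le> norm (S R - 1)" by simp
    have "norm (R - 1) \<le> norm R + 1" using norm_triangle_ineq4[of R 1] by simp
    moreover have "norm (R + 1) \<le> norm (S R + 1) + norm (S R - R)"
      using norm_triangle_ineq4[of "S R + 1" "S R - R"] by (simp add: algebra_simps)
    ultimately have "5/6 * norm R - 1/6 \<le> norm (S R + 1)" using b Rbig(1)[OF R] by linarith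
    moreover have "1 \<le> norm (S R + 1)" using Rbig(2)[of "S R"] ReS[OF R] by simp
    ultimately show "2/3 * M \<le> norm (S R + 1)" unfolding M(1) by (simp add: max_def)
  qed
  have reg2: "1 / (8 * al) \<le> norm (S R)" if R: "0 < Re R" and big: "1/4 < \<tau> * norm R" for R
  proof -
    let ?w = "of_real \<tau> * R"
    have nw: "norm ?w = \<tau> * norm R" using \<tau>1 by (simp add: norm_mult)
    have n0: "1 + \<i> * ?w \<noteq> 0" "1 - \<i> * ?w \<noteq> 0"
      using Rw[OF R] by (auto simp: complex_eq_iff)
    define L where "L = Ln ((1 - \<i> * ?w) / (1 + \<i> * ?w))"
    have "exp L = (1 - \<i> * ?w) / (1 + \<i> * ?w)" unfolding L_def using n0 by simp
    then have e: "exp L - 1 = - 2 * \<i> * ?w / (1 + \<i> * ?w)" using n0 by (simp add: field_simps)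
    have "norm (exp L - 1) = 2 * norm ?w / norm (1 + \<i> * ?w)" unfolding e norm_divide norm_mult by simp
    also have "\<dots> \<ge> 2 * norm ?w / (1 + norm ?w)"
      using norm_triangle_ineq[of 1 "\<i> * ?w"] n0 by (intro divide_left_mono) (auto simp: norm_mult intro!: mult_pos_pos add_pos_nonneg)
    also have "2 * norm ?w / (1 + norm ?w) \<ge> 2/5"
      using big nw by (simp add: le_divide_eq)
    finally have lo: "2/5 \<le> norm (exp L - 1)" .
    have "1/4 \<le> norm L"
    proof (rule ccontr)
      assume "\<not> 1/4 \<le> norm L"
      then have l: "norm L < 1/4" by simp
      have "norm (exp L - exp 0) \<le> exp (1/4) * norm (L - 0)"
      proof (rule field_differentiable_bound[where S = "cball 0 (1/4)" and f' = exp])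
        show "norm (exp z) \<le> exp (1/4)" if "z \<in> cball 0 (1/4)" for z :: complex
          using that complex_Re_le_cmod[of z] by simp
      qed (use l in \<open>auto intro!: derivative_eq_intros\<close>)
      also have "\<dots> \<le> (1 + 1/4 + (1/4)\<^sup>2) * (1/4)"
        using exp_bound[of "1/4 :: real"] l by (intro mult_mono) (auto simp: power2_eq_square)
      finally show False using lo by (simp add: power2_eq_square)
    qed
    moreover have "norm (Arctan ?w) = norm L / 2" by (simp add: Arctan_def L_def norm_mult)
    ultimately have "1/8 \<le> norm (Arctan ?w)" by simp
    then have "1/8 / al \<le> norm (Arctan ?w) / al" using al by (intro divide_right_mono) auto
    then show ?thesis using al by (simp add: S_def norm_divide)
  qed
  have k1: "2 * norm (S R - R) \<le> 500 * d * norm (S R + 1) * norm (R - 1)" if R: "0 < Re R" for R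
  proof (cases "\<tau> * max 1 (norm R) \<le> 1/4")
    case True
    define M where "M = max 1 (norm R)"
    have M: "norm R \<le> M" "1 \<le> M" "\<tau> * M \<le> 1/4" using True by (auto simp: M_def)
    have "8/3 * (\<tau> * M)\<^sup>2 = 8/3 * (\<tau> * M) * (\<tau> * M)" by (simp add: power2_eq_square)
    also have "\<dots> \<le> 8/3 * (1/4) * (\<tau> * M)" using M \<tau>1 by (intro mult_right_mono) (auto simp: mult_ac)
    also have "\<dots> \<le> \<tau> * (2/3 * M)" by simp
    also have "\<dots> \<le> \<tau> * norm (S R + 1)" using reg1S(1)[OF R M_def] M \<tau>1 by (intro mult_left_mono) auto
    also have "\<dots> \<le> 2 * d * norm (S R + 1)" using al_\<tau> by (intro mult_right_mono) auto
    finally have "8/3 * (\<tau> * M)\<^sup>2 * norm (R - 1) \<le> 2 * d * norm (S R + 1) * norm (R - 1)" by (rule mult_right_mono) auto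
    then have "2 * norm (S R - R) \<le> 4 * (d * norm (S R + 1) * norm (R - 1))" using reg1(1)[OF R M] by linarith
    also have "\<dots> \<le> 500 * (d * norm (S R + 1) * norm (R - 1))" using d by (intro mult_right_mono) auto
    finally show ?thesis by (simp add: mult.assoc)
  next
    case False
    have "\<tau> \<le> 1/8" using al_\<tau> d by simp
    then have big: "1/4 < \<tau> * norm R" using False by (auto simp: max_def split: if_splits)
    have R2: "norm R / 2 \<le> norm (R - 1)"
    proof -
      have "1/8 * norm R \<ge> \<tau> * norm R" using \<open>\<tau> \<le> 1/8\<close> by (intro mult_right_mono) auto
      then have "2 \<le> norm R" using big by simp
      then show ?thesis using norm_triangle_ineq2[of R 1] by simp
    qed
    have S1b: "norm (S R) \<le> norm (S R + 1)" using Rbig(1)[of "S R"] ReS[OF R] by simp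
    have p: "1 \<le> 8 * \<tau> * norm (R - 1)"
    proof -
      have "8 * \<tau> * (norm R / 2) \<le> 8 * \<tau> * norm (R - 1)" using R2 \<tau>1 by (intro mult_left_mono) auto
      then show ?thesis using big by simp
    qed
    have q: "1 \<le> 8 * al * norm (S R + 1)"
    proof -
      have "8 * al * (1 / (8 * al)) \<le> 8 * al * norm (S R + 1)"
        using reg2[OF R big] S1b al by (intro mult_left_mono) auto
      then show ?thesis using al by simp
    qed
    have "2 * norm (S R - R) \<le> 2 * norm (S R) + 2 * norm R" using norm_triangle_ineq4[of "S R" R] by simp
    also have "2 * norm (S R) \<le> 2 * norm (S R + 1) * (8 * \<tau> * norm (R - 1))"
    proof -
      have "2 * norm (S R) * 1 \<le> 2 * norm (S R + 1) * (8 * \<tau> * norm (R - 1))"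
        by (intro mult_mono p) (use S1b in auto)
      then show ?thesis by simp
    qed
    also have "2 * norm R \<le> 4 * norm (R - 1) * (8 * al * norm (S R + 1))"
    proof -
      have "2 * norm R * 1 \<le> 4 * norm (R - 1) * (8 * al * norm (S R + 1))"
        by (rule mult_mono[OF _ q]) (use R2 in auto)
      then show ?thesis by simp
    qed
    finally have "2 * norm (S R - R) \<le> (16 * \<tau> + 32 * al) * (norm (S R + 1) * norm (R - 1))"
      by (simp add: algebra_simps)
    also have "\<dots> \<le> (500 * d) * (norm (S R + 1) * norm (R - 1))"
      using al_\<tau> al d by (intro mult_right_mono) auto
    finally show ?thesis by (simp add: mult.assoc)
  qed
  have ab_prod: "of_real (1 + \<tau>\<^sup>2) * ((z - a) * (z - cnj a)) = (1 - z)\<^sup>2 + of_real (\<tau>\<^sup>2) * (1 + z)\<^sup>2" for z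
  proof -
    have "(z - a) * (z - cnj a) = z\<^sup>2 - of_real (2 * Re a) * z + of_real ((norm a)\<^sup>2)"
      unfolding complex_norm_square complex_add_cnj[symmetric] by (simp add: power2_eq_square algebra_simps)
    then have X: "(z - a) * (z - cnj a) = z\<^sup>2 - of_real (2 * Re a) * z + 1" unfolding na by simp
    have "of_real (1 + \<tau>\<^sup>2) * ((z - a) * (z - cnj a))
        = of_real (1 + \<tau>\<^sup>2) * (z\<^sup>2 + 1) - 2 * of_real ((1 + \<tau>\<^sup>2) * Re a) * z"
      unfolding X by (simp add: algebra_simps)
    also have "(1 + \<tau>\<^sup>2) * Re a = 1 - \<tau>\<^sup>2" using \<tau>2 by (simp add: a_def)
    finally show ?thesis by (simp add: power2_eq_square algebra_simps)
  qed
  have q: "norm (1 - S' R * (R\<^sup>2 - 1) / ((S R)\<^sup>2 - 1)) * min (norm (z - a)) (norm (z - cnj a)) \<le> 500 * d"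
    if z: "norm z < 1" "z \<noteq> 0" and Rz: "R = (1 + z) / (1 - z)" and R: "0 < Re R" for z R
  proof -
    let ?m = "min (norm (z - a)) (norm (z - cnj a))"
    define M where "M = max 1 (norm R)"
    have z1: "1 - z \<noteq> 0" using z by auto
    have Rp: "R + 1 = 2 / (1 - z)" "R - 1 = 2 * z / (1 - z)" using z1 unfolding Rz by (auto simp: field_simps)
    have M1: "1 \<le> M" by (simp add: M_def)
    have "M \<le> norm (R + 1)" using Rbig[OF R] by (simp add: M_def)
    then have "M * norm (1 - z) \<le> 2" using z1 unfolding Rp norm_divide by (simp add: le_divide_eq)
    then have nz: "norm (1 - z) \<le> 2 / M" using M1 by (simp add: field_simps)
    have m: "?m \<le> 2 / M + 4 * \<tau>"
      using norm_triangle_ineq4[of "1 - a" "1 - z"] a1 nz by (simp add: min_def)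
    have R1: "R \<noteq> 1" using Rp(2) z z1 by auto
    have S1n: "S R \<noteq> 1"
      using inj S1 R R1 by (metis (mono_tags, lifting) inj_onD mem_Collect_eq one_complex.sel(1) zero_less_one)
    have Sp: "S R + 1 \<noteq> 0" using ReS[OF R] by (auto simp: complex_eq_iff)
    have Sq: "(S R)\<^sup>2 - 1 = (S R - 1) * (S R + 1)" by (simp add: power2_eq_square algebra_simps)
    have Rq: "R\<^sup>2 - 1 = (R - 1) * (R + 1)" by (simp add: power2_eq_square algebra_simps)
    show ?thesis
    proof (cases "\<tau> * M \<le> 1/4")
      case True
      have M: "norm R \<le> M" "1 \<le> M" "\<tau> * M \<le> 1/4" using True by (auto simp: M_def)
      note r = reg1[OF R M] and rS = reg1S[OF R M_def M(3)]
      have "1 - S' R * (R\<^sup>2 - 1) / ((S R)\<^sup>2 - 1)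
          = ((S R - R) * (S R + R) - (S' R - 1) * ((R - 1) * (R + 1))) / ((S R - 1) * (S R + 1))"
        unfolding Sq Rq using S1n Sp by (simp add: divide_simps) (simp add: algebra_simps)
      then have "norm (1 - S' R * (R\<^sup>2 - 1) / ((S R)\<^sup>2 - 1))
          = norm ((S R - R) * (S R + R) - (S' R - 1) * ((R - 1) * (R + 1))) / (norm (S R - 1) * norm (S R + 1))"
        by (simp only: norm_divide norm_mult)
      also have "\<dots> \<le> (23 * (\<tau> * M)\<^sup>2 * (5/6 * norm (R - 1) * norm (S R + 1))) / (norm (S R - 1) * norm (S R + 1))"
      proof (rule divide_right_mono)
        have "norm ((S R - R) * (S R + R) - (S' R - 1) * ((R - 1) * (R + 1)))
            \<le> norm (S R - R) * norm (S R + R) + norm (S' R - 1) * (norm (R - 1) * norm (R + 1))"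
          using norm_triangle_ineq4[of "(S R - R) * (S R + R)" "(S' R - 1) * ((R - 1) * (R + 1))"]
          by (simp add: norm_mult)
        also have "norm (S R + R) \<le> 4 * norm (S R + 1)"
        proof -
          have "norm (S R + R) \<le> norm (S R + 1) + norm (R - 1)"
            using norm_triangle_ineq[of "S R + 1" "R - 1"] by simp
          moreover have "norm (R - 1) \<le> norm R + 1" using norm_triangle_ineq4[of R 1] by simp
          ultimately show ?thesis using rS(1) M by linarith
        qed
        also have "norm (R + 1) \<le> 3 * norm (S R + 1)"
          using norm_triangle_ineq[of R 1] rS(1) M by simp
        finally have "norm ((S R - R) * (S R + R) - (S' R - 1) * ((R - 1) * (R + 1)))
            \<le> norm (S R - R) * (4 * norm (S R + 1)) + norm (S' R - 1) * (norm (R - 1) * (3 * norm (S R + 1)))"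
          by (simp add: mult_left_mono)
        also have "\<dots> \<le> (8/3 * (\<tau> * M)\<^sup>2 * norm (R - 1)) * (4 * norm (S R + 1))
             + (8/3 * (\<tau> * M)\<^sup>2) * (norm (R - 1) * (3 * norm (S R + 1)))"
          by (intro add_mono mult_right_mono r) auto
        also have "\<dots> = 56/3 * ((\<tau> * M)\<^sup>2 * (norm (R - 1) * norm (S R + 1)))" by (simp add: algebra_simps)
        also have "\<dots> \<le> 115/6 * ((\<tau> * M)\<^sup>2 * (norm (R - 1) * norm (S R + 1)))" by (rule mult_right_mono) auto
        finally show "norm ((S R - R) * (S R + R) - (S' R - 1) * ((R - 1) * (R + 1)))
           \<le> 23 * (\<tau> * M)\<^sup>2 * (5/6 * norm (R - 1) * norm (S R + 1))" by (simp add: mult_ac)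
      qed auto
      also have "\<dots> \<le> (23 * (\<tau> * M)\<^sup>2 * (norm (S R - 1) * norm (S R + 1))) / (norm (S R - 1) * norm (S R + 1))"
        by (intro divide_right_mono mult_left_mono mult_right_mono rS) auto
      also have "\<dots> = 23 * (\<tau> * M)\<^sup>2" using S1n Sp by simp
      finally have "norm (1 - S' R * (R\<^sup>2 - 1) / ((S R)\<^sup>2 - 1)) * ?m \<le> 23 * (\<tau> * M)\<^sup>2 * (2 / M + 4 * \<tau>)"
        by (intro mult_mono m) auto
      moreover have "(\<tau> * M)\<^sup>2 * (2 / M + 4 * \<tau>) \<le> \<tau> * 1"
      proof -
      have "(\<tau> * M)\<^sup>2 * (2 / M + 4 * \<tau>) = \<tau> * (2 * (\<tau> * M) + 4 * ((\<tau> * M) * (\<tau> * M)))"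
        using M by (simp add: power2_eq_square field_simps)
      also have "2 * (\<tau> * M) + 4 * ((\<tau> * M) * (\<tau> * M)) \<le> 1"
      proof -
        have "(\<tau> * M) * (\<tau> * M) \<le> (1/4) * (1/4)" using M \<tau>1 by (intro mult_mono) auto
        then show ?thesis using M by simp
      qed
      finally show ?thesis using \<tau>1 by simp
      qed
      ultimately have "norm (1 - S' R * (R\<^sup>2 - 1) / ((S R)\<^sup>2 - 1)) * ?m \<le> 23 * \<tau>"
        by (simp only: mult.assoc)
      then show ?thesis using al_\<tau> d by simp
    next
      case False
      have "\<tau> \<le> 1/8" using al_\<tau> d by simp
      then have big: "1/4 < \<tau> * norm R" using False by (auto simp: M_def max_def split: if_splits)
      have "1 / M \<le> 4 * \<tau>" using False M1 by (simp add: field_simps)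
      then have m12: "?m \<le> 12 * \<tau>" using m by simp
      \<comment> \<open>\<open>S'\<close> has simple poles at \<open>a\<close> and
        \<open>cnj a\<close>. The minimum cancels the nearer one; the farther point is at least
        \<open>\<tau>\<close> away, because the two are at least \<open>2 * \<tau>\<close> apart.
        Smallness then comes from dividing by \<open>(S R)^2 - 1\<close>, which is at least of order
        \<open>al^-2\<close>.\<close>
      let ?X = "max (norm (z - a)) (norm (z - cnj a))"
      have mX: "?m * ?X = norm (z - a) * norm (z - cnj a)" by (simp add: min_def max_def)
      have X: "\<tau> \<le> ?X"
      proof -
        have "norm (a - cnj a) = \<bar>2 * Im a\<bar>" by (simp add: complex_diff_cnj norm_mult)
        also have "\<dots> = 4 * \<tau> / (1 + \<tau>\<^sup>2)" using \<tau>1 \<tau>2 by (simp add: a_def)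
        also have "\<dots> \<ge> 4 * \<tau> / 2" using \<tau>1 sqm[of \<tau> 1] by (intro divide_left_mono) (auto simp: add_pos_nonneg)
        finally have "2 * \<tau> \<le> norm (a - cnj a)" by simp
        also have "\<dots> \<le> norm (z - cnj a) + norm (z - a)"
          using norm_triangle_ineq4[of "z - cnj a" "z - a"] by simp
        finally show ?thesis by simp
      qed
      have den: "(1 - z)\<^sup>2 * (1 + (of_real \<tau> * R)\<^sup>2) = of_real (1 + \<tau>\<^sup>2) * ((z - a) * (z - cnj a))"
      proof -
        have "(1 - z)\<^sup>2 * R\<^sup>2 = (1 + z)\<^sup>2" using z1 by (simp add: Rz power_divide)
        then show ?thesis unfolding ab_prod
          by (simp add: power_mult_distrib distrib_left mult.left_commute[of "(1-z)\<^sup>2"])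
      qed
      have "S' R * (R\<^sup>2 - 1) = of_real (\<tau> / al) * (4 * z) / ((1 - z)\<^sup>2 * (1 + (of_real \<tau> * R)\<^sup>2))"
        unfolding S'_def Rq Rp by (simp add: power2_eq_square)
      then have "S' R * (R\<^sup>2 - 1) / ((S R)\<^sup>2 - 1)
          = of_real (\<tau> / al) * (4 * z) / (of_real (1 + \<tau>\<^sup>2) * ((z - a) * (z - cnj a))) / ((S R)\<^sup>2 - 1)"
        unfolding den by simp
      then have nq: "norm (S' R * (R\<^sup>2 - 1) / ((S R)\<^sup>2 - 1))
          = (\<tau> / al) * (4 * norm z) / ((1 + \<tau>\<^sup>2) * (norm (z - a) * norm (z - cnj a))) / norm ((S R)\<^sup>2 - 1)"
        using \<tau>1 al \<tau>2 by (simp only: norm_divide norm_mult norm_of_real) simp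
      have Sbig: "1 / (128 * al\<^sup>2) \<le> norm ((S R)\<^sup>2 - 1)"
      proof -
        have "(1 / (8 * al))\<^sup>2 \<le> (norm (S R))\<^sup>2" using reg2[OF R big] al by (intro power_mono) auto
        then have "1 / (64 * al\<^sup>2) \<le> norm ((S R)\<^sup>2)" by (simp add: power_divide power_mult_distrib norm_power)
        moreover have "1 \<le> 1 / (128 * al\<^sup>2)"
        proof -
          have "al\<^sup>2 \<le> (1/2000)\<^sup>2" using al d by (intro power_mono) auto
          then show ?thesis using al by (simp add: power2_eq_square le_divide_eq)
        qed
        moreover have "1 / (64 * al\<^sup>2) = 2 * (1 / (128 * al\<^sup>2))" by simp
        ultimately show ?thesis using norm_triangle_ineq2[of "(S R)\<^sup>2" 1] unfolding norm_one by linarith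
      qed
      have "norm (S' R * (R\<^sup>2 - 1) / ((S R)\<^sup>2 - 1)) * ?m \<le> 512 * al"
      proof (cases "?m = 0")
        case True
        show ?thesis unfolding True using al by simp
      next
        case False
        have pos: "0 < 1 / (128 * al\<^sup>2)" using al by simp
        have "norm (S' R * (R\<^sup>2 - 1) / ((S R)\<^sup>2 - 1)) * ?m
            = (\<tau> / al) * (4 * norm z) / ((1 + \<tau>\<^sup>2) * ?X) / norm ((S R)\<^sup>2 - 1)"
        proof -
          have gen: "p / (k * (m * x)) / n * m = p / (k * x) / n" if "m \<noteq> 0" for p k m x n :: real
            using that by simp
          show ?thesis unfolding nq mX[symmetric] by (rule gen[OF False])
        qed
        also have "\<dots> \<le> (\<tau> / al) * 4 / \<tau> / (1 / (128 * al\<^sup>2))"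
        proof (rule frac_le[OF _ _ pos Sbig])
          have "(1 + 0) * \<tau> \<le> (1 + \<tau>\<^sup>2) * ?X" by (rule mult_mono) (use X \<tau>1 in auto)
          moreover have "\<tau> / al * (4 * norm z) \<le> \<tau> / al * 4" by (rule mult_left_mono) (use z \<tau>1 al in auto)
          ultimately show "\<tau> / al * (4 * norm z) / ((1 + \<tau>\<^sup>2) * ?X) \<le> \<tau> / al * 4 / \<tau>"
            using \<tau>1 al by (intro frac_le) auto
          show "0 \<le> \<tau> / al * 4 / \<tau>" using \<tau>1 al by simp
        qed
        also have "\<dots> = 512 * al" using \<tau>1 al by (simp add: power2_eq_square)
        finally show ?thesis .
      qed
      moreover have "norm (1 - S' R * (R\<^sup>2 - 1) / ((S R)\<^sup>2 - 1)) * ?m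
          \<le> (1 + norm (S' R * (R\<^sup>2 - 1) / ((S R)\<^sup>2 - 1))) * ?m"
        using norm_triangle_ineq4[of 1 "S' R * (R\<^sup>2 - 1) / ((S R)\<^sup>2 - 1)"] by (intro mult_right_mono) auto
      ultimately have "norm (1 - S' R * (R\<^sup>2 - 1) / ((S R)\<^sup>2 - 1)) * ?m \<le> 12 * \<tau> + 512 * al"
        using m12 by (simp add: distrib_right)
      also have "\<dots> \<le> 500 * d"
      proof -
        \<comment> \<open>The bound \<open>al \<le> d\<close> is too weak for the constant 500, so a
          numerical value of \<open>pi\<close> enters.\<close>
        have "pi * t \<le> 315/100 * (d/2)" using pi_approx t by (intro mult_mono) auto
        then have "al \<le> 315/400 * d" by (simp add: al_def)
        then show ?thesis using al_\<tau> d by linarith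
      qed
      finally show ?thesis .
    qed
  qed
  have "(d/3)\<^sup>2 \<le> \<tau>\<^sup>2" "\<tau>\<^sup>2 \<le> (2 * d)\<^sup>2" using sqm[of "d/3" \<tau>] sqm[of \<tau> "2*d"] al_\<tau> al t d \<tau>1 by auto
  then have cb: "d\<^sup>2 \<le> 500 * c" "c \<le> 500 * d\<^sup>2" using cl by (auto simp: power_divide power_mult_distrib)
  have T: "T \<subseteq> rhp" by (auto simp: T_def)
  have "\<exists>f. hl_map_est (disc_particle d) (8 * 500) d c f"
    by (rule hl_map_from_halfplane[OF der inj im T S1 S'1 P0 kP _ _ _ _ k1 na _ q cb])
       (use d na in auto)
  then show ?thesis by auto
qed

section \<open>Uniqueness of the normalised map\<close>

lemma is_HL_map_ratio_limit:
  assumes "is_HL_map P F c"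
  shows "((\<lambda>\<zeta>. \<zeta> * F (1 / \<zeta>)) \<longlongrightarrow> of_real (exp c)) (at 0)"
proof -
  obtain B where B: "\<forall>\<^sub>F z in at_infinity. norm (F z - of_real (exp c) * z) \<le> B"
    using assms by (auto simp: is_HL_map_def)
  have "filterlim (\<lambda>\<zeta> :: complex. inverse \<zeta>) at_infinity (at 0)" by (rule filterlim_inverse_at_infinity)
  from eventually_compose_filterlim[OF B this]
  have "\<forall>\<^sub>F \<zeta> in at 0. norm (F (inverse \<zeta>) - of_real (exp c) * inverse \<zeta>) \<le> B" .
  then have ev: "\<forall>\<^sub>F \<zeta> in at 0. norm (\<zeta> * F (1 / \<zeta>) - of_real (exp c)) \<le> B * norm \<zeta>"
    using eventually_neq_at_within[of 0 0 UNIV]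
  proof eventually_elim
    case (elim \<zeta>)
    have "\<zeta> * F (1 / \<zeta>) - of_real (exp c) = (F (inverse \<zeta>) - of_real (exp c) * inverse \<zeta>) * \<zeta>"
      using elim(2) by (simp add: field_simps inverse_eq_divide)
    then show ?case using elim(1) by (simp add: norm_mult mult_right_mono)
  qed
  have "((\<lambda>\<zeta> :: complex. B * norm \<zeta>) \<longlongrightarrow> 0) (at 0)" by (auto intro!: tendsto_eq_intros)
  then have "((\<lambda>\<zeta>. \<zeta> * F (1 / \<zeta>) - of_real (exp c)) \<longlongrightarrow> 0) (at 0)"
    by (rule Lim_null_comparison[OF ev])
  then show ?thesis by (simp add: LIM_zero_iff)
qed

text \<open>Passing to \<open>1 / F (1 / \<zeta>)\<close> gives an injective self-map of the disc
  fixing 0, within reach of the Schwarz lemma. The value at 0 fills the removable singularity, and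
  the condition at infinity becomes a positive derivative at 0.\<close>

lemma is_HL_map_inverted:
  assumes F: "is_HL_map P F c"
  defines "k \<equiv> \<lambda>\<zeta>. if \<zeta> = 0 then 0 else 1 / F (1 / \<zeta>)"
  shows "k holomorphic_on ball 0 1" "inj_on k (ball 0 1)"
    "k ` ball 0 1 = insert 0 ((\<lambda>z. 1 / z) ` (- (K0 \<union> P)))"
    "\<And>\<zeta>. norm \<zeta> < 1 \<Longrightarrow> norm (k \<zeta>) < 1"
    "((\<lambda>\<zeta>. k \<zeta> / \<zeta>) \<longlongrightarrow> of_real (exp (- c))) (at 0)"
proof -
  have hol: "F holomorphic_on D0" and inj: "inj_on F D0" and im: "F ` D0 = - (K0 \<union> P)"
    using F by (auto simp: is_HL_map_def)
  have inD: "1 / \<zeta> \<in> D0" if "norm \<zeta> < 1" "\<zeta> \<noteq> 0" for \<zeta> :: complex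
    using that by (simp add: D0_def norm_divide less_divide_eq)
  have big: "1 < norm (F z)" if "z \<in> D0" for z
    using im that by (force simp: K0_def)
  show lt: "norm (k \<zeta>) < 1" if "norm \<zeta> < 1" for \<zeta>
    using big[OF inD[OF that]] by (auto simp: k_def norm_divide divide_less_eq)
  have "((\<lambda>\<zeta>. \<zeta> * F (1 / \<zeta>)) \<longlongrightarrow> of_real (exp c)) (at 0)"
    by (rule is_HL_map_ratio_limit[OF F])
  from tendsto_inverse[OF this]
  have "((\<lambda>\<zeta>. inverse (\<zeta> * F (1 / \<zeta>))) \<longlongrightarrow> of_real (exp (- c))) (at 0)"
    by (simp add: exp_minus)
  then show rat: "((\<lambda>\<zeta>. k \<zeta> / \<zeta>) \<longlongrightarrow> of_real (exp (- c))) (at 0)"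
    by (rule Lim_transform_eventually)
       (auto simp: k_def eventually_at_filter divide_inverse mult_ac)
  have k0: "(k \<longlongrightarrow> 0) (at 0)"
  proof -
    have "((\<lambda>\<zeta>. k \<zeta> / \<zeta> * \<zeta>) \<longlongrightarrow> of_real (exp (- c)) * 0) (at 0)"
      by (intro tendsto_mult rat tendsto_ident_at)
    from this[unfolded mult_zero_right] show ?thesis
      by (rule Lim_transform_eventually) (auto simp: eventually_at_filter)
  qed
  have hol': "k holomorphic_on ball 0 1 - {0}"
  proof -
    have "(F \<circ> (\<lambda>\<zeta>. 1 / \<zeta>)) holomorphic_on ball 0 1 - {0}"
      by (rule holomorphic_on_compose_gen[OF _ hol]) (auto intro!: holomorphic_intros inD)
    then have "(\<lambda>\<zeta>. 1 / (F \<circ> (\<lambda>\<zeta>. 1 / \<zeta>)) \<zeta>) holomorphic_on ball 0 1 - {0}"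
      by (intro holomorphic_intros) (use big inD in force)+
    then show ?thesis by (rule holomorphic_transform) (auto simp: k_def)
  qed
  show "k holomorphic_on ball 0 1"
  proof (rule no_isolated_singularity[of _ _ "{0}"])
    show "continuous_on (ball 0 1) k"
    proof (rule continuous_at_imp_continuous_on, rule ballI)
      fix z :: complex assume z: "z \<in> ball 0 1"
      show "isCont k z"
      proof (cases "z = 0")
        case True then show ?thesis using k0 by (simp add: isCont_def k_def)
      next
        case False
        have "continuous_on (ball 0 1 - {0}) k" using hol' by (rule holomorphic_on_imp_continuous_on)
        moreover have "open (ball 0 1 - {0 :: complex})" by (intro open_Diff) auto
        ultimately show ?thesis using z False by (simp add: continuous_on_eq_continuous_at)
      qed
    qed
  qed (use hol' in auto)
  show "inj_on k (ball 0 1)"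
  proof (rule inj_onI)
    fix x y assume xy: "x \<in> ball 0 1" "y \<in> ball 0 1" "k x = k y"
    have nz: "k z \<noteq> 0" if "z \<in> ball 0 1" "z \<noteq> 0" for z
      using that big[OF inD[of z]] by (auto simp: k_def)
    show "x = y"
    proof (cases "x = 0 \<or> y = 0")
      case True then show ?thesis using nz xy by (metis k_def)
    next
      case False
      then have "F (1 / x) = F (1 / y)" using xy(3) by (simp add: k_def)
      then have "1 / x = 1 / y" by (rule inj_onD[OF inj]) (use inD xy False in auto)
      then show ?thesis by simp
    qed
  qed
  show "k ` ball 0 1 = insert 0 ((\<lambda>z. 1 / z) ` (- (K0 \<union> P)))"
  proof (intro equalityI subsetI)
    fix w assume "w \<in> k ` ball 0 1"
    then obtain z where z: "norm z < 1" "w = k z" by auto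
    show "w \<in> insert 0 ((\<lambda>z. 1 / z) ` (- (K0 \<union> P)))"
    proof (cases "z = 0")
      case False
      then have "F (1 / z) \<in> - (K0 \<union> P)" using im inD[OF z(1)] by auto
      then show ?thesis using False z by (auto simp: k_def)
    qed (use z in \<open>auto simp: k_def\<close>)
  next
    fix w assume w: "w \<in> insert 0 ((\<lambda>z. 1 / z) ` (- (K0 \<union> P)))"
    show "w \<in> k ` ball 0 1"
    proof (cases "w = 0")
      case True then show ?thesis by (auto simp: k_def image_iff intro!: bexI[of _ 0])
    next
      case False
      then obtain u where "u \<in> - (K0 \<union> P)" "w = 1 / u" using w by auto
      then obtain v where v: "v \<in> D0" "w = 1 / F v" using im by (metis imageE)
      then have "v \<noteq> 0" "norm (1 / v) < 1" by (auto simp: D0_def norm_divide divide_less_eq)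
      then show ?thesis using v by (intro image_eqI[of _ _ "1 / v"]) (auto simp: k_def)
    qed
  qed
qed

text \<open>\<open>li \<circ> k\<close> and \<open>ki \<circ> l\<close> are mutually inverse
  self-maps of the disc fixing 0, so equality holds in the Schwarz lemma and they are rotations.
  Both derivatives at 0 are positive, which makes the rotation trivial and the capacities
  equal.\<close>

lemma is_HL_map_unique:
  assumes F: "is_HL_map P F c" and G: "is_HL_map P G c'"
  shows "c = c'" "\<And>z. z \<in> D0 \<Longrightarrow> F z = G z"
proof -
  define k where "k \<zeta> = (if \<zeta> = 0 then 0 else 1 / F (1 / \<zeta>))" for \<zeta>
  define l where "l \<zeta> = (if \<zeta> = 0 then 0 else 1 / G (1 / \<zeta>))" for \<zeta>
  note k = is_HL_map_inverted[OF F, folded k_def] and l = is_HL_map_inverted[OF G, folded l_def]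
  let ?B = "ball 0 1 :: complex set"
  have im: "k ` ?B = l ` ?B" using k(3) l(3) by simp
  obtain ki where ki: "ki holomorphic_on k ` ?B" "\<And>z. z \<in> ?B \<Longrightarrow> ki (k z) = z"
    using holomorphic_has_inverse[OF k(1) open_ball k(2)] by metis
  obtain li where li: "li holomorphic_on l ` ?B" "\<And>z. z \<in> ?B \<Longrightarrow> li (l z) = z"
    using holomorphic_has_inverse[OF l(1) open_ball l(2)] by metis
  have k00: "k 0 = 0" "l 0 = 0" by (auto simp: k_def l_def)
  have schwarz: "norm (inv_f (h z)) \<le> norm z \<and>
       ((\<exists>z. norm z < 1 \<and> z \<noteq> 0 \<and> norm (inv_f (h z)) = norm z) \<longrightarrow>
          (\<exists>\<alpha>. (\<forall>z. norm z < 1 \<longrightarrow> inv_f (h z) = \<alpha> * z) \<and> norm \<alpha> = 1))"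
    if "h holomorphic_on ?B" "h ` ?B = g ` ?B" "inv_f holomorphic_on g ` ?B"
       "\<And>z. z \<in> ?B \<Longrightarrow> inv_f (g z) = z" "h 0 = 0" "g 0 = 0" "norm z < 1" for h g inv_f z
  proof -
    have hol: "(inv_f \<circ> h) holomorphic_on ?B"
      by (rule holomorphic_on_compose[OF that(1)]) (use that in simp)
    have z0: "(inv_f \<circ> h) 0 = 0" using that(4)[of 0] that(5,6) by simp
    have no: "norm ((inv_f \<circ> h) z) < 1" if "norm z < 1" for z
    proof -
      have "h z \<in> g ` ?B" using that \<open>h ` ?B = g ` ?B\<close> by auto
      then obtain y where "y \<in> ?B" "h z = g y" by auto
      then show ?thesis using \<open>\<And>z. z \<in> ?B \<Longrightarrow> inv_f (g z) = z\<close> by auto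
    qed
    show ?thesis using Schwarz_Lemma[OF hol z0 no that(7)] by auto
  qed
  have a: "norm (li (k z)) \<le> norm z" "norm (ki (l z)) \<le> norm z" if "norm z < 1" for z
    using schwarz[OF k(1) im li k00 that] schwarz[OF l(1) im[symmetric] ki k00(2,1) that] by auto
  have eqn: "norm (li (k z)) = norm z" if z: "norm z < 1" for z
  proof (rule antisym[OF a(1)[OF z]])
    have "k z \<in> l ` ?B" using im z by auto
    then obtain y where y: "norm y < 1" "k z = l y" by auto
    then have "li (k z) = y" using li(2) by auto
    moreover have "norm (ki (l y)) \<le> norm y" by (rule a(2)[OF y(1)])
    moreover have "ki (l y) = z" using ki(2)[of z] z y(2) by auto
    ultimately show "norm z \<le> norm (li (k z))" by simp
  qed
  have "norm (1/2 :: complex) < 1 \<and> (1/2 :: complex) \<noteq> 0 \<and> norm (li (k (1/2))) = norm (1/2 :: complex)"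
    using eqn[of "1/2"] by simp
  then obtain \<alpha> where al: "\<And>z. norm z < 1 \<Longrightarrow> li (k z) = \<alpha> * z" "norm \<alpha> = 1"
    using schwarz[OF k(1) im li k00, of 0] by (metis norm_zero zero_less_one)
  have kl: "k z = l (\<alpha> * z)" if z: "norm z < 1" for z
  proof -
    have "k z \<in> l ` ?B" using im z by auto
    then obtain y where y: "norm y < 1" "k z = l y" by auto
    then have "li (k z) = y" using li(2) by auto
    then show ?thesis using al(1)[OF z] y by simp
  qed
  have a0: "\<alpha> \<noteq> 0" using al(2) by auto
  have "filterlim (\<lambda>z. \<alpha> * z) (at 0) (at 0)"
    unfolding filterlim_at using a0 by (auto intro!: tendsto_eq_intros simp: eventually_at_filter)
  from filterlim_compose[OF l(5) this]
  have "((\<lambda>z. \<alpha> * (l (\<alpha> * z) / (\<alpha> * z))) \<longlongrightarrow> \<alpha> * of_real (exp (- c'))) (at 0)"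
    by (intro tendsto_mult tendsto_const)
  then have "((\<lambda>z. k z / z) \<longlongrightarrow> \<alpha> * of_real (exp (- c'))) (at 0)"
  proof (rule Lim_transform_eventually)
    show "\<forall>\<^sub>F z in at 0. \<alpha> * (l (\<alpha> * z) / (\<alpha> * z)) = k z / z"
      using eventually_at_in_open'[of ?B 0] by (rule eventually_mono) (use kl a0 in auto)
  qed
  from tendsto_unique[OF _ this k(5)]
  have e: "\<alpha> * of_real (exp (- c')) = of_real (exp (- c))" by simp
  from arg_cong[OF this, of norm] show cc: "c = c'" by (simp add: norm_mult al(2))
  with e have "\<alpha> = 1" by simp
  show "F z = G z" if z: "z \<in> D0" for z
  proof -
    have "norm (1 / z) < 1" "1 / z \<noteq> 0" using z by (auto simp: D0_def norm_divide divide_less_eq)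
    then have "1 / F z = 1 / G z" using kl[of "1 / z"] \<open>\<alpha> = 1\<close> by (simp add: k_def l_def)
    then show ?thesis by simp
  qed
qed

text \<open>Replaces the choice operator in \<open>HL_pair\<close> by an explicit map. Agreement
  holds on \<open>D0\<close> only, as the choice is unconstrained elsewhere.\<close>

lemma HL_pair_eq:
  assumes F: "is_HL_map P F c"
  shows "HL_cap P = c" "\<And>z. z \<in> D0 \<Longrightarrow> HL_F P z = F z"
proof -
  have "case HL_pair P of (F, c) \<Rightarrow> is_HL_map P F c"
    unfolding HL_pair_def by (rule someI_ex) (use F in auto)
  then have G: "is_HL_map P (HL_F P) (HL_cap P)" by (simp add: HL_F_def HL_cap_def split_beta)
  show "HL_cap P = c" by (rule is_HL_map_unique(1)[OF G F])
  show "HL_F P z = F z" if "z \<in> D0" for z by (rule is_HL_map_unique(2)[OF G F that])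
qed

section \<open>Iterated maps in the coordinate \<open>1 / z\<close>\<close>

text \<open>A Borel-Caratheodory bound: the Cayley transform of \<open>h\<close>, normalised to
  vanish at 0, maps the disc into itself, and the Schwarz lemma applies to it.\<close>

lemma Re_nonneg_bound_strict:
  fixes h :: "complex \<Rightarrow> complex"
  assumes h: "h holomorphic_on ball 0 1" and pos: "\<And>z. norm z < 1 \<Longrightarrow> 0 < Re (h z)"
    and h0: "h 0 = of_real \<alpha>" and z: "norm z < 1"
  shows "norm (h z - of_real \<alpha>) \<le> 2 * \<alpha> * norm z / (1 - norm z)"
proof -
  have al: "0 < \<alpha>" using pos[of 0] h0 by simp
  define w where "w z = (h z - of_real \<alpha>) / (h z + of_real \<alpha>)" for z
  have ne: "h z + of_real \<alpha> \<noteq> 0" if "norm z < 1" for z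
  proof
    assume "h z + of_real \<alpha> = 0"
    then have "Re (h z + of_real \<alpha>) = 0" by (simp only: zero_complex.sel)
    then show False using pos[OF that] al by simp
  qed
  have hol: "w holomorphic_on ball 0 1"
    unfolding w_def by (intro holomorphic_intros h) (use ne in auto)
  have w0: "w 0 = 0" by (simp add: w_def h0)
  have w1: "norm (w z) < 1" if z: "norm z < 1" for z
  proof -
    have "norm (h z - of_real \<alpha>) < norm (h z + of_real \<alpha>)"
    proof (rule power2_less_imp_less)
      have "0 < \<alpha> * Re (h z)" using al pos[OF z] by simp
      then show "(norm (h z - of_real \<alpha>))\<^sup>2 < (norm (h z + of_real \<alpha>))\<^sup>2"
        unfolding cmod_power2 by (simp add: power2_eq_square algebra_simps)
    qed auto
    then show ?thesis using ne[OF z] by (simp add: w_def norm_divide divide_less_eq)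
  qed
  have wz: "norm (w z) \<le> norm z" by (rule Schwarz_Lemma(1)[OF hol w0 w1 z])
  have "(h z - of_real \<alpha>) * (1 - w z) = 2 * of_real \<alpha> * w z"
    using ne[OF z] by (simp add: w_def field_simps)
  then have e: "norm (h z - of_real \<alpha>) * norm (1 - w z) = 2 * \<alpha> * norm (w z)"
    using al by (metis norm_mult norm_of_real abs_of_pos norm_numeral)
  have lo: "1 - norm z \<le> norm (1 - w z)" using norm_triangle_ineq2[of 1 "w z"] wz by simp
  have "norm (h z - of_real \<alpha>) * (1 - norm z) \<le> norm (h z - of_real \<alpha>) * norm (1 - w z)"
    by (rule mult_left_mono[OF lo]) auto
  also have "\<dots> \<le> 2 * \<alpha> * norm z" unfolding e by (rule mult_left_mono[OF wz]) (use al in auto)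
  finally show ?thesis using z by (simp add: le_divide_eq)
qed

text \<open>A positive constant is added to make the real part strictly positive, and then sent to
  0.\<close>

lemma Re_nonneg_bound:
  fixes h :: "complex \<Rightarrow> complex"
  assumes h: "h holomorphic_on ball 0 1" and pos: "\<And>z. norm z < 1 \<Longrightarrow> 0 \<le> Re (h z)"
    and h0: "h 0 = of_real \<alpha>" and z: "norm z < 1"
  shows "norm (h z - of_real \<alpha>) \<le> 2 * \<alpha> * norm z / (1 - norm z)"
proof -
  have "norm (h z - of_real \<alpha>) \<le> 2 * (\<alpha> + e) * norm z / (1 - norm z)" if e: "0 < e" for e
  proof -
    have "(\<lambda>z. h z + of_real e) holomorphic_on ball 0 1" by (intro holomorphic_intros h)
    then show ?thesis
      using Re_nonneg_bound_strict[of "\<lambda>z. h z + of_real e" "\<alpha> + e" z] pos h0 z e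
      by (auto simp: add_nonneg_pos)
  qed
  then have ev: "\<forall>\<^sub>F e in at_right 0. norm (h z - of_real \<alpha>) \<le> 2 * (\<alpha> + e) * norm z / (1 - norm z)"
    by (auto simp: eventually_at_filter)
  have "((\<lambda>e. 2 * (\<alpha> + e) * norm z / (1 - norm z)) \<longlongrightarrow> 2 * (\<alpha> + 0) * norm z / (1 - norm z)) (at_right 0)"
    by (intro tendsto_intros) (use z in auto)
  from tendsto_lowerbound[OF this ev] show ?thesis by simp
qed

text \<open>Cauchy's inequality on circles of half the distance to the boundary. The constant
  depends on \<open>h\<close> only through its value at 0; for a sum of \<open>n\<close> values of
  \<open>f\<close> along the chain this is \<open>c * n\<close>, whatever the angles are.\<close>

lemma Re_nonneg_lipschitz:
  fixes h :: "complex \<Rightarrow> complex"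
  assumes h: "h holomorphic_on ball 0 1" and pos: "\<And>z. norm z < 1 \<Longrightarrow> 0 \<le> Re (h z)"
    and h0: "h 0 = of_real \<alpha>" and al: "0 \<le> \<alpha>" and r: "r < 1" "norm z \<le> r" "norm w \<le> r"
  shows "norm (h z - h w) \<le> 8 * \<alpha> / (1 - r)\<^sup>2 * norm (z - w)"
proof (rule field_differentiable_bound[where S = "cball 0 r" and f' = "deriv h"])
  fix x :: complex assume x: "x \<in> cball 0 r"
  then have x1: "norm x < 1" using r by simp
  show "(h has_field_derivative deriv h x) (at x within cball 0 r)"
    using holomorphic_derivI[OF h open_ball, of x] x1 by (simp add: has_field_derivative_at_within)
  define \<rho> where "\<rho> = (1 - norm x) / 2"
  have \<rho>: "0 < \<rho>" "(1 - r) / 2 \<le> \<rho>" using x x1 by (auto simp: \<rho>_def)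
  have sub: "norm y \<le> 1 - \<rho>" if "norm (x - y) \<le> \<rho>" for y
    using norm_triangle_ineq2[of y x] that by (simp add: norm_minus_commute \<rho>_def field_simps)
  have "norm ((deriv ^^ 1) h x) \<le> fact 1 * (2 * \<alpha> / \<rho>) / \<rho> ^ 1"
  proof (rule Cauchy_inequality)
    have "cball x \<rho> \<subseteq> ball 0 1" using sub \<rho> by (force simp: dist_norm)
    then show "h holomorphic_on ball x \<rho>" "continuous_on (cball x \<rho>) h"
      using h holomorphic_on_imp_continuous_on holomorphic_on_subset ball_subset_cball by (meson order_trans)+
    fix y assume "norm (x - y) = \<rho>"
    then have y: "norm y \<le> 1 - \<rho>" using sub by simp
    then have y1: "norm y < 1" using \<rho> by simp
    have "norm (h y) \<le> \<alpha> + norm (h y - of_real \<alpha>)"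
      using norm_triangle_ineq[of "of_real \<alpha>" "h y - of_real \<alpha>"] al by simp
    also have "\<dots> \<le> \<alpha> + 2 * \<alpha> * norm y / (1 - norm y)" using Re_nonneg_bound[OF h pos h0 y1] by simp
    also have "\<dots> = \<alpha> * (1 + norm y) / (1 - norm y)" using y1 by (simp add: field_simps)
    also have "\<dots> \<le> \<alpha> * 2 / \<rho>" using y y1 \<rho> al by (intro frac_le mult_left_mono) auto
    finally show "norm (h y) \<le> 2 * \<alpha> / \<rho>" by (simp add: mult.commute)
  qed (use \<rho> in auto)
  then have "norm (deriv h x) \<le> 2 * \<alpha> / \<rho>\<^sup>2" by (simp add: power2_eq_square)
  also have "\<dots> \<le> 2 * \<alpha> / ((1 - r) / 2)\<^sup>2"
    using \<rho> r al by (intro divide_left_mono power_mono mult_pos_pos) auto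
  also have "\<dots> = 8 * \<alpha> / (1 - r)\<^sup>2" by (simp add: power_divide)
  finally show "norm (deriv h x) \<le> 8 * \<alpha> / (1 - r)\<^sup>2" .
qed (use r in auto)

lemma exp_minus_lipschitz:
  fixes p q :: complex
  assumes "0 \<le> Re p" "0 \<le> Re q"
  shows "norm (exp (- p) - exp (- q)) \<le> norm (p - q)"
proof -
  have "norm (exp (- p) - exp (- q)) \<le> 1 * norm (p - q)"
  proof (rule field_differentiable_bound[where S = "{z. 0 \<le> Re z}" and f' = "\<lambda>z. - exp (- z)"])
    show "convex {z. 0 \<le> Re z}" using convex_halfspace_Re_ge[of 0] by simp
  qed (use assms in \<open>auto intro!: derivative_eq_intros\<close>)
  then show ?thesis by simp
qed

text \<open>In the coordinate \<open>1 / z\<close> the chain \<open>dch\<close> follows a point through the maps composed in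
  \<open>\<Phi> n\<close>, innermost first: for \<open>\<theta> k = \<Theta> (n - k)\<close> one has \<open>\<Phi> n z = 1 / dch f \<theta> (1 / z) n
  = z * exp (Hs f \<theta> (1 / z) n)\<close>.\<close>

primrec dch :: "(complex \<Rightarrow> complex) \<Rightarrow> (nat \<Rightarrow> real) \<Rightarrow> complex \<Rightarrow> nat \<Rightarrow> complex" where
  "dch f \<theta> z 0 = z"
| "dch f \<theta> z (Suc k) = dch f \<theta> z k * exp (- f (cis (\<theta> k) * dch f \<theta> z k))"

definition Hs :: "(complex \<Rightarrow> complex) \<Rightarrow> (nat \<Rightarrow> real) \<Rightarrow> complex \<Rightarrow> nat \<Rightarrow> complex" where
  "Hs f \<theta> z n = (\<Sum>k<n. f (cis (\<theta> k) * dch f \<theta> z k))"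

lemma Hs_0 [simp]: "Hs f \<theta> z 0 = 0" and
  Hs_Suc: "Hs f \<theta> z (Suc n) = Hs f \<theta> z n + f (cis (\<theta> n) * dch f \<theta> z n)"
  by (simp_all add: Hs_def)

lemma dch_eq: "dch f \<theta> z n = z * exp (- Hs f \<theta> z n)"
  by (induction n) (simp_all add: Hs_Suc exp_diff exp_minus mult_ac divide_inverse)

lemma dch_add: "dch f \<theta> z (m + k) = dch f (\<lambda>j. \<theta> (m + j)) (dch f \<theta> z m) k"
  by (induction k) simp_all

lemma Hs_add: "Hs f \<theta> z (m + k) = Hs f \<theta> z m + Hs f (\<lambda>j. \<theta> (m + j)) (dch f \<theta> z m) k"
  by (induction k) (simp_all add: Hs_Suc dch_add)

section \<open>Deterministic estimates for the chain\<close>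

locale hl_map =
  fixes f :: "complex \<Rightarrow> complex" and c C d :: real and a b :: complex
  assumes hol: "f holomorphic_on ball 0 1"
    and f_meas: "f \<in> borel_measurable borel"
    and f0: "f 0 = of_real c"
    and Re_nonneg: "\<And>z. norm z < 1 \<Longrightarrow> 0 \<le> Re (f z)"
    and f_bound: "\<And>z. norm z < 1 \<Longrightarrow> norm (f z) \<le> C * d"
    and a1: "norm a = 1" and b1: "norm b = 1"
    and deriv_bound: "\<And>z. norm z < 1 \<Longrightarrow>
          norm (deriv f z) * min (norm (z - a)) (norm (z - b)) \<le> C * d"
    and c_lower: "d\<^sup>2 \<le> C * c" and c_upper: "c \<le> C * d\<^sup>2"
    and d_pos: "0 < d" and d_le: "d \<le> 1" and C_ge: "1 \<le> C"
begin

lemma c_pos: "0 < c"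
  using c_lower d_pos C_ge by (metis zero_less_mult_pos zero_less_power less_le_trans zero_less_one)

lemma norm_dch_le: "norm z < 1 \<Longrightarrow> norm (dch f \<theta> z k) \<le> norm z"
proof (induction k)
  case (Suc k)
  let ?u = "cis (\<theta> k) * dch f \<theta> z k"
  have "norm ?u < 1" using Suc by (simp add: norm_mult)
  then have "norm (exp (- f ?u)) \<le> 1" using Re_nonneg by simp
  then have "norm (dch f \<theta> z k) * norm (exp (- f ?u)) \<le> norm (dch f \<theta> z k) * 1"
    by (intro mult_left_mono) auto
  then show ?case using Suc by (simp add: norm_mult)
qed simp

lemma norm_arg_lt: "norm z < 1 \<Longrightarrow> norm (cis \<phi> * dch f \<theta> z k) < 1"
  using norm_dch_le[of z \<theta> k] by (simp add: norm_mult)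

lemma Re_Hs_nonneg: "norm z < 1 \<Longrightarrow> 0 \<le> Re (Hs f \<theta> z n)"
  by (auto simp: Hs_def intro!: sum_nonneg Re_nonneg norm_arg_lt)

lemma norm_dch: "norm (dch f \<theta> z n) = norm z * exp (- Re (Hs f \<theta> z n))"
  by (simp add: dch_eq norm_mult)

lemma dch_at_0 [simp]: "dch f \<theta> 0 n = 0"
  by (induction n) auto

lemma Hs_at_0 [simp]: "Hs f \<theta> 0 n = of_real (c * real n)"
  by (simp add: Hs_def f0 mult.commute)

lemma f_comp_hol:
  assumes "g holomorphic_on ball 0 1" "\<And>z. norm z < 1 \<Longrightarrow> norm (g z) < 1"
  shows "(\<lambda>z. f (g z)) holomorphic_on ball 0 1"
proof -
  have "g ` ball 0 1 \<subseteq> ball 0 1" using assms(2) by auto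
  from holomorphic_on_compose_gen[OF assms(1) hol this] show ?thesis by (simp add: o_def)
qed

lemma dch_hol: "(\<lambda>z. dch f \<theta> z n) holomorphic_on ball 0 1"
proof (induction n)
  case (Suc n)
  have "(\<lambda>z. f (cis (\<theta> n) * dch f \<theta> z n)) holomorphic_on ball 0 1"
    by (intro f_comp_hol holomorphic_intros Suc) (use norm_arg_lt in auto)
  then show ?case using Suc by (auto intro!: holomorphic_intros)
qed (auto intro!: holomorphic_intros)

lemma Hs_hol: "(\<lambda>z. Hs f \<theta> z n) holomorphic_on ball 0 1"
  unfolding Hs_def by (intro holomorphic_intros f_comp_hol dch_hol) (use norm_arg_lt in auto)

lemma Hs_lipschitz:
  assumes "r < 1" "norm z \<le> r" "norm w \<le> r"
  shows "norm (Hs f \<theta> z n - Hs f \<theta> w n) \<le> 8 * (c * real n) / (1 - r)\<^sup>2 * norm (z - w)"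
  by (rule Re_nonneg_lipschitz[OF Hs_hol Re_Hs_nonneg Hs_at_0]) (use assms c_pos in auto)

lemma f_near_c:
  assumes "norm z < 1"
  shows "norm (f z - of_real c) \<le> 2 * c * norm z / (1 - norm z)"
  by (rule Re_nonneg_bound[OF hol Re_nonneg f0 assms])

section \<open>Expansion of small pockets\<close>

definition sdist :: "complex \<Rightarrow> real" where "sdist u = min (norm (u - a)) (norm (u - b))"

text \<open>A product of Lipschitz constants of the single steps of \<open>dch\<close>. The 2 allows
  the distance to the singular points to halve within the pocket; the 1 comes from the factor in
  front of the exponential.\<close>

definition growth :: "(nat \<Rightarrow> real) \<Rightarrow> complex \<Rightarrow> nat \<Rightarrow> real" where
  "growth \<theta> z n = (\<Prod>k<n. 1 + 2 * C * d / sdist (cis (\<theta> k) * dch f \<theta> z k))"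

lemma sdist_pos: "norm u < 1 \<Longrightarrow> 0 < sdist u"
  using a1 b1 by (auto simp: sdist_def)

lemma f_lipschitz_pocket:
  assumes u: "norm u < 1" "norm v < 1" and e: "norm (u - v) \<le> sdist u / 2"
  shows "norm (f u - f v) \<le> 2 * C * d / sdist u * norm (u - v)"
proof (rule field_differentiable_bound[where S = "closed_segment u v" and f' = "deriv f"])
  have sp: "0 < sdist u" by (rule sdist_pos[OF u(1)])
  have seg: "closed_segment u v \<subseteq> ball 0 1"
    by (rule closed_segment_subset) (use u in auto)
  fix x assume x: "x \<in> closed_segment u v"
  then have x1: "norm x < 1" using seg by auto
  show "(f has_field_derivative deriv f x) (at x within closed_segment u v)"
    using holomorphic_derivI[OF hol open_ball, of x] x1 by (simp add: has_field_derivative_at_within)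
  have "norm (x - u) \<le> norm (u - v)"
    using segment_bound(1)[OF x] by (simp add: norm_minus_commute)
  then have xu: "norm (u - x) \<le> sdist u / 2" using e by (simp add: norm_minus_commute)
  have "sdist u / 2 \<le> min (norm (x - a)) (norm (x - b))"
    using norm_triangle_ineq[of "x - a" "u - x"] norm_triangle_ineq[of "x - b" "u - x"] xu
    by (simp add: sdist_def min_def split: if_splits)
  then have "norm (deriv f x) * (sdist u / 2) \<le> norm (deriv f x) * min (norm (x - a)) (norm (x - b))"
    by (rule mult_left_mono) auto
  also have "\<dots> \<le> C * d" by (rule deriv_bound[OF x1])
  finally show "norm (deriv f x) \<le> 2 * C * d / sdist u" using sp by (simp add: field_simps)
qed auto

lemma growth_mono: "norm z < 1 \<Longrightarrow> m \<le> n \<Longrightarrow> growth \<theta> z m \<le> growth \<theta> z n"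
  and growth_ge_1: "norm z < 1 \<Longrightarrow> 1 \<le> growth \<theta> z n"
proof -
  assume z: "norm z < 1"
  have x: "0 \<le> 2 * C * d / sdist (cis (\<theta> k) * dch f \<theta> z k)" for k
    using sdist_pos[OF norm_arg_lt[OF z]] C_ge d_pos by (simp add: less_imp_le)
  show g1: "1 \<le> growth \<theta> z n" for n
    unfolding growth_def by (rule prod_ge_1) (use x in auto)
  show "growth \<theta> z m \<le> growth \<theta> z n" if "m \<le> n"
    using that
  proof (rule lift_Suc_mono_le[rotated])
    fix n
    have "growth \<theta> z n * 1 \<le> growth \<theta> z n * (1 + 2 * C * d / sdist (cis (\<theta> n) * dch f \<theta> z n))"
      using g1[of n] x[of n] by (intro mult_left_mono) auto
    then show "growth \<theta> z n \<le> growth \<theta> z (Suc n)" by (simp add: growth_def)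
  qed
qed

text \<open>A small pocket around \<open>z\<close> is expanded by at most \<open>growth\<close>, as long as it stays away
  from the two singular points; the latter is automatic, because \<open>growth\<close> is large as soon as
  the orbit of \<open>z\<close> comes close to them.\<close>

lemma pocket:
  assumes z: "norm z < 1" "norm w < 1" and small: "norm (z - w) * (growth \<theta> z n)\<^sup>2 \<le> C * d"
  shows "norm (dch f \<theta> z n - dch f \<theta> w n) \<le> norm (z - w) * growth \<theta> z n"
    and "norm (Hs f \<theta> z n - Hs f \<theta> w n) \<le> norm (z - w) * growth \<theta> z n"
proof -
  let ?e = "norm (z - w)"
  have Cd: "0 < C * d" using C_ge d_pos by simp
  \<comment> \<open>Carrying \<open>growth - 1\<close> in the second bound makes it telescope: the
    step contributes exactly the increment of \<open>growth\<close>.\<close>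
  have main: "k \<le> n \<Longrightarrow> norm (dch f \<theta> z k - dch f \<theta> w k) \<le> ?e * growth \<theta> z k
     \<and> norm (Hs f \<theta> z k - Hs f \<theta> w k) \<le> ?e * (growth \<theta> z k - 1)" for k
  proof (induction k)
    case 0 show ?case by (simp add: growth_def)
  next
    case (Suc k)
    define u where "u = cis (\<theta> k) * dch f \<theta> z k"
    define v where "v = cis (\<theta> k) * dch f \<theta> w k"
    define s where "s = sdist u"
    define x where "x = 2 * C * d / s"
    have uv: "norm u < 1" "norm v < 1" unfolding u_def v_def using norm_arg_lt z by auto
    have s0: "0 < s" unfolding s_def by (rule sdist_pos[OF uv(1)])
    have x0: "0 < x" using s0 Cd by (simp add: x_def mult.assoc)
    have W: "growth \<theta> z (Suc k) = growth \<theta> z k * (1 + x)" by (simp add: growth_def x_def s_def u_def)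
    have Wk: "1 \<le> growth \<theta> z k" by (rule growth_ge_1[OF z(1)])
    have Wn: "growth \<theta> z (Suc k) \<le> growth \<theta> z n" by (rule growth_mono[OF z(1) Suc.prems])
    have Wkn: "growth \<theta> z k \<le> growth \<theta> z n" by (rule growth_mono[OF z(1)]) (use Suc.prems in auto)
    have IH: "norm (dch f \<theta> z k - dch f \<theta> w k) \<le> ?e * growth \<theta> z k"
       "norm (Hs f \<theta> z k - Hs f \<theta> w k) \<le> ?e * (growth \<theta> z k - 1)"
      using Suc by auto
    have uvd: "norm (u - v) = norm (dch f \<theta> z k - dch f \<theta> w k)"
      unfolding u_def v_def right_diff_distrib[symmetric] norm_mult by simp
    \<comment> \<open>A single factor is at most the whole product. Together with the squared growth
      in the hypothesis this keeps the pocket within half the distance to the singular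
      points.\<close>
    have "x \<le> growth \<theta> z n"
    proof -
      have "1 * x \<le> growth \<theta> z k * (1 + x)" by (intro mult_mono Wk) (use x0 Wk in auto)
      then show ?thesis using Wn W by simp
    qed
    then have "2 * (C * d) \<le> growth \<theta> z n * s" using s0 by (simp add: x_def field_simps)
    moreover have "?e * growth \<theta> z n * growth \<theta> z n \<le> C * d" using small by (simp add: power2_eq_square mult.assoc)
    ultimately have "?e * growth \<theta> z n * growth \<theta> z n \<le> (s / 2) * growth \<theta> z n" by (simp add: mult.commute)
    then have "?e * growth \<theta> z n \<le> s / 2" using Wk Wkn by (simp add: mult_le_cancel_right)
    moreover have "?e * growth \<theta> z k \<le> ?e * growth \<theta> z n" by (rule mult_left_mono[OF Wkn]) auto
    ultimately have "norm (u - v) \<le> sdist u / 2" using IH(1) uvd s_def by simp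
    then have "norm (f u - f v) \<le> x * norm (u - v)"
      unfolding x_def s_def by (rule f_lipschitz_pocket[OF uv])
    also have "\<dots> \<le> x * (?e * growth \<theta> z k)" using IH(1) uvd x0 by (intro mult_left_mono) auto
    finally have fd: "norm (f u - f v) \<le> ?e * growth \<theta> z k * x" by (simp add: mult_ac)
    have "norm (dch f \<theta> z (Suc k) - dch f \<theta> w (Suc k))
        = norm ((dch f \<theta> z k - dch f \<theta> w k) * exp (- f v) + dch f \<theta> z k * (exp (- f u) - exp (- f v)))"
      by (simp add: u_def v_def algebra_simps)
    also have "\<dots> \<le> norm (dch f \<theta> z k - dch f \<theta> w k) * norm (exp (- f v)) + norm (dch f \<theta> z k) * norm (exp (- f u) - exp (- f v))"
      by (metis norm_mult norm_triangle_ineq)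
    also have "\<dots> \<le> norm (dch f \<theta> z k - dch f \<theta> w k) * 1 + 1 * norm (f u - f v)"
      by (intro add_mono mult_mono exp_minus_lipschitz Re_nonneg uv)
         (use norm_dch_le[OF z(1), of \<theta> k] z Re_nonneg[OF uv(2)] in auto)
    also have "\<dots> \<le> ?e * growth \<theta> z k + ?e * growth \<theta> z k * x" using IH(1) fd by simp
    also have "\<dots> = ?e * growth \<theta> z (Suc k)" by (simp add: W algebra_simps)
    finally have 1: "norm (dch f \<theta> z (Suc k) - dch f \<theta> w (Suc k)) \<le> ?e * growth \<theta> z (Suc k)" .
    have "Hs f \<theta> z (Suc k) - Hs f \<theta> w (Suc k) = (Hs f \<theta> z k - Hs f \<theta> w k) + (f u - f v)"
      by (simp add: Hs_Suc u_def v_def)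
    then have "norm (Hs f \<theta> z (Suc k) - Hs f \<theta> w (Suc k)) \<le> ?e * (growth \<theta> z k - 1) + ?e * growth \<theta> z k * x"
      using norm_triangle_ineq[of "Hs f \<theta> z k - Hs f \<theta> w k" "f u - f v"] IH(2) fd by simp
    also have "\<dots> = ?e * (growth \<theta> z (Suc k) - 1)" by (simp add: W algebra_simps)
    finally show ?case using 1 by simp
  qed
  show "norm (dch f \<theta> z n - dch f \<theta> w n) \<le> ?e * growth \<theta> z n" using main[of n] by simp
  have "?e * (growth \<theta> z n - 1) \<le> ?e * growth \<theta> z n" by (rule mult_left_mono) auto
  then show "norm (Hs f \<theta> z n - Hs f \<theta> w n) \<le> ?e * growth \<theta> z n" using main[of n] by simp
qed

text \<open>Once the reference point has been lifted off the unit circle by \<open>exp (c / 2)\<close>, the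
  remaining steps are uniformly Lipschitz on the pocket.\<close>

lemma pocket_lifted:
  assumes z: "norm z < 1" "norm w < 1" and small: "norm (z - w) * (growth \<theta> z K)\<^sup>2 \<le> C * d"
    and tiny: "norm (z - w) * growth \<theta> z K \<le> c / 16" and c1: "c \<le> 1"
    and Kn: "K \<le> n" and lift: "c / 2 \<le> Re (Hs f \<theta> z K)"
  shows "norm (Hs f \<theta> z n - Hs f \<theta> w n) \<le> norm (z - w) * growth \<theta> z K * (1 + 512 * real n / c)"
proof -
  let ?D = "norm (z - w) * growth \<theta> z K"
  note p = pocket[OF z small]
  \<comment> \<open>A lift by \<open>c / 2\<close> puts the reference point within
    \<open>1 - c / 4\<close>, and a pocket of radius at most \<open>c / 16\<close> then stays within
    \<open>1 - c / 8\<close>. There \<open>Hs_lipschitz\<close> has the constant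
    \<open>512 * l / c\<close>, with 512 = 8 * 64.\<close>
  define r where "r = 1 - c / 8"
  have "norm (dch f \<theta> z K) \<le> 1 * exp (- (c / 2))"
    unfolding norm_dch using z lift by (intro mult_mono) auto
  also have "1 * exp (- (c / 2)) \<le> 1 - c / 4"
  proof -
    have "exp (- (c/2)) = 1 / exp (c/2)" by (simp add: exp_minus inverse_eq_divide)
    also have "\<dots> \<le> 1 / (1 + c/2)" using exp_ge_add_one_self[of "c/2"] c_pos by (intro divide_left_mono) auto
    also have "\<dots> \<le> 1 - c / 4"
    proof -
      have "c * c \<le> c * 1" using c1 c_pos by (intro mult_left_mono) auto
      then have "1 \<le> (1 - c/4) * (1 + c/2)" using c_pos by (simp add: field_simps)
      then show ?thesis using c_pos by (simp add: divide_le_eq)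
    qed
    finally show ?thesis by simp
  qed
  finally have r1: "norm (dch f \<theta> z K) \<le> r" using c_pos by (simp add: r_def)
  have "norm (dch f \<theta> w K) \<le> norm (dch f \<theta> z K) + norm (dch f \<theta> z K - dch f \<theta> w K)"
    using norm_triangle_ineq4[of "dch f \<theta> z K" "dch f \<theta> z K - dch f \<theta> w K"] by simp
  also have "\<dots> \<le> (1 - c/4) + c/16"
    using p(1) tiny \<open>norm (dch f \<theta> z K) \<le> 1 * exp (- (c / 2))\<close> \<open>1 * exp (- (c / 2)) \<le> 1 - c / 4\<close> by linarith
  also have "\<dots> \<le> r" using c_pos by (simp add: r_def)
  finally have r2: "norm (dch f \<theta> w K) \<le> r" .
  obtain l where n: "n = K + l" using Kn le_Suc_ex by blast
  let ?\<phi> = "\<lambda>j. \<theta> (K + j)"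
  have "norm (Hs f ?\<phi> (dch f \<theta> z K) l - Hs f ?\<phi> (dch f \<theta> w K) l)
      \<le> 8 * (c * real l) / (1 - r)\<^sup>2 * norm (dch f \<theta> z K - dch f \<theta> w K)"
    by (rule Hs_lipschitz[OF _ r1 r2]) (use c_pos in \<open>simp add: r_def\<close>)
  also have "8 * (c * real l) / (1 - r)\<^sup>2 = 512 * real l / c"
    using c_pos by (simp add: r_def power2_eq_square field_simps)
  also have "512 * real l / c * norm (dch f \<theta> z K - dch f \<theta> w K) \<le> 512 * real n / c * ?D"
    using p(1) c_pos n by (intro mult_mono divide_right_mono) auto
  finally have "norm (Hs f ?\<phi> (dch f \<theta> z K) l - Hs f ?\<phi> (dch f \<theta> w K) l) \<le> 512 * real n / c * ?D" .
  moreover have "Hs f \<theta> z n - Hs f \<theta> w n = (Hs f \<theta> z K - Hs f \<theta> w K)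
      + (Hs f ?\<phi> (dch f \<theta> z K) l - Hs f ?\<phi> (dch f \<theta> w K) l)" unfolding n Hs_add by simp
  ultimately have "norm (Hs f \<theta> z n - Hs f \<theta> w n) \<le> ?D + 512 * real n / c * ?D"
    using p(2) norm_triangle_ineq[of "Hs f \<theta> z K - Hs f \<theta> w K"
       "Hs f ?\<phi> (dch f \<theta> z K) l - Hs f ?\<phi> (dch f \<theta> w K) l"] by simp
  then show ?thesis by (simp add: algebra_simps)
qed

end

section \<open>Exponential moments along the chain\<close>

text \<open>A chain with a step-dependent map and an arbitrary state space: the state may carry more
  than the position, such as an accumulated exponent.\<close>

primrec iter :: "(nat \<Rightarrow> 's \<Rightarrow> real \<Rightarrow> 's) \<Rightarrow> 's \<Rightarrow> (nat \<Rightarrow> real) \<Rightarrow> nat \<Rightarrow> 's" where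
  "iter T s \<phi> 0 = s"
| "iter T s \<phi> (Suc k) = T k (iter T s \<phi> k) (\<phi> k)"

lemma iter_cong: "(\<And>j. j < k \<Longrightarrow> \<phi> j = \<psi> j) \<Longrightarrow> iter T s \<phi> k = iter T s \<psi> k"
  by (induction k) auto

lemma measurable_iter:
  assumes T: "\<And>k. (\<lambda>(s, \<theta>). T k s \<theta>) \<in> N \<Otimes>\<^sub>M borel \<rightarrow>\<^sub>M N" and s: "s \<in> space N"
    and X: "\<And>k. k < m \<Longrightarrow> (\<lambda>\<omega>. X \<omega> k) \<in> borel_measurable M" and k: "k \<le> m"
  shows "(\<lambda>\<omega>. iter T s (X \<omega>) k) \<in> M \<rightarrow>\<^sub>M N"
  using k
proof (induction k)
  case (Suc k)
  have "(\<lambda>\<omega>. (iter T s (X \<omega>) k, X \<omega> k)) \<in> M \<rightarrow>\<^sub>M N \<Otimes>\<^sub>M borel"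
    using Suc X[of k] by (intro measurable_Pair) auto
  from measurable_compose[OF this T[of k]] show ?case by simp
qed (use s in simp)

text \<open>A supermartingale argument: \<open>X k\<close> is independent of the state built from
  the earlier variables, so Fubini integrates it out first, where \<open>step\<close> applies. With
  \<open>nn_integral\<close> no integrability has to be shown, and \<open>V\<close> may be
  infinite.\<close>

lemma (in prob_space) nn_integral_iter_le:
  assumes indep: "indep_vars (\<lambda>_. borel) X {..<n}"
    and distr: "\<And>k. k < n \<Longrightarrow> distr M borel (X k) = circ"
    and T: "\<And>k. (\<lambda>(s, \<theta>). T k s \<theta>) \<in> N \<Otimes>\<^sub>M borel \<rightarrow>\<^sub>M N" and s: "s \<in> space N"
    and V: "\<And>k. V k \<in> borel_measurable N"
    and step: "\<And>k s. k < n \<Longrightarrow> s \<in> space N \<Longrightarrow> (\<integral>\<^sup>+\<theta>. V (Suc k) (T k s \<theta>) \<partial>circ) \<le> V k s"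
  shows "k \<le> n \<Longrightarrow> (\<integral>\<^sup>+\<omega>. V k (iter T s (\<lambda>i. X i \<omega>) k) \<partial>M) \<le> V 0 s"
proof (induction k)
  case 0 then show ?case by (simp add: emeasure_space_1)
next
  case (Suc k)
  have X: "X i \<in> borel_measurable M" if "i < n" for i
    using indep that by (auto simp: indep_vars_def)
  define Y where "Y \<omega> = iter T s (\<lambda>i. X i \<omega>) k" for \<omega>
  let ?P = "PiM {..<k} (\<lambda>_. borel) :: (nat \<Rightarrow> real) measure" and ?Q = "PiM {k} (\<lambda>_. borel) :: (nat \<Rightarrow> real) measure"
  define R where "R \<omega> = restrict (\<lambda>i. X i \<omega>) {..<k}" for \<omega>
  define R' where "R' \<omega> = restrict (\<lambda>i. X i \<omega>) {k}" for \<omega>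
  have "indep_var ?P R ?Q R'"
    unfolding R_def R'_def by (rule indep_var_restrict[OF indep]) (use Suc in auto)
  then have Rm: "R \<in> M \<rightarrow>\<^sub>M ?P" "R' \<in> M \<rightarrow>\<^sub>M ?Q"
    and D: "distr M (?P \<Otimes>\<^sub>M ?Q) (\<lambda>\<omega>. (R \<omega>, R' \<omega>)) = distr M ?P R \<Otimes>\<^sub>M distr M ?Q R'"
    unfolding indep_var_distribution_eq by auto
  interpret Q: prob_space "distr M ?Q R'" by (rule prob_space_distr[OF Rm(2)])
  have Xk: "X k \<in> borel_measurable M" using X Suc by simp
  define F where "F x = V (Suc k) (T k (iter T s (fst x) k) (snd x k))" for x
  have itm: "(\<lambda>\<phi>. iter T s \<phi> k) \<in> ?P \<rightarrow>\<^sub>M N" by (rule measurable_iter[OF T s, of k]) auto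
  have VT: "(\<lambda>x. V (Suc k) (T k (fst x) (snd x))) \<in> borel_measurable (N \<Otimes>\<^sub>M borel)"
    using measurable_compose[OF T[of k] V[of "Suc k"]] by (simp add: split_beta)
  have Fm: "F \<in> borel_measurable (?P \<Otimes>\<^sub>M ?Q)"
  proof -
    have "(\<lambda>x. (iter T s (fst x) k, snd x k)) \<in> ?P \<Otimes>\<^sub>M ?Q \<rightarrow>\<^sub>M N \<Otimes>\<^sub>M borel"
      by (intro measurable_Pair measurable_compose[OF measurable_fst itm]
          measurable_compose[OF measurable_snd measurable_component_singleton]) auto
    from measurable_compose[OF this VT] show ?thesis by (simp add: F_def[abs_def])
  qed
  then have Fm': "F \<in> borel_measurable (distr M ?P R \<Otimes>\<^sub>M distr M ?Q R')"
    by (simp cong: measurable_cong_sets)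
  have RY: "iter T s (R \<omega>) k = Y \<omega>" for \<omega> unfolding R_def Y_def by (rule iter_cong) auto
  have inner: "(\<integral>\<^sup>+y. F (x, y) \<partial>distr M ?Q R') = (\<integral>\<^sup>+\<theta>. V (Suc k) (T k (iter T s x k) \<theta>) \<partial>circ)"
    if x: "x \<in> space ?P" for x
  proof -
    have sN: "iter T s x k \<in> space N" using measurable_space[OF itm x] .
    have Vx: "(\<lambda>\<theta>. V (Suc k) (T k (iter T s x k) \<theta>)) \<in> borel_measurable borel"
      using measurable_compose[OF measurable_Pair1'[OF sN] VT] by simp
    have "(\<lambda>y. F (x, y)) \<in> borel_measurable ?Q"
      using measurable_compose[OF measurable_Pair1'[OF x] Fm] by simp
    then have "(\<integral>\<^sup>+y. F (x, y) \<partial>distr M ?Q R') = (\<integral>\<^sup>+\<omega>. V (Suc k) (T k (iter T s x k) (X k \<omega>)) \<partial>M)"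
      using Rm(2) by (simp add: nn_integral_distr F_def R'_def)
    also have "\<dots> = (\<integral>\<^sup>+\<theta>. V (Suc k) (T k (iter T s x k) \<theta>) \<partial>distr M borel (X k))"
      by (subst nn_integral_distr[OF Xk]) (use Vx in simp_all)
    finally show ?thesis using distr[of k] Suc by simp
  qed
  have "(\<integral>\<^sup>+\<omega>. V (Suc k) (iter T s (\<lambda>i. X i \<omega>) (Suc k)) \<partial>M) = (\<integral>\<^sup>+\<omega>. F (R \<omega>, R' \<omega>) \<partial>M)"
    using RY by (simp add: F_def R'_def Y_def)
  also have "\<dots> = (\<integral>\<^sup>+x. F x \<partial>(distr M ?P R \<Otimes>\<^sub>M distr M ?Q R'))"
    unfolding D[symmetric] by (subst nn_integral_distr[OF measurable_Pair[OF Rm]]) (use Fm in simp_all)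
  also have "\<dots> = (\<integral>\<^sup>+x. (\<integral>\<^sup>+y. F (x, y) \<partial>distr M ?Q R') \<partial>distr M ?P R)"
    by (rule Q.nn_integral_fst[OF Fm', symmetric])
  also have "\<dots> \<le> (\<integral>\<^sup>+x. V k (iter T s x k) \<partial>distr M ?P R)"
    by (intro nn_integral_mono) (use inner step[of k] Suc measurable_space[OF itm] in auto)
  also have "\<dots> = (\<integral>\<^sup>+\<omega>. V k (iter T s (R \<omega>) k) \<partial>M)"
    by (subst nn_integral_distr[OF Rm(1)]) (use measurable_compose[OF itm V] in simp_all)
  also have "\<dots> = (\<integral>\<^sup>+\<omega>. V k (Y \<omega>) \<partial>M)" by (simp only: RY)
  also have "\<dots> \<le> V 0 s" unfolding Y_def by (rule Suc.IH) (use Suc in auto)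
  finally show ?case .
qed

lemma cis_measurable [measurable]: "cis \<in> borel_measurable borel"
  by (intro borel_measurable_continuous_onI continuous_intros)

section \<open>Measurability of the chain\<close>

context hl_map
begin

lemma measurable_dch:
  assumes \<phi>: "\<And>j. \<phi> j \<in> borel_measurable M" and s: "s \<in> borel_measurable M"
  shows "(\<lambda>\<omega>. dch f (\<lambda>j. \<phi> j \<omega>) (s \<omega>) k) \<in> borel_measurable M"
proof (induction k)
  case (Suc k)
  note Suc[measurable] \<phi>[of k, measurable] f_meas[measurable]
  show ?case unfolding dch.simps by measurable
qed (use s in simp)

lemma measurable_chain_arg:
  assumes \<phi>: "\<And>j. \<phi> j \<in> borel_measurable M" and s: "s \<in> borel_measurable M"
  shows "(\<lambda>\<omega>. cis (\<phi> k \<omega>) * dch f (\<lambda>j. \<phi> j \<omega>) (s \<omega>) k) \<in> borel_measurable M"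
proof -
  note measurable_dch[OF assms, measurable] \<phi>[of k, measurable]
  show ?thesis by measurable
qed

lemma measurable_Hs:
  assumes "\<And>j. \<phi> j \<in> borel_measurable M" and "s \<in> borel_measurable M"
  shows "(\<lambda>\<omega>. Hs f (\<lambda>j. \<phi> j \<omega>) (s \<omega>) k) \<in> borel_measurable M"
  unfolding Hs_def
  by (intro borel_measurable_sum measurable_compose[OF measurable_chain_arg[OF assms] f_meas])

end

text \<open>The angle of the particle is \<open>X 0\<close>; the angles of the \<open>n\<close> particles before it are
  \<open>X 1, \<dots>, X n\<close>, the latest first.\<close>

locale hl_prob = hl_map f c C d a b + prob_space M
  for f :: "complex \<Rightarrow> complex" and c C d :: real and a b :: complex and M :: "'s measure" +
  fixes X :: "nat \<Rightarrow> 's \<Rightarrow> real" and n :: nat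
  assumes X_indep: "indep_vars (\<lambda>_. borel) X {..n}"
    and X_distr: "\<And>k. k \<le> n \<Longrightarrow> distr M borel (X k) = circ"
    and X_meas: "\<And>k. X k \<in> borel_measurable M"
begin

abbreviation th :: "'s \<Rightarrow> nat \<Rightarrow> real" where "th \<omega> \<equiv> \<lambda>j. X (Suc j) \<omega>"

text \<open>A point \<open>cis (X 0 \<omega>) * p\<close> of the rotated particle has the inverse
  \<open>cis (- X 0 \<omega>) * (1 / p)\<close>, and this is where its chain starts.\<close>

abbreviation st :: "complex \<Rightarrow> 's \<Rightarrow> complex" where "st z \<omega> \<equiv> cis (- X 0 \<omega>) * z"

lemma st_measurable: "st z \<in> borel_measurable M"
proof -
  note X_meas[of 0, measurable]
  show ?thesis by measurable
qed

lemma dch_measurable: "(\<lambda>\<omega>. dch f (th \<omega>) (st z \<omega>) k) \<in> borel_measurable M"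
  by (rule measurable_dch[OF X_meas st_measurable])

lemma arg_measurable: "(\<lambda>\<omega>. cis (th \<omega> k) * dch f (th \<omega>) (st z \<omega>) k) \<in> borel_measurable M"
  by (rule measurable_chain_arg[OF X_meas st_measurable])

lemma Hs_measurable: "(\<lambda>\<omega>. Hs f (th \<omega>) (st z \<omega>) k) \<in> borel_measurable M"
  by (rule measurable_Hs[OF X_meas st_measurable])

lemma sdist_measurable: "sdist \<in> borel_measurable borel"
  unfolding sdist_def[abs_def] by measurable

lemma growth_measurable: "(\<lambda>\<omega>. growth (th \<omega>) (st z \<omega>) k) \<in> borel_measurable M"
  unfolding growth_def
  by (intro borel_measurable_prod borel_measurable_add borel_measurable_divide borel_measurable_const
      measurable_compose[OF arg_measurable sdist_measurable])

text \<open>One-step exponential bounds multiply along the chain. The state pairs the position with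
  the exponent collected so far; off the unit disc \<open>V\<close> is infinite, so the step
  condition is trivial there and \<open>v\<close> is required only for
  \<open>norm z < 1\<close>.\<close>

lemma chain_exp:
  fixes g :: "nat \<Rightarrow> complex \<Rightarrow> real \<Rightarrow> real"
  assumes g: "\<And>k. (\<lambda>(z, \<theta>). g k z \<theta>) \<in> borel_measurable (borel \<Otimes>\<^sub>M borel)"
    and v: "\<And>k z. k < m \<Longrightarrow> norm z < 1 \<Longrightarrow> (\<integral>\<^sup>+\<theta>. ennreal (exp (g k z \<theta>)) \<partial>circ) \<le> ennreal (exp (v k))"
    and z: "norm z < 1" and m: "m \<le> n"
  shows "(\<integral>\<^sup>+\<omega>. ennreal (exp (\<Sum>k<m. g k (dch f (th \<omega>) (st z \<omega>) k) (th \<omega> k))) \<partial>M) \<le> ennreal (exp (\<Sum>k<m. v k))"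
proof -
  define T :: "nat \<Rightarrow> complex \<times> real \<Rightarrow> real \<Rightarrow> complex \<times> real" where
    "T k s \<theta> = (if k = 0 then (cis (- \<theta>) * fst s, snd s)
       else (fst s * exp (- f (cis \<theta> * fst s)), snd s + g (k - 1) (fst s) \<theta>))" for k s \<theta>
  \<comment> \<open>Step 0 is the rotation by \<open>X 0\<close> and collects nothing; the truncated
    \<open>k - 1\<close> accordingly gives \<open>V 0\<close> and \<open>V 1\<close> the same
    remaining sum.\<close>
  define V :: "nat \<Rightarrow> complex \<times> real \<Rightarrow> ennreal" where
    "V k s = (if norm (fst s) < 1 then ennreal (exp (snd s + (\<Sum>j\<in>{k-1..<m}. v j))) else \<top>)" for k s
  let ?N = "borel \<Otimes>\<^sub>M borel :: (complex \<times> real) measure"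
  note f_meas[measurable]
  have Tm: "(\<lambda>(s, \<theta>). T k s \<theta>) \<in> ?N \<Otimes>\<^sub>M borel \<rightarrow>\<^sub>M ?N" for k
  proof -
    have gm: "(\<lambda>x. g (k - 1) (fst (fst x)) (snd x)) \<in> borel_measurable (?N \<Otimes>\<^sub>M borel)"
      using measurable_compose[OF _ g[of "k - 1"], of "\<lambda>x. (fst (fst x), snd x)" "?N \<Otimes>\<^sub>M borel"] by simp
    show ?thesis unfolding T_def split_beta
    proof (cases "k = 0")
      case True
      have "(\<lambda>x. (cis (- snd x) * fst (fst x), snd (fst x))) \<in> ?N \<Otimes>\<^sub>M borel \<rightarrow>\<^sub>M ?N" by measurable
      then show "(\<lambda>p. if k = 0 then (cis (- snd p) * fst (fst p), snd (fst p)) else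
         (fst (fst p) * exp (- f (cis (snd p) * fst (fst p))), snd (fst p) + g (k - 1) (fst (fst p)) (snd p)))
         \<in> ?N \<Otimes>\<^sub>M borel \<rightarrow>\<^sub>M ?N" using True by simp
    next
      case False
      note gm[measurable]
      have "(\<lambda>p. (fst (fst p) * exp (- f (cis (snd p) * fst (fst p))), snd (fst p) + g (k - 1) (fst (fst p)) (snd p)))
         \<in> ?N \<Otimes>\<^sub>M borel \<rightarrow>\<^sub>M ?N" by measurable
      then show "(\<lambda>p. if k = 0 then (cis (- snd p) * fst (fst p), snd (fst p)) else
         (fst (fst p) * exp (- f (cis (snd p) * fst (fst p))), snd (fst p) + g (k - 1) (fst (fst p)) (snd p)))
         \<in> ?N \<Otimes>\<^sub>M borel \<rightarrow>\<^sub>M ?N" using False by simp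
    qed
  qed
  have Vm: "V k \<in> borel_measurable ?N" for k unfolding V_def[abs_def] by measurable
  have it: "iter T (z, 0) (\<lambda>i. X i \<omega>) (Suc k) = (dch f (th \<omega>) (st z \<omega>) k,
      \<Sum>j<k. g j (dch f (th \<omega>) (st z \<omega>) j) (th \<omega> j))" for k \<omega>
  proof (induction k)
    case 0 then show ?case by (simp add: T_def)
  next
    case (Suc k)
    have T_Suc: "T (Suc k) s \<theta> = (fst s * exp (- f (cis \<theta> * fst s)), snd s + g k (fst s) \<theta>)" for s \<theta>
      by (simp add: T_def)
    show ?case by (simp only: iter.simps(2)[of T _ _ "Suc k"] Suc T_Suc) simp
  qed
  have "(\<integral>\<^sup>+\<omega>. V (Suc m) (iter T (z, 0) (\<lambda>i. X i \<omega>) (Suc m)) \<partial>M) \<le> V 0 (z, 0)"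
  proof (rule nn_integral_iter_le[where n = "Suc m", OF _ _ Tm _ Vm])
    show "indep_vars (\<lambda>_. borel) X {..<Suc m}" by (rule indep_vars_subset[OF X_indep]) (use m in auto)
    show "distr M borel (X k) = circ" if "k < Suc m" for k using X_distr that m by auto
    fix k and s :: "complex \<times> real" assume k: "k < Suc m"
    show "(\<integral>\<^sup>+\<theta>. V (Suc k) (T k s \<theta>) \<partial>circ) \<le> V k s"
    proof (cases "norm (fst s) < 1")
      case False
      then show ?thesis by (simp add: V_def)
    next
      case True
      show ?thesis
      proof (cases k)
        case 0
        interpret Q: prob_space circ by (rule prob_space_circ)
        have "V (Suc k) (T k s \<theta>) = V k s" for \<theta> using 0 by (simp add: V_def T_def norm_mult)
        then show ?thesis using Q.emeasure_space_1 by simp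
      next
        case (Suc l)
        define W where "W = snd s + (\<Sum>j\<in>{Suc l..<m}. v j)"
        have l: "l < m" using k Suc by simp
        have lt: "norm (fst s * exp (- f (cis \<theta> * fst s))) < 1" for \<theta>
          using norm_dch_le[OF True, of "\<lambda>_. \<theta>" 1] True by simp
        have "V (Suc k) (T k s \<theta>) = ennreal (exp W) * ennreal (exp (g l (fst s) \<theta>))" for \<theta>
          using Suc lt[of \<theta>] by (simp add: V_def T_def W_def exp_add[symmetric] ennreal_mult[symmetric] algebra_simps)
        then have "(\<integral>\<^sup>+\<theta>. V (Suc k) (T k s \<theta>) \<partial>circ)
           = ennreal (exp W) * (\<integral>\<^sup>+\<theta>. ennreal (exp (g l (fst s) \<theta>)) \<partial>circ)"
          using g[of l] by (simp add: nn_integral_cmult)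
        also have "\<dots> \<le> ennreal (exp W) * ennreal (exp (v l))"
          by (intro mult_left_mono v l True) auto
        also have "\<dots> = V k s"
        proof -
          have "(\<Sum>j\<in>{l..<m}. v j) = v l + (\<Sum>j\<in>{Suc l..<m}. v j)" using l by (rule sum.atLeast_Suc_lessThan)
          then show ?thesis using Suc True
            by (simp add: V_def W_def exp_add[symmetric] ennreal_mult[symmetric] algebra_simps)
        qed
        finally show ?thesis .
      qed
    qed
  qed (auto simp: space_pair_measure)
  moreover have "V 0 (z, 0) = ennreal (exp (\<Sum>k<m. v k))"
    using z by (simp add: V_def lessThan_atLeast0)
  moreover have "V (Suc m) (iter T (z, 0) (\<lambda>i. X i \<omega>) (Suc m))
      = ennreal (exp (\<Sum>k<m. g k (dch f (th \<omega>) (st z \<omega>) k) (th \<omega> k)))" for \<omega>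
  proof -
    have "norm (st z \<omega>) < 1" using z by (simp add: norm_mult)
    from norm_dch_le[OF this, of "th \<omega>" m] this
    have "norm (dch f (th \<omega>) (st z \<omega>) m) < 1" by simp
    then show ?thesis unfolding it V_def by simp
  qed
  ultimately show ?thesis by simp
qed

end

section \<open>Tail bounds\<close>

lemma exp_le_quadratic:
  fixes x :: real
  assumes "\<bar>x\<bar> \<le> 1"
  shows "exp x \<le> 1 + x + x\<^sup>2"
proof (cases "0 \<le> x")
  case True then show ?thesis using exp_bound assms by simp
next
  case False
  have "exp x = 1 / exp (- x)" by (simp add: exp_minus inverse_eq_divide)
  also have "\<dots> \<le> 1 / (1 - x)" using exp_ge_add_one_self[of "- x"] False by (intro divide_left_mono) auto
  also have "\<dots> \<le> 1 + x + x\<^sup>2"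
  proof -
    have "(1 + x + x\<^sup>2) * (1 - x) = 1 - x ^ 3" by (simp add: power2_eq_square power3_eq_cube algebra_simps)
    moreover have "x ^ 3 \<le> 0" using False by (simp add: power_le_zero_eq)
    ultimately show ?thesis using False by (simp add: divide_le_eq)
  qed
  finally show ?thesis .
qed

lemma powr_one_plus_le:
  fixes x p :: real
  assumes "0 < x" "0 < p" "p \<le> 1"
  shows "(1 + x) powr p \<le> 1 + x powr p"
proof -
  have "(1 + x) powr p = (1 + x) * (1 + x) powr (p - 1)" using assms by (simp add: powr_mult_base)
  also have "\<dots> = (1 + x) powr (p - 1) + x * (1 + x) powr (p - 1)" by (simp add: algebra_simps)
  also have "\<dots> \<le> 1 powr (p - 1) + x * x powr (p - 1)"
    using assms by (intro add_mono mult_left_mono powr_mono2') auto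
  also have "\<dots> = 1 + x powr p" using assms by (simp add: powr_mult_base)
  finally show ?thesis .
qed

text \<open>The one-step Bernstein bound: \<open>exp x \<le> 1 + x + x^2\<close> is integrated, and
  \<open>1 + y \<le> exp y\<close> puts the result back into exponential form.\<close>

lemma circ_exp_moment:
  assumes h: "h \<in> borel_measurable borel" and h1: "\<And>\<theta>. \<bar>h \<theta>\<bar> \<le> 1"
    and mean: "integral\<^sup>L circ h \<le> \<mu>" and var: "(\<integral>\<theta>. (h \<theta>)\<^sup>2 \<partial>circ) \<le> \<sigma>"
  shows "(\<integral>\<^sup>+\<theta>. ennreal (exp (h \<theta>)) \<partial>circ) \<le> ennreal (exp (\<mu> + \<sigma>))"
proof -
  interpret Q: prob_space circ by (rule prob_space_circ)
  have hm: "h \<in> borel_measurable circ" using h by simp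
  have i1: "integrable circ h" by (rule Q.integrable_const_bound[of _ 1]) (use h1 hm in auto)
  have i2: "integrable circ (\<lambda>\<theta>. (h \<theta>)\<^sup>2)"
    by (rule Q.integrable_const_bound[of _ 1]) (use h1 hm in \<open>auto simp: abs_square_le_1\<close>)
  have "(\<integral>\<^sup>+\<theta>. ennreal (exp (h \<theta>)) \<partial>circ) \<le> (\<integral>\<^sup>+\<theta>. ennreal (1 + h \<theta> + (h \<theta>)\<^sup>2) \<partial>circ)"
    by (intro nn_integral_mono ennreal_leI exp_le_quadratic h1)
  also have "\<dots> = ennreal (\<integral>\<theta>. 1 + h \<theta> + (h \<theta>)\<^sup>2 \<partial>circ)"
  proof (rule nn_integral_eq_integral)
    show "integrable circ (\<lambda>\<theta>. 1 + h \<theta> + (h \<theta>)\<^sup>2)" using i1 i2 by auto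
    show "AE x in circ. 0 \<le> 1 + h x + (h x)\<^sup>2"
      using h1 by (auto intro!: always_eventually) (smt (verit) zero_le_power2)
  qed
  also have "(\<integral>\<theta>. 1 + h \<theta> + (h \<theta>)\<^sup>2 \<partial>circ) = 1 + integral\<^sup>L circ h + (\<integral>\<theta>. (h \<theta>)\<^sup>2 \<partial>circ)"
    using i1 i2 Q.prob_space by (simp add: Bochner_Integration.integral_add)
  also have "ennreal (1 + integral\<^sup>L circ h + (\<integral>\<theta>. (h \<theta>)\<^sup>2 \<partial>circ)) \<le> ennreal (1 + (\<mu> + \<sigma>))"
    using mean var by (intro ennreal_leI) simp
  also have "\<dots> \<le> ennreal (exp (\<mu> + \<sigma>))" by (intro ennreal_leI exp_ge_add_one_self)
  finally show ?thesis .
qed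

section \<open>Mean, variance and exponential moments of one step\<close>

context hl_map
begin

lemma c_le_bound: "c \<le> C * d"
  using f_bound[of 0] f0 c_pos by simp

lemma f_arg_measurable: "(\<lambda>\<theta>. f (cis \<theta> * z)) \<in> borel_measurable borel"
proof -
  note f_meas[measurable]
  show ?thesis by measurable
qed

lemma Re_f_mean: "norm z < 1 \<Longrightarrow> has_bochner_integral circ (\<lambda>\<theta>. Re (f (cis \<theta> * z))) c"
  using circle_mean_Re[OF hol] f0 by simp

text \<open>\<open>Re f\<close> lies between 0 and \<open>C * d\<close>, so its square is at most
  \<open>C * d\<close> times itself, and the mean of \<open>Re f\<close> is only \<open>c\<close>.
  The result is of order \<open>d^3\<close> instead of the naive \<open>d^2\<close>.\<close>

lemma Re_f_square:
  assumes z: "norm z < 1"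
  shows "integrable circ (\<lambda>\<theta>. (Re (f (cis \<theta> * z)))\<^sup>2)" "(\<integral>\<theta>. (Re (f (cis \<theta> * z)))\<^sup>2 \<partial>circ) \<le> C * d * c"
proof -
  interpret Q: prob_space circ by (rule prob_space_circ)
  have u: "norm (cis \<theta> * z) < 1" for \<theta> using z by (simp add: norm_mult)
  have le: "Re (f (cis \<theta> * z)) \<le> C * d" "0 \<le> Re (f (cis \<theta> * z))" for \<theta>
    using f_bound[OF u] Re_nonneg[OF u] complex_Re_le_cmod order_trans by blast+
  have sq: "(Re (f (cis \<theta> * z)))\<^sup>2 \<le> C * d * Re (f (cis \<theta> * z))" for \<theta>
    unfolding power2_eq_square using le by (intro mult_right_mono) auto
  note f_arg_measurable[of z, measurable]
  show i: "integrable circ (\<lambda>\<theta>. (Re (f (cis \<theta> * z)))\<^sup>2)"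
    by (rule Q.integrable_const_bound[of _ "(C * d)\<^sup>2"])
       (use le in \<open>auto intro!: power_mono\<close>)
  have m: "has_bochner_integral circ (\<lambda>\<theta>. C * d * Re (f (cis \<theta> * z))) (C * d * c)"
    by (rule has_bochner_integral_mult_right) (use Re_f_mean[OF z] in auto)
  have "(\<integral>\<theta>. (Re (f (cis \<theta> * z)))\<^sup>2 \<partial>circ) \<le> (\<integral>\<theta>. C * d * Re (f (cis \<theta> * z)) \<partial>circ)"
    by (intro integral_mono i sq) (use m in \<open>auto simp: has_bochner_integral_iff\<close>)
  also have "\<dots> = C * d * c" using m by (simp add: has_bochner_integral_iff)
  finally show "(\<integral>\<theta>. (Re (f (cis \<theta> * z)))\<^sup>2 \<partial>circ) \<le> C * d * c" .
qed

text \<open>Since \<open>(f - c)\<^sup>2\<close> has mean zero, the real and imaginary parts of \<open>f - c\<close> have the same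
  variance.\<close>

lemma f_variance:
  assumes z: "norm z < 1"
  shows "integrable circ (\<lambda>\<theta>. (norm (f (cis \<theta> * z) - of_real c))\<^sup>2)"
    "(\<integral>\<theta>. (norm (f (cis \<theta> * z) - of_real c))\<^sup>2 \<partial>circ) \<le> 2 * C * d * c"
proof -
  interpret Q: prob_space circ by (rule prob_space_circ)
  let ?r = "\<lambda>\<theta>. Re (f (cis \<theta> * z))"
  have "(\<lambda>w. (f w - of_real c)\<^sup>2) holomorphic_on ball 0 1" by (intro holomorphic_intros hol)
  from circle_mean_Re[OF this z] have h0: "has_bochner_integral circ (\<lambda>\<theta>. Re ((f (cis \<theta> * z) - of_real c)\<^sup>2)) 0"
    by (simp add: f0)
  \<comment> \<open>The identity \<open>(norm w)^2 = 2 * (Re w)^2 - Re (w^2)\<close> for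
    \<open>w = f - c\<close>; the last term has mean zero.\<close>
  have e: "(norm (f (cis \<theta> * z) - of_real c))\<^sup>2
     = 2 * (?r \<theta>)\<^sup>2 - 4 * c * ?r \<theta> + 2 * c\<^sup>2 - Re ((f (cis \<theta> * z) - of_real c)\<^sup>2)" for \<theta>
    unfolding cmod_power2 by (simp add: power2_eq_square algebra_simps)
  define I where "I = (\<integral>\<theta>. (?r \<theta>)\<^sup>2 \<partial>circ)"
  have hI: "has_bochner_integral circ (\<lambda>\<theta>. (?r \<theta>)\<^sup>2) I"
    unfolding I_def using Re_f_square(1)[OF z] by (rule has_bochner_integral_integrable)
  have hc: "has_bochner_integral circ (\<lambda>\<theta>. 2 * c\<^sup>2) (2 * c\<^sup>2)"
    by (simp add: has_bochner_integral_iff Q.prob_space)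
  have hb: "has_bochner_integral circ (\<lambda>\<theta>. (norm (f (cis \<theta> * z) - of_real c))\<^sup>2) (2 * I - 4 * c * c + 2 * c\<^sup>2 - 0)"
    unfolding e
    by (intro has_bochner_integral_diff has_bochner_integral_add has_bochner_integral_mult_right
        hI hc h0 Re_f_mean[OF z])
  show "integrable circ (\<lambda>\<theta>. (norm (f (cis \<theta> * z) - of_real c))\<^sup>2)"
    using hb by (rule integrable.intros)
  have "(\<integral>\<theta>. (norm (f (cis \<theta> * z) - of_real c))\<^sup>2 \<partial>circ) = 2 * I - 4 * c * c + 2 * c\<^sup>2 - 0"
    using hb by (rule has_bochner_integral_integral_eq)
  also have "\<dots> \<le> 2 * C * d * c"
  proof -
    have "4 * c * c = 4 * c\<^sup>2" "2 * C * d * c = 2 * (C * d * c)" by (simp_all add: power2_eq_square)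
    then show ?thesis using Re_f_square(2)[OF z, folded I_def] zero_le_power2[of c] by linarith
  qed
  finally show "(\<integral>\<theta>. (norm (f (cis \<theta> * z) - of_real c))\<^sup>2 \<partial>circ) \<le> 2 * C * d * c" .
qed

text \<open>Martingale increments, truncated where \<open>Re (Hs f \<theta> z k)\<close> falls short of its mean \<open>c * k\<close> by
  more than \<open>A\<close>: as long as this does not happen, \<open>f - c\<close> is of order \<open>1 / k\<close> at step \<open>k\<close>.\<close>

definition tinc :: "real \<Rightarrow> nat \<Rightarrow> complex \<Rightarrow> real \<Rightarrow> complex" where
  "tinc A k z \<theta> = (if norm z \<le> exp (- (c * real k - A)) then f (cis \<theta> * z) - of_real c else 0)"

lemma tinc_measurable: "(\<lambda>(z, \<theta>). tinc A k z \<theta>) \<in> borel_measurable (borel \<Otimes>\<^sub>M borel)"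
proof -
  note f_meas[measurable]
  show ?thesis unfolding tinc_def split_beta by measurable
qed

text \<open>The increments have mean zero. Before \<open>k0\<close> the variance bound for
  \<open>f\<close> is used; from \<open>k0\<close> on, the truncation forces
  \<open>norm z \<le> exp (- c * k / 2)\<close>, and \<open>f_near_c\<close> makes the increment at
  most \<open>4 / k\<close>. The unit factor \<open>u\<close> selects a direction in the
  plane.\<close>

lemma tinc_mgf:
  assumes z: "norm z < 1" and u: "norm u = 1" and l: "0 < l" "2 * C * d * l \<le> 1"
    and k0: "1 \<le> k0" "2 * A \<le> c * real k0"
  shows "(\<integral>\<^sup>+\<theta>. ennreal (exp (l * Re (u * tinc A k z \<theta>))) \<partial>circ)
      \<le> ennreal (exp (l\<^sup>2 * (if k < k0 then 2 * C * d * c else 16 / (real k)\<^sup>2)))"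
    (is "_ \<le> ennreal (exp (l\<^sup>2 * ?v))")
proof -
  interpret Q: prob_space circ by (rule prob_space_circ)
  have v0: "0 \<le> ?v" using C_ge d_pos c_pos by simp
  show ?thesis
  proof (cases "norm z \<le> exp (- (c * real k - A))")
    case False
    then have "(\<integral>\<^sup>+\<theta>. ennreal (exp (l * Re (u * tinc A k z \<theta>))) \<partial>circ) = 1"
      using Q.emeasure_space_1 by (simp add: tinc_def)
    also have "\<dots> \<le> ennreal (exp (l\<^sup>2 * ?v))"
      unfolding ennreal_1[symmetric] by (intro ennreal_leI) (use v0 in simp)
    finally show ?thesis .
  next
    case True
    let ?x = "\<lambda>\<theta>. f (cis \<theta> * z) - of_real c"
    have uu: "norm (cis \<theta> * z) < 1" for \<theta> using z by (simp add: norm_mult)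
    have x2: "norm (?x \<theta>) \<le> 2 * C * d" for \<theta>
      using norm_triangle_ineq4[of "f (cis \<theta> * z)" "of_real c"] f_bound[OF uu[of \<theta>]] c_le_bound c_pos by simp
    have Re_le: "\<bar>Re (u * w)\<bar> \<le> norm w" for w
      using abs_Re_le_cmod[of "u * w"] u by (simp add: norm_mult)
    note f_arg_measurable[of z, measurable]
    have "(\<integral>\<^sup>+\<theta>. ennreal (exp (l * Re (u * ?x \<theta>))) \<partial>circ) \<le> ennreal (exp (0 + l\<^sup>2 * ?v))"
    proof (rule circ_exp_moment)
      show "(\<lambda>\<theta>. l * Re (u * ?x \<theta>)) \<in> borel_measurable borel" by measurable
      show "\<bar>l * Re (u * ?x \<theta>)\<bar> \<le> 1" for \<theta>
      proof -
        have "\<bar>l * Re (u * ?x \<theta>)\<bar> \<le> l * (2 * C * d)"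
          unfolding abs_mult using Re_le[of "?x \<theta>"] x2[of \<theta>] l by (intro mult_mono) auto
        then show ?thesis using l(2) by (simp add: mult.commute)
      qed
      have "(\<lambda>w. u * (f w - of_real c)) holomorphic_on ball 0 1" by (intro holomorphic_intros hol)
      from circle_mean_Re[OF this z] have m: "has_bochner_integral circ (\<lambda>\<theta>. Re (u * ?x \<theta>)) 0" by (simp add: f0)
      then show "(\<integral>\<theta>. l * Re (u * ?x \<theta>) \<partial>circ) \<le> 0" by (simp add: has_bochner_integral_iff)
      have "(\<integral>\<theta>. (l * Re (u * ?x \<theta>))\<^sup>2 \<partial>circ) \<le> (\<integral>\<theta>. l\<^sup>2 * (norm (?x \<theta>))\<^sup>2 \<partial>circ)"
      proof (rule integral_mono)
        show "(l * Re (u * ?x \<theta>))\<^sup>2 \<le> l\<^sup>2 * (norm (?x \<theta>))\<^sup>2" for \<theta>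
          unfolding power_mult_distrib using Re_le[of "?x \<theta>"]
          by (intro mult_left_mono) (metis abs_le_square_iff abs_norm_cancel, simp)
        then show "integrable circ (\<lambda>\<theta>. (l * Re (u * ?x \<theta>))\<^sup>2)"
          by (intro Bochner_Integration.integrable_bound[OF integrable_mult_right[OF f_variance(1)[OF z], of "l\<^sup>2"]]) auto
      qed (use f_variance(1)[OF z] in auto)
      also have "\<dots> = l\<^sup>2 * (\<integral>\<theta>. (norm (?x \<theta>))\<^sup>2 \<partial>circ)" by simp
      also have "\<dots> \<le> l\<^sup>2 * ?v"
      proof (rule mult_left_mono)
        show "(\<integral>\<theta>. (norm (?x \<theta>))\<^sup>2 \<partial>circ) \<le> ?v"
        proof (cases "k < k0")
          case True then show ?thesis using f_variance(2)[OF z] by simp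
        next
          case False
          define y where "y = c * real k - A"
          have "c * real k0 \<le> c * real k" using False c_pos by simp
          then have y: "c * real k / 2 \<le> y" using k0 by (simp add: y_def)
          have kk: "0 < real k" using False k0 by simp
          have y0: "0 < y" using y kk c_pos by (smt (verit) half_gt_zero mult_pos_pos)
          have x4: "norm (?x \<theta>) \<le> 4 / real k" for \<theta>
          proof -
            have "norm (?x \<theta>) \<le> 2 * c * norm z / (1 - norm z)"
              using f_near_c[OF uu[of \<theta>]] by (simp add: norm_mult)
            also have "\<dots> \<le> 2 * c * exp (- y) / (1 - exp (- y))"
              using True y0 c_pos z unfolding y_def[symmetric] by (intro frac_le mult_left_mono) auto
            also have "\<dots> = 2 * c / (exp y - 1)" using y0 by (simp add: exp_minus field_simps)
            also have "\<dots> \<le> 2 * c / y" proof (rule divide_left_mono)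
              show "y \<le> exp y - 1" using exp_ge_add_one_self[of y] by linarith
            qed (use y0 c_pos in auto)
            also have "\<dots> \<le> 2 * c / (c * real k / 2)" using y y0 c_pos kk by (intro divide_left_mono) auto
            also have "\<dots> = 4 / real k" using c_pos by simp
            finally show ?thesis .
          qed
          have "(\<integral>\<theta>. (norm (?x \<theta>))\<^sup>2 \<partial>circ) \<le> (\<integral>\<theta>. (4 / real k)\<^sup>2 \<partial>circ)"
            by (intro integral_mono f_variance(1) z power_mono x4) auto
          then show ?thesis using False Q.prob_space by (simp add: power_divide)
        qed
      qed simp
      finally show "(\<integral>\<theta>. (l * Re (u * ?x \<theta>))\<^sup>2 \<partial>circ) \<le> l\<^sup>2 * ?v" .
    qed
    then show ?thesis using True by (simp add: tinc_def)
  qed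
qed

end

lemma sum_inverse_squares_tail:
  assumes "1 \<le> k0"
  shows "(\<Sum>k\<in>{k0..<m}. 16 / (real k)\<^sup>2) \<le> 32 / real k0"
proof -
  have *: "(\<Sum>k\<in>{k0..<m}. 16 / (real k)\<^sup>2) \<le> 32 / real k0 - 32 / real m" if "k0 \<le> m" for m
    using that
  proof (induction m rule: dec_induct)
    case base then show ?case by simp
  next
    case (step m)
    have m: "1 \<le> real m" using step assms by simp
    have "16 / (real m)\<^sup>2 \<le> 32 / real m - 32 / (real m + 1)"
      using m by (simp add: divide_simps power2_eq_square)
    then show ?case using step by (simp add: add.commute)
  qed
  show ?thesis
  proof (cases "k0 \<le> m")
    case True then show ?thesis using *[of m] by (smt (verit) divide_nonneg_nonneg of_nat_0_le_iff)
  qed simp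
qed

section \<open>Tail bounds from a single starting point\<close>

context hl_prob
begin

lemma st_lt: "norm z < 1 \<Longrightarrow> norm (st z \<omega>) < 1" "norm (st z \<omega>) = norm z"
  by (simp_all add: norm_mult)

lemma chain_sum_measurable:
  fixes g :: "nat \<Rightarrow> complex \<Rightarrow> real \<Rightarrow> real"
  assumes g: "\<And>k. (\<lambda>(z, \<theta>). g k z \<theta>) \<in> borel_measurable (borel \<Otimes>\<^sub>M borel)"
  shows "(\<lambda>\<omega>. \<Sum>k<m. g k (dch f (th \<omega>) (st z \<omega>) k) (th \<omega> k)) \<in> borel_measurable M"
proof (intro borel_measurable_sum)
  fix k
  have "(\<lambda>\<omega>. (dch f (th \<omega>) (st z \<omega>) k, th \<omega> k)) \<in> M \<rightarrow>\<^sub>M borel \<Otimes>\<^sub>M borel"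
    by (intro measurable_Pair dch_measurable X_meas)
  from measurable_compose[OF this g[of k]]
  show "(\<lambda>\<omega>. g k (dch f (th \<omega>) (st z \<omega>) k) (th \<omega> k)) \<in> borel_measurable M" by simp
qed

lemma chain_tail:
  fixes g :: "nat \<Rightarrow> complex \<Rightarrow> real \<Rightarrow> real"
  assumes g: "\<And>k. (\<lambda>(z, \<theta>). g k z \<theta>) \<in> borel_measurable (borel \<Otimes>\<^sub>M borel)"
    and v: "\<And>k z. k < m \<Longrightarrow> norm z < 1 \<Longrightarrow> (\<integral>\<^sup>+\<theta>. ennreal (exp (g k z \<theta>)) \<partial>circ) \<le> ennreal (exp (v k))"
    and z: "norm z < 1" and m: "m \<le> n"
  shows "prob {\<omega> \<in> space M. y \<le> (\<Sum>k<m. g k (dch f (th \<omega>) (st z \<omega>) k) (th \<omega> k))} \<le> exp ((\<Sum>k<m. v k) - y)"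
proof -
  define S where "S \<omega> = (\<Sum>k<m. g k (dch f (th \<omega>) (st z \<omega>) k) (th \<omega> k))" for \<omega>
  have Sm[measurable]: "S \<in> borel_measurable M" unfolding S_def[abs_def] by (rule chain_sum_measurable[OF g])
  have A: "{\<omega> \<in> space M. y \<le> S \<omega>} \<in> events" by measurable
  have "ennreal (prob {\<omega> \<in> space M. y \<le> S \<omega>}) = (\<integral>\<^sup>+\<omega>. indicator {\<omega> \<in> space M. y \<le> S \<omega>} \<omega> \<partial>M)"
    using A by (simp add: emeasure_eq_measure)
  also have "\<dots> \<le> (\<integral>\<^sup>+\<omega>. ennreal (exp (- y)) * ennreal (exp (S \<omega>)) \<partial>M)"
    by (intro nn_integral_mono)
       (auto simp: indicator_def ennreal_mult[symmetric] exp_add[symmetric] simp flip: ennreal_1 intro!: ennreal_leI)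
  also have "\<dots> = ennreal (exp (- y)) * (\<integral>\<^sup>+\<omega>. ennreal (exp (S \<omega>)) \<partial>M)"
    by (rule nn_integral_cmult) measurable
  also have "\<dots> \<le> ennreal (exp (- y)) * ennreal (exp (\<Sum>k<m. v k))"
    unfolding S_def by (intro mult_left_mono chain_exp[OF g v z m]) auto
  also have "\<dots> = ennreal (exp ((\<Sum>k<m. v k) - y))"
    by (simp add: ennreal_mult[symmetric] exp_add[symmetric])
  finally show ?thesis unfolding S_def by simp
qed

text \<open>A Chernoff bound that needs no truncation, because \<open>Re f\<close> is nonnegative
  and bounded. With \<open>l * (C * d) = 1/4\<close> the quadratic term costs a quarter of the drift
  \<open>c\<close>; the gap between 3/4 and 5/8 is left for the exponent.\<close>

lemma lower_tail:
  assumes z: "norm z < 1" and m: "m \<le> n"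
  shows "prob {\<omega> \<in> space M. Re (Hs f (th \<omega>) (st z \<omega>) m) \<le> 5/8 * c * real m} \<le> exp (- (c * real m) / (32 * C * d))"
proof -
  define l where "l = 1 / (4 * C * d)"
  have Cd: "0 < C * d" using C_ge d_pos by simp
  have l0: "0 < l" using Cd by (simp add: l_def mult.assoc)
  note f_meas[measurable]
  have gm: "(\<lambda>(z, \<theta>). - l * Re (f (cis \<theta> * z))) \<in> borel_measurable (borel \<Otimes>\<^sub>M borel)"
    unfolding split_beta by measurable
  have mgf: "(\<integral>\<^sup>+\<theta>. ennreal (exp (- l * Re (f (cis \<theta> * w)))) \<partial>circ) \<le> ennreal (exp (- (3/4) * l * c))"
    if w: "norm w < 1" for w
  proof -
    have u: "norm (cis \<theta> * w) < 1" for \<theta> using w by (simp add: norm_mult)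
    have le: "Re (f (cis \<theta> * w)) \<le> C * d" "0 \<le> Re (f (cis \<theta> * w))" for \<theta>
      using f_bound[OF u] Re_nonneg[OF u] complex_Re_le_cmod order_trans by blast+
    note f_arg_measurable[of w, measurable]
    have lC: "l * (C * d) = 1/4" using d_pos C_ge by (simp add: l_def)
    have "(\<integral>\<^sup>+\<theta>. ennreal (exp (- l * Re (f (cis \<theta> * w)))) \<partial>circ) \<le> ennreal (exp (- l * c + l\<^sup>2 * (C * d * c)))"
    proof (rule circ_exp_moment)
      show "(\<lambda>\<theta>. - l * Re (f (cis \<theta> * w))) \<in> borel_measurable borel" by measurable
      show "\<bar>- l * Re (f (cis \<theta> * w))\<bar> \<le> 1" for \<theta>
      proof -
        have "\<bar>- l * Re (f (cis \<theta> * w))\<bar> = l * Re (f (cis \<theta> * w))" using le[of \<theta>] l0 by (simp add: abs_mult)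
        also have "\<dots> \<le> l * (C * d)" by (rule mult_left_mono) (use le l0 in auto)
        finally show ?thesis using lC by simp
      qed
      show "(\<integral>\<theta>. - l * Re (f (cis \<theta> * w)) \<partial>circ) \<le> - l * c"
        using Re_f_mean[OF w] by (simp add: has_bochner_integral_iff)
      have "(\<integral>\<theta>. (- l * Re (f (cis \<theta> * w)))\<^sup>2 \<partial>circ) = l\<^sup>2 * (\<integral>\<theta>. (Re (f (cis \<theta> * w)))\<^sup>2 \<partial>circ)"
        by (simp add: power_mult_distrib)
      also have "\<dots> \<le> l\<^sup>2 * (C * d * c)" by (rule mult_left_mono[OF Re_f_square(2)[OF w]]) simp
      finally show "(\<integral>\<theta>. (- l * Re (f (cis \<theta> * w)))\<^sup>2 \<partial>circ) \<le> l\<^sup>2 * (C * d * c)" .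
    qed
    also have "- l * c + l\<^sup>2 * (C * d * c) = - l * c + (l * (C * d)) * (l * c)" by (simp add: power2_eq_square)
    also have "\<dots> = - (3/4) * l * c" unfolding lC by simp
    finally show ?thesis .
  qed
  have S: "(\<Sum>k<m. - l * Re (f (cis (th \<omega> k) * dch f (th \<omega>) (st z \<omega>) k))) = - l * Re (Hs f (th \<omega>) (st z \<omega>) m)" for \<omega>
    by (simp add: Hs_def sum_distrib_left sum_negf)
  have "prob {\<omega> \<in> space M. - l * (5/8 * c * real m) \<le> - l * Re (Hs f (th \<omega>) (st z \<omega>) m)}
     \<le> exp ((\<Sum>k<m. - (3/4) * l * c) - (- l * (5/8 * c * real m)))"
    using chain_tail[where g = "\<lambda>_ z \<theta>. - l * Re (f (cis \<theta> * z))" and y = "- l * (5/8 * c * real m)", OF gm mgf z m]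
    by (simp only: S)
  also have "(\<Sum>k<m. - (3/4) * l * c) - (- l * (5/8 * c * real m)) = - (l * (c * real m)) / 8" by (simp add: field_simps)
  also have "- (l * (c * real m)) / 8 = - (c * real m) / (32 * C * d)" by (simp add: l_def)
  finally have fin: "prob {\<omega> \<in> space M. - l * (5/8 * c * real m) \<le> - l * Re (Hs f (th \<omega>) (st z \<omega>) m)}
     \<le> exp (- (c * real m) / (32 * C * d))" .
  have "- l * (5/8 * c * real m) \<le> - l * R \<longleftrightarrow> R \<le> 5/8 * c * real m" for R
    using l0 by (simp only: mult_minus_left neg_le_iff_le mult_le_cancel_left_pos)
  with fin show ?thesis by (simp only:)
qed

text \<open>The logarithm turns the product into a sum along the chain. For \<open>p < 1\<close> one
  has \<open>(1 + x) powr p \<le> 1 + x powr p\<close>, the power \<open>- p\<close> of the smaller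
  distance is at most the sum of both powers, and \<open>circle_kernel_bound\<close> controls their
  means uniformly up to the circle; as \<open>p\<close> tends to 1 that bound degenerates.\<close>

lemma growth_tail:
  assumes z: "norm z < 1" and m: "m \<le> n" and p: "0 < p" "p < 1" and y: "0 < y"
  shows "prob {\<omega> \<in> space M. y \<le> growth (th \<omega>) (st z \<omega>) m}
     \<le> exp (real m * ((2 * C * d) powr p * (2 / cos (p * pi / 2))) - p * ln y)"
proof -
  let ?K = "(2 * C * d) powr p * (2 / cos (p * pi / 2))"
  define x where "x u = 2 * C * d / sdist u" for u
  have Cd: "0 < 2 * C * d" using C_ge d_pos by simp
  have cpos: "0 < cos (p * pi / 2)"
  proof (rule cos_gt_zero_pi)
    have "0 < p * pi" "p * pi < 1 * pi" using p by auto
    then show "- (pi / 2) < p * pi / 2" "p * pi / 2 < pi / 2" by linarith+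
  qed
  have x0: "0 < x u" if "norm u < 1" for u using sdist_pos[OF that] Cd by (simp add: x_def)
  note sdist_measurable[measurable]
  have gm: "(\<lambda>(z, \<theta>). p * ln (1 + x (cis \<theta> * z))) \<in> borel_measurable (borel \<Otimes>\<^sub>M borel)"
    unfolding split_beta x_def by measurable
  have mgf: "(\<integral>\<^sup>+\<theta>. ennreal (exp (p * ln (1 + x (cis \<theta> * w)))) \<partial>circ) \<le> ennreal (exp ?K)"
    if w: "norm w < 1" for w
  proof -
    interpret Q: prob_space circ by (rule prob_space_circ)
    have u: "norm (cis \<theta> * w) < 1" for \<theta> using w by (simp add: norm_mult)
    let ?A = "\<lambda>\<theta>. norm (cis \<theta> * w - a) powr (- p)" and ?B = "\<lambda>\<theta>. norm (cis \<theta> * w - b) powr (- p)"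
    have pt: "exp (p * ln (1 + x (cis \<theta> * w))) \<le> 1 + (2 * C * d) powr p * (?A \<theta> + ?B \<theta>)" for \<theta>
    proof -
      let ?u = "cis \<theta> * w"
      have sd: "sdist ?u powr (- p) \<le> ?A \<theta> + ?B \<theta>" by (simp add: sdist_def min_def)
      have "exp (p * ln (1 + x ?u)) = (1 + x ?u) powr p" using x0[OF u[of \<theta>]] by (simp add: powr_def)
      also have "\<dots> \<le> 1 + x ?u powr p" by (rule powr_one_plus_le) (use x0[OF u[of \<theta>]] p in auto)
      also have "x ?u powr p = (2 * C * d) powr p * sdist ?u powr (- p)"
      proof -
        have "(2 * C * d / sdist ?u) powr p = (2 * C * d) powr p / sdist ?u powr p" by (rule powr_divide)
        then show ?thesis unfolding x_def by (simp add: powr_minus divide_inverse)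
      qed
      also have "1 + \<dots> \<le> 1 + (2 * C * d) powr p * (?A \<theta> + ?B \<theta>)" using sd by (intro add_left_mono mult_left_mono) auto
      finally show ?thesis .
    qed
    have "(\<integral>\<^sup>+\<theta>. ennreal (exp (p * ln (1 + x (cis \<theta> * w)))) \<partial>circ)
       \<le> (\<integral>\<^sup>+\<theta>. 1 + ennreal ((2 * C * d) powr p) * (ennreal (?A \<theta>) + ennreal (?B \<theta>)) \<partial>circ)"
    proof (rule nn_integral_mono)
      fix \<theta>
      have "ennreal (exp (p * ln (1 + x (cis \<theta> * w)))) \<le> ennreal (1 + (2 * C * d) powr p * (?A \<theta> + ?B \<theta>))"
        by (rule ennreal_leI[OF pt])
      then show "ennreal (exp (p * ln (1 + x (cis \<theta> * w)))) \<le> 1 + ennreal ((2 * C * d) powr p) * (ennreal (?A \<theta>) + ennreal (?B \<theta>))"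
        by (simp add: ennreal_mult ennreal_plus)
    qed
    also have "\<dots> = 1 + ennreal ((2 * C * d) powr p) * ((\<integral>\<^sup>+\<theta>. ennreal (?A \<theta>) \<partial>circ) + (\<integral>\<^sup>+\<theta>. ennreal (?B \<theta>) \<partial>circ))"
      using Q.emeasure_space_1 by (simp add: nn_integral_add nn_integral_cmult)
    also have "\<dots> \<le> 1 + ennreal ((2 * C * d) powr p) * (ennreal (1 / cos (p * pi / 2)) + ennreal (1 / cos (p * pi / 2)))"
      by (intro add_left_mono mult_left_mono add_mono circle_kernel_bound p a1 b1 w) auto
    also have "\<dots> = ennreal (1 + ?K)"
      using cpos by (simp add: ennreal_mult[symmetric] ennreal_plus[symmetric] del: ennreal_plus)
        (simp add: ennreal_plus flip: ennreal_1)
    also have "\<dots> \<le> ennreal (exp ?K)" by (intro ennreal_leI exp_ge_add_one_self)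
    finally show ?thesis .
  qed
  have S: "(\<Sum>k<m. p * ln (1 + x (cis (th \<omega> k) * dch f (th \<omega>) (st z \<omega>) k))) = p * ln (growth (th \<omega>) (st z \<omega>) m)" for \<omega>
  proof -
    have "ln (growth (th \<omega>) (st z \<omega>) m) = (\<Sum>k<m. ln (1 + x (cis (th \<omega> k) * dch f (th \<omega>) (st z \<omega>) k)))"
      unfolding growth_def x_def[symmetric]
    proof (rule ln_prod)
      fix k
      show "1 + x (cis (th \<omega> k) * dch f (th \<omega>) (st z \<omega>) k) \<noteq> 0"
        using x0[OF norm_arg_lt[OF st_lt(1)[OF z]], of "th \<omega> k" "th \<omega>" \<omega> k] by linarith
    qed auto
    then show ?thesis by (simp add: sum_distrib_left)
  qed
  have g1: "1 \<le> growth (th \<omega>) (st z \<omega>) m" for \<omega> by (rule growth_ge_1[OF st_lt(1)[OF z]])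
  have "prob {\<omega> \<in> space M. y \<le> growth (th \<omega>) (st z \<omega>) m}
     = prob {\<omega> \<in> space M. p * ln y \<le> p * ln (growth (th \<omega>) (st z \<omega>) m)}"
    using y p g1 by (intro arg_cong[of _ _ prob] Collect_cong) (smt (verit) ln_le_cancel_iff mult_le_cancel_left_pos)
  also have "\<dots> \<le> exp ((\<Sum>k<m. ?K) - p * ln y)"
    using chain_tail[of "\<lambda>_ z \<theta>. p * ln (1 + x (cis \<theta> * z))", OF gm mgf z m] unfolding S by simp
  finally show ?thesis by simp
qed

text \<open>A bootstrap: while the truncated sums stay within \<open>A\<close>, the chain is deep
  enough in the disc for the truncation to be inactive at the next step, so the truncated sums are
  the true deviations.\<close>

lemma Hs_eq_tinc:
  assumes z: "norm z < 1" and small: "\<And>k. k \<le> m \<Longrightarrow> norm (\<Sum>j<k. tinc A j (dch f (th \<omega>) (st z \<omega>) j) (th \<omega> j)) \<le> A"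
  shows "k \<le> m \<Longrightarrow> Hs f (th \<omega>) (st z \<omega>) k - of_real (c * real k) = (\<Sum>j<k. tinc A j (dch f (th \<omega>) (st z \<omega>) j) (th \<omega> j))"
proof (induction k)
  case (Suc k)
  have IH: "Hs f (th \<omega>) (st z \<omega>) k - of_real (c * real k) = (\<Sum>j<k. tinc A j (dch f (th \<omega>) (st z \<omega>) j) (th \<omega> j))"
    using Suc by simp
  then have "norm (Hs f (th \<omega>) (st z \<omega>) k - of_real (c * real k)) \<le> A" using small[of k] Suc by simp
  then have "c * real k - A \<le> Re (Hs f (th \<omega>) (st z \<omega>) k)"
    using abs_Re_le_cmod[of "Hs f (th \<omega>) (st z \<omega>) k - of_real (c * real k)"] by simp
  then have "norm (dch f (th \<omega>) (st z \<omega>) k) \<le> 1 * exp (- (c * real k - A))"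
    unfolding norm_dch st_lt(2) using z by (intro mult_mono) auto
  then have "tinc A k (dch f (th \<omega>) (st z \<omega>) k) (th \<omega> k) = f (cis (th \<omega> k) * dch f (th \<omega>) (st z \<omega>) k) - of_real c"
    by (simp add: tinc_def)
  then show ?case using IH by (simp add: Hs_Suc algebra_simps)
qed simp

text \<open>A union over the times up to \<open>m\<close> and the four directions in
  \<open>?U\<close>: bounding every signed coordinate by \<open>A / 2\<close> bounds the norm by
  \<open>A\<close>. The moment bounds for the truncated sums hold unconditionally, and
  \<open>Hs_eq_tinc\<close> transfers the conclusion to \<open>Hs\<close>.\<close>

lemma concentration:
  assumes z: "norm z < 1" and m: "m \<le> n" and l: "0 < l" "2 * C * d * l \<le> 1"
    and k0: "1 \<le> k0" "2 * A \<le> c * real k0"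
  shows "prob {\<omega> \<in> space M. \<not> (\<forall>k\<le>m. norm (Hs f (th \<omega>) (st z \<omega>) k - of_real (c * real k)) \<le> A)}
     \<le> 4 * (real m + 1) * exp (l\<^sup>2 * (real k0 * (2 * C * d * c) + 32 / real k0) - l * A / 2)"
proof -
  define Y where "Y k \<omega> = (\<Sum>j<k. tinc A j (dch f (th \<omega>) (st z \<omega>) j) (th \<omega> j))" for k \<omega>
  define v where "v k = l\<^sup>2 * (if k < k0 then 2 * C * d * c else 16 / (real k)\<^sup>2)" for k
  let ?V = "real k0 * (2 * C * d * c) + 32 / real k0"
  let ?U = "{1, - 1, \<i>, - \<i>} :: complex set"
  have Cdc: "0 \<le> 2 * C * d * c" using C_ge d_pos c_pos by simp
  have sumv: "(\<Sum>k<i. v k) \<le> l\<^sup>2 * ?V" for i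
  proof -
    have "(\<Sum>k<i. if k < k0 then 2 * C * d * c else 16 / (real k)\<^sup>2)
       \<le> (\<Sum>k<k0. 2 * C * d * c) + (\<Sum>k\<in>{k0..<i}. 16 / (real k)\<^sup>2)"
    proof -
      have "(\<Sum>k<i. if k < k0 then 2 * C * d * c else 16 / (real k)\<^sup>2)
         \<le> (\<Sum>k<max k0 i. if k < k0 then 2 * C * d * c else 16 / (real k)\<^sup>2)"
        by (rule sum_mono2) (use Cdc in auto)
      also have "{..<max k0 i} = {..<k0} \<union> {k0..<i}" by auto
      also have "(\<Sum>k\<in>{..<k0} \<union> {k0..<i}. if k < k0 then 2 * C * d * c else 16 / (real k)\<^sup>2)
         = (\<Sum>k<k0. 2 * C * d * c) + (\<Sum>k\<in>{k0..<i}. 16 / (real k)\<^sup>2)"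
        by (subst sum.union_disjoint) auto
      finally show ?thesis .
    qed
    also have "\<dots> \<le> ?V" using sum_inverse_squares_tail[OF k0(1), of i] by simp
    finally show ?thesis unfolding v_def sum_distrib_left[symmetric] by (rule mult_left_mono) simp
  qed
  define E where "E ku = {\<omega> \<in> space M. l * A / 2 \<le> (\<Sum>j<fst ku. l * Re (snd ku * tinc A j (dch f (th \<omega>) (st z \<omega>) j) (th \<omega> j)))}" for ku
  have gm: "(\<lambda>(z, \<theta>). l * Re (u * tinc A j z \<theta>)) \<in> borel_measurable (borel \<Otimes>\<^sub>M borel)" for u j
  proof -
    note tinc_measurable[of A j, unfolded split_beta, measurable]
    show ?thesis unfolding split_beta by measurable
  qed
  have Em: "E ku \<in> events" for ku
  proof -
    note chain_sum_measurable[where g = "\<lambda>j w \<theta>. l * Re (snd ku * tinc A j w \<theta>)" and m = "fst ku" and z = z, OF gm, measurable]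
    show ?thesis unfolding E_def by measurable
  qed
  have Ep: "prob (E ku) \<le> exp (l\<^sup>2 * ?V - l * A / 2)" if ku: "ku \<in> {..m} \<times> ?U" for ku
  proof -
    have nu: "norm (snd ku) = 1" and km: "fst ku \<le> n" using ku m by auto
    have "prob (E ku) \<le> exp ((\<Sum>k<fst ku. v k) - l * A / 2)"
      unfolding E_def
      by (rule chain_tail[of "\<lambda>j w \<theta>. l * Re (snd ku * tinc A j w \<theta>)", OF gm _ z km])
         (unfold v_def, rule tinc_mgf[OF _ nu l k0], assumption)
    also have "\<dots> \<le> exp (l\<^sup>2 * ?V - l * A / 2)" using sumv[of "fst ku"] by simp
    finally show ?thesis .
  qed
  have sub: "{\<omega> \<in> space M. \<not> (\<forall>k\<le>m. norm (Hs f (th \<omega>) (st z \<omega>) k - of_real (c * real k)) \<le> A)}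
      \<subseteq> (\<Union>ku\<in>{..m} \<times> ?U. E ku)"
  proof (rule subsetI, rule ccontr)
    fix \<omega> assume bad: "\<omega> \<in> {\<omega> \<in> space M. \<not> (\<forall>k\<le>m. norm (Hs f (th \<omega>) (st z \<omega>) k - of_real (c * real k)) \<le> A)}"
      and good: "\<omega> \<notin> (\<Union>ku\<in>{..m} \<times> ?U. E ku)"
    have w: "\<omega> \<in> space M" using bad by auto
    have S: "(\<Sum>j<k. l * Re (u * tinc A j (dch f (th \<omega>) (st z \<omega>) j) (th \<omega> j))) = l * Re (u * Y k \<omega>)" for k u
      by (simp only: Y_def sum_distrib_left Re_sum)
    have lt: "Re (u * Y k \<omega>) < A / 2" if "k \<le> m" "u \<in> ?U" for k u
    proof -
      have "\<omega> \<notin> E (k, u)" using good that by blast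
      then have "\<not> l * A / 2 \<le> (\<Sum>j<k. l * Re (u * tinc A j (dch f (th \<omega>) (st z \<omega>) j) (th \<omega> j)))"
        using w unfolding E_def by simp
      then have "l * Re (u * Y k \<omega>) < l * (A / 2)" by (simp only: S not_le times_divide_eq_right)
      then show ?thesis using l by (simp only: mult_less_cancel_left_pos)
    qed
    have Yb: "norm (Y k \<omega>) \<le> A" if "k \<le> m" for k
      using lt[OF that, of 1] lt[OF that, of "-1"] lt[OF that, of \<i>] lt[OF that, of "-\<i>"] cmod_le[of "Y k \<omega>"] by simp
    have "norm (Hs f (th \<omega>) (st z \<omega>) k - of_real (c * real k)) \<le> A" if k: "k \<le> m" for k
      using Hs_eq_tinc[OF z, of m A \<omega> k] Yb k unfolding Y_def by simp
    then show False using bad by blast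
  qed
  have "prob {\<omega> \<in> space M. \<not> (\<forall>k\<le>m. norm (Hs f (th \<omega>) (st z \<omega>) k - of_real (c * real k)) \<le> A)}
     \<le> prob (\<Union>ku\<in>{..m} \<times> ?U. E ku)"
    by (rule finite_measure_mono[OF sub]) (use Em in auto)
  also have "\<dots> \<le> (\<Sum>ku\<in>{..m} \<times> ?U. prob (E ku))"
    by (rule finite_measure_subadditive_finite) (use Em in auto)
  also have "\<dots> \<le> (\<Sum>ku\<in>{..m} \<times> ?U. exp (l\<^sup>2 * ?V - l * A / 2))" by (rule sum_mono[OF Ep])
  also have "\<dots> = real (card ({..m} \<times> ?U)) * exp (l\<^sup>2 * ?V - l * A / 2)" by simp
  also have "\<dots> \<le> (4 * (real m + 1)) * exp (l\<^sup>2 * ?V - l * A / 2)"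
  proof (rule mult_right_mono)
    have "card ?U \<le> 4" by (rule order_trans[OF card_insert_le_m1]) (auto intro!: card_insert_le_m1)
    then have "card ({..m} \<times> ?U) \<le> Suc m * 4" unfolding card_cartesian_product by (intro mult_mono) auto
    then have "real (card ({..m} \<times> ?U)) \<le> real (Suc m * 4)" by (rule of_nat_mono)
    then show "real (card ({..m} \<times> ?U)) \<le> 4 * (real m + 1)" by simp
  qed auto
  finally show ?thesis .
qed

end

section \<open>Uniform control over a particle\<close>

text \<open>One representative per cell of a square grid. Representatives are taken from
  \<open>A\<close> itself, so that estimates valid only on \<open>A\<close> apply at them.\<close>

lemma finite_net:
  fixes A :: "complex set"
  assumes A: "A \<subseteq> ball 0 1" and N: "1 \<le> N"
  shows "\<exists>G. finite G \<and> G \<subseteq> A \<and> card G \<le> (2 * N + 1)\<^sup>2 \<and> (\<forall>x\<in>A. \<exists>y\<in>G. norm (x - y) \<le> 2 / real N)"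
proof -
  define cell where "cell z = (\<lfloor>real N * Re z\<rfloor>, \<lfloor>real N * Im z\<rfloor>)" for z :: complex
  have rng: "\<lfloor>real N * t\<rfloor> \<in> {- int N..int N}" if "\<bar>t\<bar> \<le> 1" for t :: real
  proof -
    have "\<bar>real N * t\<bar> \<le> real N * 1" unfolding abs_mult by (rule mult_mono) (use that in auto)
    then have "- real N \<le> real N * t" "real N * t \<le> real N" by auto
    then show ?thesis by (auto simp: le_floor_iff floor_le_iff)
  qed
  have cells: "cell ` A \<subseteq> {- int N..int N} \<times> {- int N..int N}"
  proof (rule image_subsetI)
    fix z assume "z \<in> A"
    then have "norm z < 1" using A by auto
    then show "cell z \<in> {- int N..int N} \<times> {- int N..int N}"
      using rng[of "Re z"] rng[of "Im z"] abs_Re_le_cmod[of z] abs_Im_le_cmod[of z] by (simp add: cell_def)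
  qed
  then have fin: "finite (cell ` A)" by (rule finite_subset) auto
  define pick where "pick p = (SOME z. z \<in> A \<and> cell z = p)" for p
  have pick: "pick (cell z) \<in> A" "cell (pick (cell z)) = cell z" if "z \<in> A" for z
    using someI[of "\<lambda>x. x \<in> A \<and> cell x = cell z" z] that unfolding pick_def by auto
  define G where "G = pick ` cell ` A"
  have "card G \<le> card (cell ` A)" unfolding G_def by (rule card_image_le[OF fin])
  also have "\<dots> \<le> card ({- int N..int N} \<times> {- int N..int N})" by (rule card_mono[OF _ cells]) auto
  also have "\<dots> = (2 * N + 1)\<^sup>2"
  proof -
    have "card {- int N..int N} = 2 * N + 1" unfolding card_atLeastAtMost_int by linarith
    then show ?thesis by (simp only: card_cartesian_product power2_eq_square)
  qed
  finally have card: "card G \<le> (2 * N + 1)\<^sup>2" .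
  have close: "\<bar>x - y\<bar> \<le> 1 / real N" if "\<lfloor>real N * x\<rfloor> = \<lfloor>real N * y\<rfloor>" for x y :: real
  proof -
    have "\<bar>real N * x - real N * y\<bar> < 1" using that by linarith
    then have "real N * \<bar>x - y\<bar> \<le> 1" by (simp add: right_diff_distrib[symmetric] abs_mult)
    then show ?thesis using N by (simp add: field_simps)
  qed
  have "norm (x - pick (cell x)) \<le> 2 / real N" if "x \<in> A" for x
  proof -
    have "cell (pick (cell x)) = cell x" by (rule pick(2)[OF that])
    then have "\<bar>Re x - Re (pick (cell x))\<bar> \<le> 1 / real N" "\<bar>Im x - Im (pick (cell x))\<bar> \<le> 1 / real N"
      using close by (auto simp: cell_def)
    then show ?thesis using cmod_le[of "x - pick (cell x)"] by simp
  qed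
  then show ?thesis using fin card pick by (intro exI[of _ G]) (auto simp: G_def)
qed

text \<open>In the coordinate \<open>1 / z\<close> both particles lie in this horocyclic region at \<open>1\<close>.\<close>

definition horo :: "real \<Rightarrow> complex set" where
  "horo d = {\<zeta>. norm \<zeta> < 1 \<and> (norm (1 - \<zeta>))\<^sup>2 \<le> d * (1 - norm \<zeta>)}"

context hl_prob
begin

text \<open>Points of \<open>horo d\<close> at distance at least \<open>\<kappa>\<close> from 1 have
  norm at most \<open>1 - \<kappa>^2\<close>, where \<open>Hs_lipschitz\<close> costs a factor
  \<open>\<kappa>^-4\<close>, paid for by the mesh of the net. The others lie within
  \<open>2 * \<kappa>\<close> of the reference point \<open>1 - \<kappa>\<close>, and only at this
  one point must two events be excluded: large growth up to step \<open>K\<close>, and no lift by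
  then.\<close>

lemma oscillation:
  assumes kappa: "0 < \<kappa>" "\<kappa> < 1" and N: "1 \<le> N" and K: "1 \<le> K" and p: "0 < p" "p < 1" and W: "1 \<le> W"
    and G: "G \<subseteq> cball 0 (1 - \<kappa>\<^sup>2)" "\<And>x. x \<in> cball 0 (1 - \<kappa>\<^sup>2) \<Longrightarrow> \<exists>y\<in>G. norm (x - y) \<le> 2 / real N"
    and c1: "c \<le> 1"
    and eta: "16 * c * real n / (\<kappa> ^ 4 * real N) \<le> \<eta>" "2 * \<kappa> * W * (1 + 512 * real n / c) \<le> \<eta>"
    and small: "2 * \<kappa> * W\<^sup>2 \<le> C * d" "2 * \<kappa> * W \<le> c / 16"
  shows "\<exists>E\<in>events. prob E \<le> exp (real K * ((2 * C * d) powr p * (2 / cos (p * pi / 2))) - p * ln W)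
       + exp (- (c * real K) / (32 * C * d)) \<and>
     (\<forall>\<omega>\<in>space M - E. \<forall>\<zeta>\<in>horo d. \<exists>g\<in>insert (of_real (1 - \<kappa>)) G.
        norm (Hs f (th \<omega>) (st \<zeta> \<omega>) n - Hs f (th \<omega>) (st g \<omega>) n) \<le> \<eta>)"
proof -
  define r :: complex where "r = of_real (1 - \<kappa>)"
  have r1: "norm r < 1" unfolding r_def norm_of_real using kappa by simp
  \<comment> \<open>If the chain stops before step \<open>K\<close> no lift is required: the growth
    up to \<open>n\<close> already controls \<open>Hs\<close>.\<close>
  define K' where "K' = min K n"
  define E1 where "E1 = {\<omega> \<in> space M. W \<le> growth (th \<omega>) (st r \<omega>) K'}"
  define E2 where "E2 = (if K \<le> n then {\<omega> \<in> space M. Re (Hs f (th \<omega>) (st r \<omega>) K) \<le> 5/8 * c * real K} else {})"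
  note growth_measurable[of r K', measurable] Hs_measurable[of r K, measurable]
  have Em: "E1 \<in> events" "E2 \<in> events" unfolding E1_def E2_def by (measurable, cases "K \<le> n") auto
  have pk: "0 \<le> (2 * C * d) powr p * (2 / cos (p * pi / 2))"
  proof -
    have "0 < p * pi" "p * pi < 1 * pi" using p by auto
    then have "0 < cos (p * pi / 2)" by (intro cos_gt_zero_pi) linarith+
    then show ?thesis by simp
  qed
  have P1: "prob E1 \<le> exp (real K * ((2 * C * d) powr p * (2 / cos (p * pi / 2))) - p * ln W)"
  proof -
    have "prob E1 \<le> exp (real K' * ((2 * C * d) powr p * (2 / cos (p * pi / 2))) - p * ln W)"
      unfolding E1_def by (rule growth_tail[OF r1 _ p]) (use W in \<open>auto simp: K'_def\<close>)
    also have "\<dots> \<le> exp (real K * ((2 * C * d) powr p * (2 / cos (p * pi / 2))) - p * ln W)"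
      using mult_right_mono[OF _ pk, of "real K'" "real K"] by (simp add: K'_def)
    finally show ?thesis .
  qed
  have P2: "prob E2 \<le> exp (- (c * real K) / (32 * C * d))"
    unfolding E2_def using lower_tail[OF r1, of K] by auto
  have "prob (E1 \<union> E2) \<le> prob E1 + prob E2" by (rule measure_Un_le[OF Em])
  then have P: "prob (E1 \<union> E2) \<le> exp (real K * ((2 * C * d) powr p * (2 / cos (p * pi / 2))) - p * ln W)
       + exp (- (c * real K) / (32 * C * d))" using P1 P2 by simp
  have main: "\<exists>g\<in>insert r G. norm (Hs f (th \<omega>) (st \<zeta> \<omega>) n - Hs f (th \<omega>) (st g \<omega>) n) \<le> \<eta>"
    if w: "\<omega> \<in> space M - (E1 \<union> E2)" and h: "\<zeta> \<in> horo d" for \<omega> \<zeta>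
  proof (cases "\<kappa> \<le> norm (1 - \<zeta>)")
    case True
    have "\<kappa>\<^sup>2 \<le> (norm (1 - \<zeta>))\<^sup>2" using True kappa by (intro power_mono) auto
    also have "\<dots> \<le> d * (1 - norm \<zeta>)" using h by (simp add: horo_def)
    also have "\<dots> \<le> 1 * (1 - norm \<zeta>)" by (rule mult_right_mono[OF d_le]) (use h in \<open>auto simp: horo_def\<close>)
    finally have z: "norm \<zeta> \<le> 1 - \<kappa>\<^sup>2" by simp
    then obtain g where g: "g \<in> G" "norm (\<zeta> - g) \<le> 2 / real N" using G(2)[of \<zeta>] by auto
    have gz: "norm g \<le> 1 - \<kappa>\<^sup>2" using G(1) g by auto
    have "norm (Hs f (th \<omega>) (st \<zeta> \<omega>) n - Hs f (th \<omega>) (st g \<omega>) n)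
        \<le> 8 * (c * real n) / (1 - (1 - \<kappa>\<^sup>2))\<^sup>2 * norm (st \<zeta> \<omega> - st g \<omega>)"
      by (rule Hs_lipschitz) (use z gz kappa in \<open>auto simp: norm_mult\<close>)
    also have "norm (st \<zeta> \<omega> - st g \<omega>) = norm (\<zeta> - g)"
      unfolding right_diff_distrib[symmetric] norm_mult by simp
    also have "8 * (c * real n) / (1 - (1 - \<kappa>\<^sup>2))\<^sup>2 * norm (\<zeta> - g) \<le> 8 * (c * real n) / (1 - (1 - \<kappa>\<^sup>2))\<^sup>2 * (2 / real N)"
      by (rule mult_left_mono[OF g(2)]) (use c_pos in auto)
    also have "\<dots> = 16 * c * real n / (\<kappa> ^ 4 * real N)" by (simp add: power_mult[symmetric] mult_ac)
    also have "\<dots> \<le> \<eta>" by (rule eta(1))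
    finally show ?thesis using g by blast
  next
    case False
    have rz: "norm (r - \<zeta>) \<le> 2 * \<kappa>"
    proof -
      have "r - \<zeta> = (1 - \<zeta>) - of_real \<kappa>" by (simp add: r_def)
      then show ?thesis unfolding \<open>r - \<zeta> = _\<close> using norm_triangle_ineq4[of "1 - \<zeta>" "of_real \<kappa>"] False kappa by simp
    qed
    have e: "norm (st r \<omega> - st \<zeta> \<omega>) \<le> 2 * \<kappa>"
      unfolding right_diff_distrib[symmetric] norm_mult using rz by simp
    have lt: "norm (st r \<omega>) < 1" "norm (st \<zeta> \<omega>) < 1" using r1 h by (auto simp: norm_mult horo_def)
    let ?g = "growth (th \<omega>) (st r \<omega>) K'"
    have gW: "?g \<le> W" "1 \<le> ?g" using w growth_ge_1[OF lt(1)] by (auto simp: E1_def)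
    have "norm (st r \<omega> - st \<zeta> \<omega>) * ?g\<^sup>2 \<le> 2 * \<kappa> * W\<^sup>2"
      by (intro mult_mono e power_mono gW) (use gW kappa in auto)
    then have s1: "norm (st r \<omega> - st \<zeta> \<omega>) * ?g\<^sup>2 \<le> C * d" using small by simp
    have eg: "norm (st r \<omega> - st \<zeta> \<omega>) * ?g \<le> 2 * \<kappa> * W"
      by (intro mult_mono e gW) (use gW kappa in auto)
    have "norm (Hs f (th \<omega>) (st r \<omega>) n - Hs f (th \<omega>) (st \<zeta> \<omega>) n) \<le> \<eta>"
    proof (cases "K \<le> n")
      case True
      then have KK: "K' = K" by (simp add: K'_def)
      have "5/8 * c * real K \<le> Re (Hs f (th \<omega>) (st r \<omega>) K)" using w True by (auto simp: E2_def)
      moreover have "5/8 * c * 1 \<le> 5/8 * c * real K" using K c_pos by (intro mult_left_mono) auto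
      ultimately have lift: "c / 2 \<le> Re (Hs f (th \<omega>) (st r \<omega>) K)" using c_pos by linarith
      have "norm (Hs f (th \<omega>) (st r \<omega>) n - Hs f (th \<omega>) (st \<zeta> \<omega>) n)
          \<le> norm (st r \<omega> - st \<zeta> \<omega>) * growth (th \<omega>) (st r \<omega>) K * (1 + 512 * real n / c)"
        by (rule pocket_lifted[OF lt _ _ c1 True lift]) (use s1 eg small KK in auto)
      also have "\<dots> \<le> 2 * \<kappa> * W * (1 + 512 * real n / c)"
        using eg KK c_pos by (intro mult_right_mono) auto
      finally show ?thesis using eta(2) by simp
    next
      case False
      then have KK: "K' = n" by (simp add: K'_def)
      have "norm (Hs f (th \<omega>) (st r \<omega>) n - Hs f (th \<omega>) (st \<zeta> \<omega>) n)
          \<le> norm (st r \<omega> - st \<zeta> \<omega>) * growth (th \<omega>) (st r \<omega>) n"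
        by (rule pocket(2)[OF lt]) (use s1 KK in auto)
      also have "\<dots> \<le> 2 * \<kappa> * W * 1" using eg KK by simp
      also have "\<dots> \<le> 2 * \<kappa> * W * (1 + 512 * real n / c)"
        using kappa W c_pos by (intro mult_left_mono) auto
      finally show ?thesis using eta(2) by simp
    qed
    then show ?thesis by (metis insertI1 norm_minus_commute)
  qed
  show ?thesis using main P Em unfolding r_def by (intro bexI[of _ "E1 \<union> E2"]) auto
qed

text \<open>\<open>Q\<close> is left abstract because the scheme serves a two-sided and a one-sided
  estimate. The \<open>+ 1\<close> next to the size of the net is the reference point of the
  pocket.\<close>

lemma uniform_on_particle:
  assumes kappa: "0 < \<kappa>" "\<kappa> < 1" and N: "1 \<le> N" and K: "1 \<le> K" and p: "0 < p" "p < 1" and W: "1 \<le> W"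
    and c1: "c \<le> 1"
    and eta: "16 * c * real n / (\<kappa> ^ 4 * real N) \<le> \<eta>" "2 * \<kappa> * W * (1 + 512 * real n / c) \<le> \<eta>"
    and small: "2 * \<kappa> * W\<^sup>2 \<le> C * d" "2 * \<kappa> * W \<le> c / 16"
    and B: "\<And>z. norm z < 1 \<Longrightarrow> B z \<in> events" "\<And>z. norm z < 1 \<Longrightarrow> prob (B z) \<le> q"
    and Q: "\<And>z \<omega>. norm z < 1 \<Longrightarrow> \<omega> \<in> space M - B z \<Longrightarrow> Q (Hs f (th \<omega>) (st z \<omega>) n)"
  shows "\<exists>E\<in>events. prob E \<le> ((2 * real N + 1)\<^sup>2 + 1) * q
       + exp (real K * ((2 * C * d) powr p * (2 / cos (p * pi / 2))) - p * ln W)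
       + exp (- (c * real K) / (32 * C * d)) \<and>
     (\<forall>\<omega>\<in>space M - E. \<forall>\<zeta>\<in>horo d. \<exists>h. Q h \<and> norm (Hs f (th \<omega>) (st \<zeta> \<omega>) n - h) \<le> \<eta>)"
proof -
  have k2: "0 < \<kappa>\<^sup>2" using kappa by simp
  have "norm x < 1" if "norm x \<le> 1 - \<kappa>\<^sup>2" for x :: complex using that k2 by linarith
  then have sub: "cball 0 (1 - \<kappa>\<^sup>2) \<subseteq> ball (0::complex) 1" by auto
  obtain G :: "complex set" where G: "finite G" "G \<subseteq> cball 0 (1 - \<kappa>\<^sup>2)" "card G \<le> (2 * N + 1)\<^sup>2"
     "\<And>x. x \<in> cball 0 (1 - \<kappa>\<^sup>2) \<Longrightarrow> \<exists>y\<in>G. norm (x - y) \<le> 2 / real N"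
    using finite_net[OF sub N] by blast
  define r :: complex where "r = of_real (1 - \<kappa>)"
  obtain E where E: "E \<in> events" "prob E \<le> exp (real K * ((2 * C * d) powr p * (2 / cos (p * pi / 2))) - p * ln W)
       + exp (- (c * real K) / (32 * C * d))"
     "\<And>\<omega> \<zeta>. \<omega> \<in> space M - E \<Longrightarrow> \<zeta> \<in> horo d \<Longrightarrow> \<exists>g\<in>insert r G.
        norm (Hs f (th \<omega>) (st \<zeta> \<omega>) n - Hs f (th \<omega>) (st g \<omega>) n) \<le> \<eta>"
    using oscillation[OF kappa N K p W G(2,4) c1 eta small] unfolding r_def by blast
  let ?G = "insert r G"
  have "norm r < 1" unfolding r_def norm_of_real using kappa by simp
  then have lt: "norm g < 1" if "g \<in> ?G" for g using that sub G(2) by auto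
  have fin: "finite ?G" using G by simp
  have q0: "0 \<le> q" using order_trans[OF measure_nonneg B(2)[of 0]] by simp
  define E' where "E' = (\<Union>g\<in>?G. B g)"
  have E'm: "E' \<in> events" unfolding E'_def using fin B(1) lt by (intro sets.finite_UN) auto
  have "prob E' \<le> (\<Sum>g\<in>?G. prob (B g))"
    unfolding E'_def by (rule finite_measure_subadditive_finite[OF fin]) (use B(1) lt in auto)
  also have "\<dots> \<le> (\<Sum>g\<in>?G. q)" by (intro sum_mono B(2) lt)
  also have "\<dots> = real (card ?G) * q" by simp
  also have "\<dots> \<le> ((2 * real N + 1)\<^sup>2 + 1) * q"
  proof (rule mult_right_mono[OF _ q0])
    have "card ?G \<le> Suc (card G)" using G(1) by (simp add: card_insert_if)
    also have "\<dots> \<le> (2 * N + 1)\<^sup>2 + 1" using G(3) by simp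
    finally have "real (card ?G) \<le> real ((2 * N + 1)\<^sup>2 + 1)" by (rule of_nat_mono)
    then show "real (card ?G) \<le> (2 * real N + 1)\<^sup>2 + 1" by (simp add: add.commute)
  qed
  finally have p': "prob E' \<le> ((2 * real N + 1)\<^sup>2 + 1) * q" .
  have "prob (E' \<union> E) \<le> prob E' + prob E" by (rule measure_Un_le[OF E'm E(1)])
  moreover have "\<exists>h. Q h \<and> norm (Hs f (th \<omega>) (st \<zeta> \<omega>) n - h) \<le> \<eta>"
    if w: "\<omega> \<in> space M - (E' \<union> E)" and h: "\<zeta> \<in> horo d" for \<omega> \<zeta>
  proof -
    obtain g where g: "g \<in> ?G" "norm (Hs f (th \<omega>) (st \<zeta> \<omega>) n - Hs f (th \<omega>) (st g \<omega>) n) \<le> \<eta>"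
      using E(3)[of \<omega> \<zeta>] w h by blast
    have "\<omega> \<in> space M - B g" using w g(1) by (auto simp: E'_def)
    from Q[OF lt[OF g(1)] this] show ?thesis using g(2) by blast
  qed
  ultimately show ?thesis using E(1,2) E'm p' by (intro bexI[of _ "E' \<union> E"]) auto
qed

lemma particle_concentration:
  assumes kappa: "0 < \<kappa>" "\<kappa> < 1" and N: "1 \<le> N" and K: "1 \<le> K" and p: "0 < p" "p < 1" and W: "1 \<le> W"
    and c1: "c \<le> 1"
    and eta: "16 * c * real n / (\<kappa> ^ 4 * real N) \<le> \<eta>" "2 * \<kappa> * W * (1 + 512 * real n / c) \<le> \<eta>"
    and small: "2 * \<kappa> * W\<^sup>2 \<le> C * d" "2 * \<kappa> * W \<le> c / 16"
    and l: "0 < l" "2 * C * d * l \<le> 1" and k0: "1 \<le> k0" "2 * A \<le> c * real k0"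
  shows "\<exists>E\<in>events. prob E \<le> ((2 * real N + 1)\<^sup>2 + 1)
          * (4 * (real n + 1) * exp (l\<^sup>2 * (real k0 * (2 * C * d * c) + 32 / real k0) - l * A / 2))
       + exp (real K * ((2 * C * d) powr p * (2 / cos (p * pi / 2))) - p * ln W)
       + exp (- (c * real K) / (32 * C * d)) \<and>
     (\<forall>\<omega>\<in>space M - E. \<forall>\<zeta>\<in>horo d. norm (Hs f (th \<omega>) (st \<zeta> \<omega>) n - of_real (c * real n)) \<le> A + \<eta>)"
proof -
  let ?B = "\<lambda>z. {\<omega> \<in> space M. \<not> (\<forall>k\<le>n. norm (Hs f (th \<omega>) (st z \<omega>) k - of_real (c * real k)) \<le> A)}"
  have "?B z \<in> events" for z
  proof -
    note Hs_measurable[of z, measurable]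
    show ?thesis by measurable
  qed
  note U = uniform_on_particle[where B = ?B and Q = "\<lambda>h. norm (h - of_real (c * real n)) \<le> A",
      OF kappa N K p W c1 eta small this concentration[OF _ order_refl l k0]]
  obtain E where E: "E \<in> events" "prob E \<le> ((2 * real N + 1)\<^sup>2 + 1)
          * (4 * (real n + 1) * exp (l\<^sup>2 * (real k0 * (2 * C * d * c) + 32 / real k0) - l * A / 2))
       + exp (real K * ((2 * C * d) powr p * (2 / cos (p * pi / 2))) - p * ln W)
       + exp (- (c * real K) / (32 * C * d))"
     "\<And>\<omega> \<zeta>. \<omega> \<in> space M - E \<Longrightarrow> \<zeta> \<in> horo d \<Longrightarrow>
        \<exists>h. norm (h - of_real (c * real n)) \<le> A \<and> norm (Hs f (th \<omega>) (st \<zeta> \<omega>) n - h) \<le> \<eta>"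
    using U by blast
  have "norm (Hs f (th \<omega>) (st \<zeta> \<omega>) n - of_real (c * real n)) \<le> A + \<eta>"
    if w: "\<omega> \<in> space M - E" "\<zeta> \<in> horo d" for \<omega> \<zeta>
  proof -
    obtain h where h: "norm (h - of_real (c * real n)) \<le> A" "norm (Hs f (th \<omega>) (st \<zeta> \<omega>) n - h) \<le> \<eta>"
      using E(3)[OF w] by blast
    then show ?thesis
      using norm_triangle_ineq[of "Hs f (th \<omega>) (st \<zeta> \<omega>) n - h" "h - of_real (c * real n)"] by simp
  qed
  then show ?thesis using E(1,2) by blast
qed

text \<open>The one-point error decays exponentially in \<open>n\<close>, whereas that of
  \<open>particle_concentration\<close>, with a fixed window \<open>A\<close>, does not decay in
  \<open>n\<close> at all. For the clause about late particles the one-sided bound is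
  enough.\<close>

lemma particle_lower:
  assumes kappa: "0 < \<kappa>" "\<kappa> < 1" and N: "1 \<le> N" and K: "1 \<le> K" and p: "0 < p" "p < 1" and W: "1 \<le> W"
    and c1: "c \<le> 1"
    and eta: "16 * c * real n / (\<kappa> ^ 4 * real N) \<le> \<eta>" "2 * \<kappa> * W * (1 + 512 * real n / c) \<le> \<eta>"
    and small: "2 * \<kappa> * W\<^sup>2 \<le> C * d" "2 * \<kappa> * W \<le> c / 16"
  shows "\<exists>E\<in>events. prob E \<le> ((2 * real N + 1)\<^sup>2 + 1) * exp (- (c * real n) / (32 * C * d))
       + exp (real K * ((2 * C * d) powr p * (2 / cos (p * pi / 2))) - p * ln W)
       + exp (- (c * real K) / (32 * C * d)) \<and>
     (\<forall>\<omega>\<in>space M - E. \<forall>\<zeta>\<in>horo d. 5/8 * c * real n - \<eta> \<le> Re (Hs f (th \<omega>) (st \<zeta> \<omega>) n))"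
proof -
  let ?B = "\<lambda>z. {\<omega> \<in> space M. Re (Hs f (th \<omega>) (st z \<omega>) n) \<le> 5/8 * c * real n}"
  have "?B z \<in> events" for z
  proof -
    note Hs_measurable[of z n, measurable]
    show ?thesis by measurable
  qed
  moreover have "5/8 * c * real n \<le> Re (Hs f (th \<omega>) (st z \<omega>) n)" if "\<omega> \<in> space M - ?B z" for z \<omega>
    using that by auto
  ultimately have U: "\<exists>E\<in>events. prob E \<le> ((2 * real N + 1)\<^sup>2 + 1) * exp (- (c * real n) / (32 * C * d))
       + exp (real K * ((2 * C * d) powr p * (2 / cos (p * pi / 2))) - p * ln W)
       + exp (- (c * real K) / (32 * C * d)) \<and>
     (\<forall>\<omega>\<in>space M - E. \<forall>\<zeta>\<in>horo d. \<exists>h. 5/8 * c * real n \<le> Re h \<and> norm (Hs f (th \<omega>) (st \<zeta> \<omega>) n - h) \<le> \<eta>)"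
    by (intro uniform_on_particle[where B = ?B, OF kappa N K p W c1 eta small] lower_tail order_refl)
  obtain E where E: "E \<in> events" "prob E \<le> ((2 * real N + 1)\<^sup>2 + 1) * exp (- (c * real n) / (32 * C * d))
       + exp (real K * ((2 * C * d) powr p * (2 / cos (p * pi / 2))) - p * ln W)
       + exp (- (c * real K) / (32 * C * d))"
     "\<And>\<omega> \<zeta>. \<omega> \<in> space M - E \<Longrightarrow> \<zeta> \<in> horo d \<Longrightarrow>
        \<exists>h. 5/8 * c * real n \<le> Re h \<and> norm (Hs f (th \<omega>) (st \<zeta> \<omega>) n - h) \<le> \<eta>"
    using U by blast
  have "5/8 * c * real n - \<eta> \<le> Re (Hs f (th \<omega>) (st \<zeta> \<omega>) n)"
    if w: "\<omega> \<in> space M - E" "\<zeta> \<in> horo d" for \<omega> \<zeta>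
  proof -
    obtain h where h: "5/8 * c * real n \<le> Re h" "norm (Hs f (th \<omega>) (st \<zeta> \<omega>) n - h) \<le> \<eta>"
      using E(3)[OF w] by blast
    then show ?thesis using abs_Re_le_cmod[of "Hs f (th \<omega>) (st \<zeta> \<omega>) n - h"] by simp
  qed
  then show ?thesis using E(1,2) by blast
qed

end

section \<open>Clusters and particles in terms of the chain\<close>

text \<open>Lets both particles share the bounds derived for the disc.\<close>

lemma slit_subset_disc:
  assumes "0 < d"
  shows "slit_particle d \<subseteq> disc_particle d"
proof
  fix z assume "z \<in> slit_particle d"
  then obtain x where x: "1 < x" "x \<le> 1 + d" "z = of_real x" by (auto simp: slit_particle_def)
  have "norm (z - of_real (1 + d / 2)) = \<bar>x - (1 + d / 2)\<bar>" unfolding x(3) of_real_diff[symmetric] norm_of_real ..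
  also have "\<dots> \<le> d / 2" using x by (simp add: abs_le_iff field_simps)
  finally show "z \<in> disc_particle d" using x by (auto simp: disc_particle_def dist_norm norm_minus_commute)
qed

text \<open>Tangency at 1 means \<open>(norm (p - 1))^2 \<le> d * (Re p - 1)\<close>; dividing by
  the square of \<open>norm p\<close> turns this into the horocyclic condition for
  \<open>1 / p\<close>.\<close>

lemma disc_particle_bounds:
  assumes d: "0 < d" "d \<le> 1" and p: "p \<in> disc_particle d"
  shows "p \<in> D0" "norm (p - 1) \<le> d" "norm p \<le> 2" "1 / p \<in> horo d"
proof -
  have n: "norm (p - of_real (1 + d/2)) \<le> d / 2" and p1: "p \<noteq> 1"
    using p by (auto simp: disc_particle_def dist_norm norm_minus_commute)
  have "(norm (p - of_real (1 + d/2)))\<^sup>2 \<le> (d/2)\<^sup>2" using n by (intro power_mono) auto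
  then have e: "(norm (p - 1))\<^sup>2 \<le> d * (Re p - 1)"
    unfolding cmod_power2 by (simp add: power2_eq_square algebra_simps)
  have "0 < (norm (p - 1))\<^sup>2" using p1 by simp
  then have "0 < d * (Re p - 1)" using e by linarith
  then have Re1: "1 < Re p" using d by (simp add: zero_less_mult_iff)
  have P1: "1 < norm p" using Re1 complex_Re_le_cmod[of p] by linarith
  then show "p \<in> D0" by (simp add: D0_def)
  have "p - 1 = (p - of_real (1 + d/2)) + of_real (d/2)" by simp
  then have "norm (p - 1) \<le> norm (p - of_real (1 + d/2)) + norm (of_real (d/2) :: complex)"
    by (metis norm_triangle_ineq)
  then show pd: "norm (p - 1) \<le> d" using n d by simp
  show "norm p \<le> 2" using norm_triangle_ineq[of 1 "p - 1"] pd d by simp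
  have "p \<noteq> 0" using P1 by auto
  then have "1 - 1 / p = (p - 1) / p" by (simp add: diff_divide_distrib)
  then have "(norm (1 - 1 / p))\<^sup>2 = (norm (p - 1))\<^sup>2 / (norm p)\<^sup>2" by (simp add: norm_divide power_divide)
  also have "\<dots> \<le> d * (norm p - 1) / norm p"
  proof (rule frac_le)
    show "(norm (p - 1))\<^sup>2 \<le> d * (norm p - 1)"
      using e mult_left_mono[of "Re p - 1" "norm p - 1" d] complex_Re_le_cmod[of p] d by linarith
    show "norm p \<le> (norm p)\<^sup>2" using P1 mult_left_mono[of 1 "norm p" "norm p"] by (simp add: power2_eq_square)
  qed (use P1 d in auto)
  also have "\<dots> = d * (1 - norm (1 / p))"
  proof -
    have "x \<noteq> 0 \<Longrightarrow> d * (x - 1) / x = d * (1 - 1 / x)" for x :: real by (simp add: field_simps)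
    then show ?thesis using \<open>p \<noteq> 0\<close> by (simp add: norm_divide)
  qed
  finally show "1 / p \<in> horo d" using P1 by (auto simp: horo_def norm_divide divide_less_eq)
qed

lemma hl_map_est_locale:
  assumes "hl_map_est P C d c f" "0 < d" "d \<le> 1" "1 \<le> C"
  obtains a b where "hl_map f c C d a b"
  using assms unfolding hl_map_est_def hl_map_def by blast

locale hl_particle = hl_map f c C d a b
  for f :: "complex \<Rightarrow> complex" and c C d :: real and a b :: complex +
  fixes P :: "complex set"
  assumes HL_map: "is_HL_map P (\<lambda>z. z * exp (f (1 / z))) c"
    and P_sub: "P \<subseteq> disc_particle d" and P_ne: "P \<noteq> {}"
begin

lemma HL_cap_eq: "HL_cap P = c" and HL_F_eq: "z \<in> D0 \<Longrightarrow> HL_F P z = z * exp (f (1 / z))"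
  using HL_pair_eq[OF HL_map] by auto

lemma inv_D0: "z \<in> D0 \<Longrightarrow> norm (1 / z) < 1" "z \<in> D0 \<Longrightarrow> z \<noteq> 0"
  by (auto simp: D0_def norm_divide divide_less_eq)

lemma P_D0: "p \<in> P \<Longrightarrow> p \<in> D0"
  using P_sub disc_particle_bounds(1)[OF d_pos d_le] by blast

lemma cis_D0: "cis t * z \<in> D0 \<longleftrightarrow> z \<in> D0"
  by (simp add: D0_def norm_mult)

lemma HL_Fn_eq:
  assumes "z \<in> D0"
  shows "HL_Fn P \<theta> n z = z * exp (f (cis (\<theta> n) * (1 / z)))"
proof -
  have "1 / (cis (- \<theta> n) * z) = cis (\<theta> n) * (1 / z)"
    by (simp add: divide_inverse inverse_mult_distrib)
  moreover have "cis (\<theta> n) * (cis (- \<theta> n) * z) = z" by (simp add: mult.assoc[symmetric] cis_mult)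
  ultimately show ?thesis
    unfolding HL_Fn_def using assms by (simp add: HL_F_eq cis_D0 mult.assoc[symmetric])
qed

lemma HL_Fn_in_D0: "z \<in> D0 \<Longrightarrow> HL_Fn P \<theta> n z \<in> D0"
proof -
  assume z: "z \<in> D0"
  have "norm (cis (\<theta> n) * (1 / z)) < 1" using inv_D0(1)[OF z] by (simp only: norm_mult norm_cis mult_1)
  then have "1 \<le> exp (Re (f (cis (\<theta> n) * (1 / z))))" using Re_nonneg by simp
  then have "norm z * 1 \<le> norm (HL_Fn P \<theta> n z)"
    unfolding HL_Fn_eq[OF z] norm_mult norm_exp_eq_Re by (intro mult_left_mono) auto
  then show ?thesis using z by (simp add: D0_def)
qed

text \<open>The innermost map carries the newest angle, so the chain reads the angles backwards from
  \<open>\<theta> n\<close> to \<open>\<theta> 1\<close>; only \<open>j < n\<close> occurs, so the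
  truncated subtraction never yields 0. The induction peels off the first step of the chain, which
  moves the starting point, hence the arbitrary \<open>z\<close>.\<close>

lemma HL_Phi_eq:
  assumes "z \<in> D0"
  shows "HL_Phi P \<theta> n z = z * exp (Hs f (\<lambda>j. \<theta> (n - j)) (1 / z) n)"
  using assms
proof (induction n arbitrary: z)
  case (Suc n)
  define w where "w = HL_Fn P \<theta> (Suc n) z"
  let ?\<phi> = "\<lambda>j. \<theta> (Suc n - j)"
  have w: "w \<in> D0" unfolding w_def by (rule HL_Fn_in_D0[OF Suc.prems])
  have weq: "w = z * exp (f (cis (\<theta> (Suc n)) * (1 / z)))" unfolding w_def by (rule HL_Fn_eq[OF Suc.prems])
  have "1 / w = dch f ?\<phi> (1 / z) 1" unfolding weq by (simp add: exp_minus divide_inverse)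
  moreover have "Hs f ?\<phi> (1 / z) 1 = f (cis (\<theta> (Suc n)) * (1 / z))" by (simp add: Hs_def)
  moreover have "Hs f ?\<phi> (1 / z) (1 + n) = Hs f ?\<phi> (1 / z) 1 + Hs f (\<lambda>j. ?\<phi> (1 + j)) (dch f ?\<phi> (1 / z) 1) n"
    by (rule Hs_add)
  ultimately have "Hs f ?\<phi> (1 / z) (Suc n) = f (cis (\<theta> (Suc n)) * (1 / z)) + Hs f (\<lambda>j. \<theta> (n - j)) (1 / w) n"
    by simp
  moreover have "HL_Phi P \<theta> (Suc n) z = HL_Phi P \<theta> n w" by (simp add: w_def)
  ultimately show ?case using Suc.IH[OF w] by (simp add: weq exp_add mult.assoc)
qed simp

lemma HL_Fn_inj: "inj_on (HL_Fn P \<theta> n) D0"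
proof (rule inj_onI)
  fix x y assume xy: "x \<in> D0" "y \<in> D0" "HL_Fn P \<theta> n x = HL_Fn P \<theta> n y"
  have inj: "inj_on (\<lambda>z. z * exp (f (1 / z))) D0" using HL_map by (simp add: is_HL_map_def)
  have "HL_F P (cis (- \<theta> n) * x) = HL_F P (cis (- \<theta> n) * y)" using xy(3) by (simp add: HL_Fn_def)
  then have "cis (- \<theta> n) * x = cis (- \<theta> n) * y"
    using inj_onD[OF inj, of "cis (- \<theta> n) * x" "cis (- \<theta> n) * y"] xy by (simp add: HL_F_eq cis_D0)
  then show "x = y" by simp
qed

lemma HL_Phi_inj: "inj_on (HL_Phi P \<theta> n) D0"
proof (induction n)
  case (Suc n)
  have "HL_Fn P \<theta> (Suc n) ` D0 \<subseteq> D0" using HL_Fn_in_D0 by auto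
  then have "inj_on (HL_Phi P \<theta> n) (HL_Fn P \<theta> (Suc n) ` D0)" by (rule inj_on_subset[OF Suc])
  with HL_Fn_inj show ?case unfolding HL_Phi.simps by (rule comp_inj_on)
qed simp

lemma HL_Fn_image: "HL_Fn P \<theta> n ` D0 = D0 - (\<lambda>z. cis (\<theta> n) * z) ` P"
proof -
  have im: "(\<lambda>z. z * exp (f (1 / z))) ` D0 = - (K0 \<union> P)" using HL_map by (simp add: is_HL_map_def)
  have FD: "HL_F P ` D0 = D0 - P"
  proof -
    have "HL_F P ` D0 = - (K0 \<union> P)" unfolding im[symmetric] by (rule image_cong) (auto simp: HL_F_eq)
    also have "\<dots> = D0 - P" by (auto simp: K0_def D0_def)
    finally show ?thesis .
  qed
  have rot: "(\<lambda>z. cis t * z) ` D0 = D0" for t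
  proof (intro equalityI subsetI)
    fix z assume "z \<in> D0"
    then have "cis (- t) * z \<in> D0" by (simp add: cis_D0)
    moreover have "z = cis t * (cis (- t) * z)" by (simp add: mult.assoc[symmetric] cis_mult)
    ultimately show "z \<in> (\<lambda>z. cis t * z) ` D0" by (rule rev_image_eqI)
  qed (auto simp: cis_D0)
  have "HL_Fn P \<theta> n ` D0 = (\<lambda>z. cis (\<theta> n) * z) ` HL_F P ` (\<lambda>z. cis (- \<theta> n) * z) ` D0"
    unfolding image_image by (simp add: HL_Fn_def[abs_def])
  also have "\<dots> = (\<lambda>z. cis (\<theta> n) * z) ` (D0 - P)" unfolding rot FD ..
  also have "\<dots> = (\<lambda>z. cis (\<theta> n) * z) ` D0 - (\<lambda>z. cis (\<theta> n) * z) ` P"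
    by (rule image_set_diff) (auto simp: inj_on_def)
  finally show ?thesis unfolding rot .
qed

text \<open>\<open>HL_K\<close> is the complement of an image. Injectivity of \<open>HL_Phi\<close>
  turns removing the rotated particle before mapping into removing its image afterwards.\<close>

lemma HL_K_Suc: "HL_K P \<theta> (Suc n) = HL_K P \<theta> n \<union> HL_P P \<theta> (Suc n)"
proof -
  have sub: "(\<lambda>z. cis (\<theta> (Suc n)) * z) ` P \<subseteq> D0" using P_D0 by (auto simp: cis_D0)
  have "HL_Phi P \<theta> (Suc n) ` D0 = HL_Phi P \<theta> n ` (D0 - (\<lambda>z. cis (\<theta> (Suc n)) * z) ` P)"
    by (simp only: HL_Phi.simps image_comp[symmetric] HL_Fn_image)
  also have "\<dots> = HL_Phi P \<theta> n ` D0 - HL_P P \<theta> (Suc n)"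
    using inj_on_image_set_diff[OF HL_Phi_inj, of D0 "(\<lambda>z. cis (\<theta> (Suc n)) * z) ` P"] sub
    by (simp add: HL_P_def)
  finally show ?thesis unfolding HL_K_def by auto
qed

lemma HL_K_eq: "HL_K P \<theta> n = K0 \<union> (\<Union>j\<in>{1..n}. HL_P P \<theta> j)"
proof (induction n)
  case 0 show ?case by (auto simp: HL_K_def D0_def K0_def)
next
  case (Suc n)
  have "{1..Suc n} = insert (Suc n) {1..n}" by auto
  then show ?case unfolding HL_K_Suc Suc by auto
qed

text \<open>The point of particle number \<open>Suc n\<close> that comes from \<open>p\<close>; with
  this shift its chain has exactly \<open>n\<close> steps.\<close>

definition ppt :: "(nat \<Rightarrow> real) \<Rightarrow> nat \<Rightarrow> complex \<Rightarrow> complex" where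
  "ppt \<theta> n p = cis (\<theta> (Suc n)) * p * exp (Hs f (\<lambda>j. \<theta> (n - j)) (cis (- \<theta> (Suc n)) * (1 / p)) n)"

lemma HL_P_eq: "HL_P P \<theta> (Suc n) = ppt \<theta> n ` P"
proof -
  have "HL_Phi P \<theta> n (cis (\<theta> (Suc n)) * p) = ppt \<theta> n p" if "p \<in> P" for p
  proof -
    have "1 / (cis (\<theta> (Suc n)) * p) = cis (- \<theta> (Suc n)) * (1 / p)"
      by (simp add: divide_inverse inverse_mult_distrib)
    then show ?thesis using HL_Phi_eq[of "cis (\<theta> (Suc n)) * p" \<theta> n] P_D0[OF that]
      by (simp add: cis_D0 ppt_def)
  qed
  then show ?thesis unfolding HL_P_def image_image by (simp cong: image_cong)
qed

lemma ppt_continuous: "continuous_on P (ppt \<theta> n)"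
proof -
  have nz: "p \<noteq> 0" if "p \<in> P" for p using inv_D0(2)[OF P_D0[OF that]] .
  have "continuous_on (ball 0 1) (\<lambda>z. Hs f (\<lambda>j. \<theta> (n - j)) z n)"
    by (rule holomorphic_on_imp_continuous_on[OF Hs_hol])
  then have "continuous_on P (\<lambda>p. Hs f (\<lambda>j. \<theta> (n - j)) (cis (- \<theta> (Suc n)) * (1 / p)) n)"
    by (rule continuous_on_compose2)
       (use nz inv_D0(1)[OF P_D0] in \<open>auto intro!: continuous_intros simp: norm_mult norm_divide\<close>)
  then show ?thesis unfolding ppt_def by (intro continuous_intros)
qed

section \<open>Conditions on the angles that imply the event\<close>

lemma horo_P: "p \<in> P \<Longrightarrow> 1 / p \<in> horo d" "p \<in> P \<Longrightarrow> norm (p - 1) \<le> d" "p \<in> P \<Longrightarrow> norm p \<le> 2"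
  using P_sub disc_particle_bounds[OF d_pos d_le] by blast+

text \<open>Quantified over the region \<open>horo d\<close>, which contains the inverses of the
  points of either particle, rather than over \<open>P\<close>.\<close>

definition good_at :: "(nat \<Rightarrow> real) \<Rightarrow> real \<Rightarrow> nat \<Rightarrow> bool" where
  "good_at \<theta> e n \<longleftrightarrow> (\<forall>\<zeta>\<in>horo d.
     norm (Hs f (\<lambda>j. \<theta> (n - j)) (cis (- \<theta> (Suc n)) * \<zeta>) n - of_real (c * real n)) \<le> e)"

definition high_at :: "(nat \<Rightarrow> real) \<Rightarrow> real \<Rightarrow> nat \<Rightarrow> bool" where
  "high_at \<theta> y n \<longleftrightarrow> (\<forall>\<zeta>\<in>horo d. y \<le> Re (Hs f (\<lambda>j. \<theta> (n - j)) (cis (- \<theta> (Suc n)) * \<zeta>) n))"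

definition fills :: "(nat \<Rightarrow> real) \<Rightarrow> nat \<Rightarrow> nat \<Rightarrow> real \<Rightarrow> bool" where
  "fills \<theta> m L e \<longleftrightarrow> (\<forall>i. i + L \<le> m \<longrightarrow> (\<forall>\<phi>. \<exists>j\<in>{i+1..i+L}. norm (cis \<phi> - cis (\<theta> j)) \<le> e))"

text \<open>Three errors: \<open>norm p \<le> 2\<close> times
  \<open>norm (exp D - 1) \<le> 2 * e\<close>, the size \<open>d\<close> of the particle, and
  \<open>2 * c\<close> for comparing \<open>exp (c * real n)\<close> with
  \<open>exp (c * real (Suc n))\<close>.\<close>

lemma good_at_close:
  assumes g: "good_at \<theta> e n" and e: "0 \<le> e" "e \<le> 1/2" and c1: "c \<le> 1" and p: "p \<in> P"
  shows "norm (ppt \<theta> n p - of_real (exp (c * real (Suc n))) * cis (\<theta> (Suc n)))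
     \<le> (4 * e + d + 2 * c) * exp (c * real (Suc n))"
proof -
  define D where "D = Hs f (\<lambda>j. \<theta> (n - j)) (cis (- \<theta> (Suc n)) * (1 / p)) n - of_real (c * real n)"
  have D: "norm D \<le> e" using g horo_P(1)[OF p] unfolding good_at_def D_def by blast
  have eD: "norm (exp D - 1) \<le> 2 * e"
  proof -
    have "norm (exp D - exp 0) \<le> 2 * norm (D - 0)"
    proof (rule field_differentiable_bound[where S = "cball 0 (1/2)" and f' = exp])
      show "norm (exp z) \<le> 2" if "z \<in> cball 0 (1/2)" for z :: complex
      proof -
        have "exp (Re z) \<le> exp (1/2)" using that complex_Re_le_cmod[of z] by simp
        also have "exp (1/2 :: real) \<le> 2" using exp_le_quadratic[of "1/2"] by (simp add: power2_eq_square)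
        finally show ?thesis by simp
      qed
    qed (use D e in \<open>auto intro!: derivative_eq_intros\<close>)
    then show ?thesis using D by simp
  qed
  have ec: "\<bar>1 - exp c\<bar> \<le> 2 * c"
  proof -
    have "c\<^sup>2 \<le> c * 1" unfolding power2_eq_square using c1 c_pos by (intro mult_left_mono) auto
    then show ?thesis using exp_le_quadratic[of c] c1 c_pos by simp
  qed
  have H: "Hs f (\<lambda>j. \<theta> (n - j)) (cis (- \<theta> (Suc n)) * (1 / p)) n = of_real (c * real n) + D" by (simp add: D_def)
  have "ppt \<theta> n p - of_real (exp (c * real (Suc n))) * cis (\<theta> (Suc n))
      = of_real (exp (c * real n)) * cis (\<theta> (Suc n)) * (p * (exp D - 1) + (p - 1) + of_real (1 - exp c))"
    unfolding ppt_def H by (simp add: exp_add exp_of_real[symmetric] algebra_simps)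
  then have "norm (ppt \<theta> n p - of_real (exp (c * real (Suc n))) * cis (\<theta> (Suc n)))
      = exp (c * real n) * norm (p * (exp D - 1) + (p - 1) + of_real (1 - exp c))"
    by (simp add: norm_mult)
  also have "norm (p * (exp D - 1) + (p - 1) + of_real (1 - exp c))
     \<le> norm p * norm (exp D - 1) + norm (p - 1) + \<bar>1 - exp c\<bar>"
    by (metis (no_types) norm_triangle_le add_mono norm_mult norm_of_real norm_triangle_ineq order_refl)
  also have "\<dots> \<le> 2 * (2 * e) + d + 2 * c"
    by (intro add_mono mult_mono eD ec horo_P(2,3) p) auto
  also have "exp (c * real n) * (2 * (2 * e) + d + 2 * c) \<le> exp (c * real (Suc n)) * (2 * (2 * e) + d + 2 * c)"
    using c_pos e d_pos by (intro mult_right_mono) auto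
  finally show ?thesis by (simp add: mult.commute)
qed

text \<open>The clause on filling is the one with an idea: a point of modulus
  \<open>exp (c * s)\<close> is close to one of the last \<open>L\<close> particles attached up to
  time \<open>s\<close>, because particle \<open>j\<close> sits near
  \<open>exp (c * j) * cis (\<theta> j)\<close> and these angles come within \<open>e'\<close> of
  every direction.\<close>

lemma HL_Omega_of_good:
  assumes g: "\<And>n. n < m \<Longrightarrow> good_at \<theta> e n" and h: "\<And>n. m \<le> n \<Longrightarrow> high_at \<theta> (c * real m - e) n"
    and f: "fills \<theta> m L e'" and e: "0 \<le> e" "e \<le> 1/2" and e': "0 \<le> e'" and c1: "c * (real L + 1) \<le> 1"
    and eps: "4 * e + d + 2 * c + 2 * c * (real L + 1) + e' \<le> \<epsilon>"
  shows "HL_Omega P m \<epsilon> \<theta>"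
proof -
  have c1': "c \<le> 1"
  proof -
    have "c * 1 \<le> c * (real L + 1)" using c_pos by (intro mult_left_mono) auto
    then show ?thesis using c1 by simp
  qed
  have nonneg: "0 \<le> c * (real L + 1)" using c_pos by simp
  have eps1: "4 * e + d + 2 * c \<le> \<epsilon>" "e \<le> \<epsilon>" "2 * c * (real L + 1) \<le> \<epsilon>" "0 \<le> \<epsilon>"
    using eps e e' d_pos c_pos nonneg by linarith+
  have A: "norm (z - of_real (exp (c * real n)) * cis (\<theta> n)) \<le> (4 * e + d + 2 * c) * exp (c * real n)"
    if n: "n \<in> {1..m}" and z: "z \<in> HL_P P \<theta> n" for n z
  proof -
    obtain k where k: "n = Suc k" "k < m" using n by (cases n) auto
    obtain p where p: "p \<in> P" "z = ppt \<theta> k p" using z unfolding k HL_P_eq by auto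
    show ?thesis unfolding k p(2) by (rule good_at_close[OF g[OF k(2)] e c1' p(1)])
  qed
  have B: "(1 - \<epsilon>) * exp (c * real m) \<le> norm z" if n: "m + 1 \<le> n'" and z: "z \<in> HL_P P \<theta> n'" for n' z
  proof -
    obtain k where k: "n' = Suc k" "m \<le> k" using n by (cases n') auto
    obtain p where p: "p \<in> P" "z = ppt \<theta> k p" using z unfolding k HL_P_eq by auto
    let ?H = "Hs f (\<lambda>j. \<theta> (k - j)) (cis (- \<theta> (Suc k)) * (1 / p)) k"
    have "c * real m - e \<le> Re ?H" using h[OF k(2)] horo_P(1)[OF p(1)] unfolding high_at_def by blast
    then have "exp (c * real m - e) \<le> exp (Re ?H)" by simp
    moreover have "1 \<le> norm p" using P_D0[OF p(1)] by (simp add: D0_def)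
    ultimately have "1 * exp (c * real m - e) \<le> norm p * exp (Re ?H)" by (intro mult_mono) auto
    also have "\<dots> = norm z" unfolding p(2) ppt_def by (simp add: norm_mult)
    finally have lo: "exp (c * real m - e) \<le> norm z" by simp
    have "(1 - \<epsilon>) * exp (c * real m) \<le> exp (- e) * exp (c * real m)"
      using exp_ge_add_one_self[of "- e"] eps1 by (intro mult_right_mono) auto
    also have "\<dots> = exp (c * real m - e)" by (simp add: exp_diff exp_minus divide_inverse)
    finally show ?thesis using lo by simp
  qed
  have Cc: "infdist w (HL_K P \<theta> n) \<le> \<epsilon> * exp (c * real n)" if n: "n \<le> m" and w: "norm w \<le> exp (c * real n)" for n w
  proof -
    have en: "1 \<le> exp (c * real n)" using c_pos by simp
    have K0s: "K0 \<subseteq> HL_K P \<theta> n" unfolding HL_K_eq by auto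
    show ?thesis
    proof (cases "norm w \<le> exp (c * (real L + 1))")
      \<comment> \<open>Up to time \<open>L + 1\<close> a full window of angles need not be
        available, but then \<open>w\<close> is within \<open>2 * c * (L + 1)\<close> of
        \<open>K0\<close>.\<close>
      case True
      have "infdist w (HL_K P \<theta> n) \<le> 2 * c * (real L + 1)"
      proof (cases "norm w \<le> 1")
        case True
        then have "infdist w (HL_K P \<theta> n) = 0" using K0s by (intro infdist_zero) (auto simp: K0_def)
        then show ?thesis using nonneg by simp
      next
        case False
        define v where "v = w / of_real (norm w)"
        have w0: "w \<noteq> 0" using False by auto
        then have nv: "norm v = 1" by (simp add: v_def norm_divide)
        have "v \<in> HL_K P \<theta> n" using K0s nv by (auto simp: K0_def)
        then have "infdist w (HL_K P \<theta> n) \<le> dist w v" by (rule infdist_le)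
        also have "dist w v = norm w - 1"
        proof -
          have "w - v = of_real (norm w - 1) * v" using w0 by (simp add: v_def left_diff_distrib diff_divide_distrib)
          then have "norm (w - v) = \<bar>norm w - 1\<bar> * 1" by (simp only: norm_mult norm_of_real nv)
          then show ?thesis using False by (simp add: dist_norm)
        qed
        also have "\<dots> \<le> exp (c * (real L + 1)) - 1" using True by simp
        also have "\<dots> \<le> c * (real L + 1) + (c * (real L + 1))\<^sup>2"
          using exp_le_quadratic[of "c * (real L + 1)"] c1 nonneg by simp
        also have "(c * (real L + 1))\<^sup>2 \<le> c * (real L + 1) * 1"
          unfolding power2_eq_square by (rule mult_left_mono[OF c1 nonneg])
        finally show ?thesis by simp
      qed
      also have "\<dots> \<le> \<epsilon> * 1" using eps1 by simp
      also have "\<dots> \<le> \<epsilon> * exp (c * real n)" using en eps1 by (intro mult_left_mono) auto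
      finally show ?thesis .
    next
      case False
      then have w0: "0 < norm w" by (smt (verit) exp_gt_zero)
      define s where "s = ln (norm w) / c"
      have es: "norm w = exp (c * s)" using w0 c_pos by (simp add: s_def)
      have sn: "s \<le> real n" using w c_pos unfolding es by simp
      have sL: "real L + 1 < s" using False c_pos unfolding es by simp
      \<comment> \<open>The window from \<open>i + 1\<close> to \<open>i + L\<close> ends at the
        integer part of \<open>s\<close>; \<open>L + 1 < s\<close> makes the truncated subtraction
        exact.\<close>
      define i where "i = nat \<lfloor>s\<rfloor> - L"
      have s0: "0 \<le> s" using sL by simp
      have fl: "real (nat \<lfloor>s\<rfloor>) \<le> s" "s < real (nat \<lfloor>s\<rfloor>) + 1"
        using s0 by linarith+
      have iL: "i + L = nat \<lfloor>s\<rfloor>" using sL fl(2) unfolding i_def by linarith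
      have iLn: "i + L \<le> n" unfolding iL using fl(1) sn by linarith
      obtain \<phi> where wphi: "w = of_real (norm w) * cis \<phi>"
        using rcis_cmod_Arg[of w] unfolding rcis_def by metis
      obtain j where j: "j \<in> {i+1..i+L}" "norm (cis \<phi> - cis (\<theta> j)) \<le> e'"
        using f iLn n unfolding fills_def by (meson order_trans)
      have jn: "j \<in> {1..n}" "j \<in> {1..m}" using j(1) iLn n by auto
      have js: "real j \<le> s" using j(1) fl(1) iL by (metis atLeastAtMost_iff of_nat_le_iff order_trans)
      have sj: "s - real j \<le> real L"
      proof -
        have "real i + 1 \<le> real j" using j(1) by simp
        moreover have "real i + real L = real (nat \<lfloor>s\<rfloor>)" using iL by (metis of_nat_add)
        ultimately show ?thesis using fl(2) by linarith
      qed
      obtain k where k: "j = Suc k" using jn by (cases j) auto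
      obtain p where p: "p \<in> P" using P_ne by auto
      define z where "z = ppt \<theta> k p"
      have zP: "z \<in> HL_P P \<theta> j" unfolding k HL_P_eq z_def using p by auto
      then have "z \<in> HL_K P \<theta> n" unfolding HL_K_eq using jn(1) by blast
      then have "infdist w (HL_K P \<theta> n) \<le> dist w z" by (rule infdist_le)
      also have "\<dots> \<le> norm (w - of_real (exp (c * real j)) * cis (\<theta> j)) + norm (z - of_real (exp (c * real j)) * cis (\<theta> j))"
        unfolding dist_norm using norm_triangle_ineq4[of "w - of_real (exp (c * real j)) * cis (\<theta> j)" "z - of_real (exp (c * real j)) * cis (\<theta> j)"] by simp
      also have "norm (z - of_real (exp (c * real j)) * cis (\<theta> j)) \<le> (4 * e + d + 2 * c) * exp (c * real j)"
        by (rule A[OF jn(2) zP])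
      also have "\<dots> \<le> (4 * e + d + 2 * c) * exp (c * real n)"
        using jn(1) e d_pos c_pos by (intro mult_left_mono) auto
      also have "norm (w - of_real (exp (c * real j)) * cis (\<theta> j)) \<le> (c * real L + e') * exp (c * real n)"
      proof -
        have "w - of_real (exp (c * real j)) * cis (\<theta> j)
          = of_real (exp (c * s) - exp (c * real j)) * cis \<phi> + of_real (exp (c * real j)) * (cis \<phi> - cis (\<theta> j))"
          by (subst wphi, subst es) (simp add: algebra_simps)
        then have "norm (w - of_real (exp (c * real j)) * cis (\<theta> j))
          \<le> \<bar>exp (c * s) - exp (c * real j)\<bar> + exp (c * real j) * norm (cis \<phi> - cis (\<theta> j))"
          using norm_triangle_ineq[of "of_real (exp (c * s) - exp (c * real j)) * cis \<phi>" "of_real (exp (c * real j)) * (cis \<phi> - cis (\<theta> j))"]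
          by (simp add: norm_mult del: of_real_diff)
        also have "\<bar>exp (c * s) - exp (c * real j)\<bar> \<le> exp (c * real n) * (c * real L)"
        proof -
          have "exp (c * real j) = exp (c * s) * exp (- (c * (s - real j)))" by (simp add: exp_add[symmetric] algebra_simps)
          then have "exp (c * s) - exp (c * real j) = exp (c * s) * (1 - exp (- (c * (s - real j))))" by (simp add: algebra_simps)
          also have "\<dots> \<le> exp (c * real n) * (c * real L)"
          proof (rule mult_mono)
            show "exp (c * s) \<le> exp (c * real n)" using sn c_pos by simp
            have "1 - exp (- (c * (s - real j))) \<le> c * (s - real j)" using exp_ge_add_one_self[of "- (c * (s - real j))"] by linarith
            also have "\<dots> \<le> c * real L" using sj c_pos by (intro mult_left_mono) auto
            finally show "1 - exp (- (c * (s - real j))) \<le> c * real L" .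
            show "0 \<le> 1 - exp (- (c * (s - real j)))" using js c_pos by simp
          qed auto
          finally show ?thesis using js c_pos by simp
        qed
        also have "exp (c * real j) * norm (cis \<phi> - cis (\<theta> j)) \<le> exp (c * real n) * e'"
          using jn(1) c_pos j(2) by (intro mult_mono) auto
        finally show ?thesis by (simp add: algebra_simps)
      qed
      finally have "infdist w (HL_K P \<theta> n) \<le> (c * real L + e' + (4 * e + d + 2 * c)) * exp (c * real n)"
        by (simp add: algebra_simps)
      also have "\<dots> \<le> \<epsilon> * exp (c * real n)"
      proof (rule mult_right_mono)
        have "c * real L \<le> c * (real L + 1)" using c_pos by simp
        then show "c * real L + e' + (4 * e + d + 2 * c) \<le> \<epsilon>" using eps nonneg by linarith
      qed simp
      finally show ?thesis .
    qed
  qed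
  show ?thesis
    unfolding HL_Omega_def HL_cap_eq Let_def
  proof (intro conjI ballI allI impI)
    fix n z assume "n \<in> {1..m}" "z \<in> HL_P P \<theta> n"
    from A[OF this] have "norm (z - of_real (exp (c * real n)) * cis (\<theta> n)) \<le> (4 * e + d + 2 * c) * exp (c * real n)" .
    also have "\<dots> \<le> \<epsilon> * exp (c * real n)" using eps1 by (intro mult_right_mono) auto
    finally show "norm (z - of_real (exp (c * real n)) * cis (\<theta> n)) \<le> \<epsilon> * exp (c * real n)" .
  qed (use B Cc in auto)
qed

end

section \<open>Measurability of the event\<close>

text \<open>The clauses of the event quantify over uncountable sets; continuity reduces each to a
  countable dense subset.\<close>

lemma continuous_le_on_dense:
  fixes h :: "complex \<Rightarrow> real"
  assumes h: "continuous_on S h" and Q: "Q \<subseteq> S" "S \<subseteq> closure Q" and le: "\<And>q. q \<in> Q \<Longrightarrow> h q \<le> r" and p: "p \<in> S"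
  shows "h p \<le> r"
proof -
  obtain x where x: "\<And>n. x n \<in> Q" "x \<longlonglongrightarrow> p" using Q p closure_sequential[of p Q] by blast
  have "(\<lambda>n. h (x n)) \<longlonglongrightarrow> h p"
    using h x p Q unfolding continuous_on_sequentially by (auto simp: o_def)
  then show ?thesis by (rule LIMSEQ_le_const2) (use le x in auto)
qed

text \<open>With the slack \<open>1 / (k + 1)\<close> the infimum becomes a family of strict
  existential conditions. These are open in the witness and can be tested on a dense set.\<close>

lemma infdist_le_iff:
  fixes A :: "complex set"
  assumes "A \<noteq> {}"
  shows "infdist w A \<le> r \<longleftrightarrow> (\<forall>k::nat. \<exists>x\<in>A. dist w x < r + 1 / (real k + 1))"
proof
  assume le: "infdist w A \<le> r"
  show "\<forall>k::nat. \<exists>x\<in>A. dist w x < r + 1 / (real k + 1)"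
  proof
    fix k :: nat
    have "0 < 1 / (real k + 1)" by simp
    then have "infdist w A < r + 1 / (real k + 1)" using le by linarith
    then have "(INF x\<in>A. dist w x) < r + 1 / (real k + 1)" unfolding infdist_notempty[OF assms] .
    then show "\<exists>x\<in>A. dist w x < r + 1 / (real k + 1)"
      using cInf_less_iff[of "dist w ` A"] assms by (auto intro: bdd_belowI2[of _ 0])
  qed
next
  assume all: "\<forall>k::nat. \<exists>x\<in>A. dist w x < r + 1 / (real k + 1)"
  show "infdist w A \<le> r"
  proof (rule ccontr)
    assume "\<not> infdist w A \<le> r"
    then obtain k :: nat where k: "inverse (real (Suc k)) < infdist w A - r"
      using reals_Archimedean[of "infdist w A - r"] by auto
    obtain x where "x \<in> A" "dist w x < r + 1 / (real k + 1)" using all by blast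
    then have "infdist w A < r + 1 / (real k + 1)" using infdist_le[of x A w] by simp
    then show False using k by (simp add: inverse_eq_divide add.commute)
  qed
qed

lemma pred_Ball_countable:
  "countable X \<Longrightarrow> (\<And>i. i \<in> X \<Longrightarrow> Measurable.pred M (P i)) \<Longrightarrow> Measurable.pred M (\<lambda>x. \<forall>i\<in>X. P i x)"
  unfolding pred_def by (rule sets.sets_Collect_countable_All')

lemma pred_Bex_countable:
  "countable X \<Longrightarrow> (\<And>i. i \<in> X \<Longrightarrow> Measurable.pred M (P i)) \<Longrightarrow> Measurable.pred M (\<lambda>x. \<exists>i\<in>X. P i x)"
  unfolding pred_def by (rule sets.sets_Collect_countable_Ex')

lemma pred_conj: "Measurable.pred M P \<Longrightarrow> Measurable.pred M Q \<Longrightarrow> Measurable.pred M (\<lambda>x. P x \<and> Q x)"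
  by measurable

lemma pred_disj: "Measurable.pred M P \<Longrightarrow> Measurable.pred M Q \<Longrightarrow> Measurable.pred M (\<lambda>x. P x \<or> Q x)"
  by measurable

context hl_particle
begin

lemma ppt_measurable:
  assumes \<Theta>: "\<And>n. \<Theta> n \<in> borel_measurable M"
  shows "(\<lambda>\<omega>. ppt (\<lambda>n. \<Theta> n \<omega>) n p) \<in> borel_measurable M"
proof -
  note \<Theta>[of "Suc n", measurable]
  have "(\<lambda>\<omega>. Hs f (\<lambda>j. \<Theta> (n - j) \<omega>) (cis (- \<Theta> (Suc n) \<omega>) * (1 / p)) n) \<in> borel_measurable M"
    by (rule measurable_Hs[OF \<Theta>]) measurable
  note this[measurable]
  show ?thesis unfolding ppt_def by measurable
qed

text \<open>\<open>G\<close> is the event with \<open>P\<close> replaced by a countable dense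
  \<open>Q\<close> and the discs by countable dense \<open>T n\<close>; this changes nothing because
  \<open>ppt\<close> is continuous on \<open>P\<close> and \<open>infdist\<close> is continuous. The
  part \<open>K0\<close> of the cluster needs no dense set, as \<open>K0_near\<close> does not
  involve the angles.\<close>

lemma HL_Omega_measurable:
  assumes \<Theta>: "\<And>n. \<Theta> n \<in> borel_measurable M"
  shows "{\<omega> \<in> space M. HL_Omega P m \<epsilon> (\<lambda>n. \<Theta> n \<omega>)} \<in> sets M"
proof -
  obtain Q where Q: "countable Q" "Q \<subseteq> P" "P \<subseteq> closure Q" using separable[of P] by metis
  define R where "R n = exp (c * real n)" for n
  have "\<exists>T. countable T \<and> T \<subseteq> cball 0 (R n) \<and> cball (0::complex) (R n) \<subseteq> closure T" for n
    using separable[of "cball (0::complex) (R n)"] by metis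
  then obtain T where T: "\<And>n. countable (T n)" "\<And>n. T n \<subseteq> cball 0 (R n)" "\<And>n. cball (0::complex) (R n) \<subseteq> closure (T n)"
    by metis
  define K0_near where "K0_near w y \<longleftrightarrow> (\<exists>x\<in>K0. dist w x < y)" for w y
  define G where "G \<omega> \<longleftrightarrow>
      (\<forall>n\<in>{..<m}. \<forall>q\<in>Q. norm (ppt (\<lambda>i. \<Theta> i \<omega>) n q - of_real (R (Suc n)) * cis (\<Theta> (Suc n) \<omega>)) \<le> \<epsilon> * R (Suc n)) \<and>
      (\<forall>n\<in>{..m}. \<forall>w\<in>T n. \<forall>k\<in>(UNIV::nat set). K0_near w (\<epsilon> * R n + 1 / (real k + 1)) \<or>
         (\<exists>j\<in>{..<n}. \<exists>q\<in>Q. dist w (ppt (\<lambda>i. \<Theta> i \<omega>) j q) < \<epsilon> * R n + 1 / (real k + 1))) \<and>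
      (\<forall>n\<in>{m..}. \<forall>q\<in>Q. (1 - \<epsilon>) * R m \<le> norm (ppt (\<lambda>i. \<Theta> i \<omega>) n q))" for \<omega>
  have Gm: "Measurable.pred M G"
  proof -
    have pm[measurable]: "(\<lambda>\<omega>. ppt (\<lambda>i. \<Theta> i \<omega>) n q) \<in> borel_measurable M" for n q
      by (rule ppt_measurable[OF \<Theta>])
    note \<Theta>[measurable]
    show ?thesis unfolding G_def[abs_def]
      by (intro pred_conj pred_disj pred_Ball_countable pred_Bex_countable Q(1) T(1) countableI_type) measurable
  qed
  have "HL_Omega P m \<epsilon> (\<lambda>n. \<Theta> n \<omega>) \<longleftrightarrow> G \<omega>" for \<omega>
  proof -
    let ?\<theta> = "\<lambda>i. \<Theta> i \<omega>"
    have 1: "(\<forall>n\<in>{1..m}. \<forall>z\<in>HL_P P ?\<theta> n. norm (z - of_real (exp (c * real n)) * cis (?\<theta> n)) \<le> \<epsilon> * exp (c * real n))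
      \<longleftrightarrow> (\<forall>n\<in>{..<m}. \<forall>q\<in>Q. norm (ppt ?\<theta> n q - of_real (R (Suc n)) * cis (\<Theta> (Suc n) \<omega>)) \<le> \<epsilon> * R (Suc n))"
      (is "?L = ?R")
    proof
      assume l: ?L
      show ?R
      proof (intro ballI)
        fix n q assume n: "n \<in> {..<m}" and q: "q \<in> Q"
        have "ppt ?\<theta> n q \<in> HL_P P ?\<theta> (Suc n)" using q Q(2) unfolding HL_P_eq by auto
        moreover have "Suc n \<in> {1..m}" using n by auto
        ultimately show "norm (ppt ?\<theta> n q - of_real (R (Suc n)) * cis (\<Theta> (Suc n) \<omega>)) \<le> \<epsilon> * R (Suc n)"
          using l unfolding R_def by blast
      qed
    next
      assume r: ?R
      show ?L
      proof (intro ballI)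
        fix n z assume n: "n \<in> {1..m}" and z: "z \<in> HL_P P ?\<theta> n"
        then obtain k where k: "n = Suc k" "k < m" by (cases n) auto
        obtain p where p: "p \<in> P" "z = ppt ?\<theta> k p" using z unfolding k HL_P_eq by auto
        show "norm (z - of_real (exp (c * real n)) * cis (?\<theta> n)) \<le> \<epsilon> * exp (c * real n)"
          unfolding k p(2)
          by (rule continuous_le_on_dense[OF _ Q(2,3) _ p(1), where h = "\<lambda>p. norm (ppt ?\<theta> k p - of_real (exp (c * real (Suc k))) * cis (?\<theta> (Suc k)))"])
             (use r k(2) in \<open>auto intro!: continuous_intros ppt_continuous simp: R_def\<close>)
      qed
    qed
    have 3: "(\<forall>n'\<ge>m + 1. \<forall>z\<in>HL_P P ?\<theta> n'. (1 - \<epsilon>) * exp (c * real m) \<le> norm z)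
      \<longleftrightarrow> (\<forall>n\<in>{m..}. \<forall>q\<in>Q. (1 - \<epsilon>) * R m \<le> norm (ppt ?\<theta> n q))" (is "?L = ?R")
    proof
      assume l: ?L
      show ?R
      proof (intro ballI)
        fix n q assume n: "n \<in> {m..}" and q: "q \<in> Q"
        have "ppt ?\<theta> n q \<in> HL_P P ?\<theta> (Suc n)" using q Q(2) unfolding HL_P_eq by auto
        then show "(1 - \<epsilon>) * R m \<le> norm (ppt ?\<theta> n q)" using l n unfolding R_def by auto
      qed
    next
      assume r: ?R
      show ?L
      proof (intro allI impI ballI)
        fix n z assume n: "n \<ge> m + 1" and z: "z \<in> HL_P P ?\<theta> n"
        then obtain k where k: "n = Suc k" "m \<le> k" by (cases n) auto
        obtain p where p: "p \<in> P" "z = ppt ?\<theta> k p" using z unfolding k HL_P_eq by auto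
        have "- norm (ppt ?\<theta> k p) \<le> - ((1 - \<epsilon>) * exp (c * real m))"
          by (rule continuous_le_on_dense[OF _ Q(2,3) _ p(1), where h = "\<lambda>p. - norm (ppt ?\<theta> k p)"])
             (use r k(2) in \<open>auto intro!: continuous_intros ppt_continuous simp: R_def\<close>)
        then show "(1 - \<epsilon>) * exp (c * real m) \<le> norm z" using p by simp
      qed
    qed
    have near: "(\<exists>x\<in>HL_K P ?\<theta> n. dist w x < y) \<longleftrightarrow> (\<exists>x\<in>K0. dist w x < y) \<or> (\<exists>j\<in>{..<n}. \<exists>q\<in>Q. dist w (ppt ?\<theta> j q) < y)"
      for n w y
    proof
      assume "\<exists>x\<in>HL_K P ?\<theta> n. dist w x < y"
      then obtain x where x: "x \<in> HL_K P ?\<theta> n" "dist w x < y" by blast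
      show "(\<exists>x\<in>K0. dist w x < y) \<or> (\<exists>j\<in>{..<n}. \<exists>q\<in>Q. dist w (ppt ?\<theta> j q) < y)"
      proof (cases "x \<in> K0")
        case False
        then obtain i where i: "i \<in> {1..n}" "x \<in> HL_P P ?\<theta> i" using x(1) unfolding HL_K_eq by blast
        then obtain j where j: "i = Suc j" "j < n" by (cases i) auto
        obtain p where p: "p \<in> P" "x = ppt ?\<theta> j p" using i(2) unfolding j HL_P_eq by auto
        have "\<exists>q\<in>Q. dist w (ppt ?\<theta> j q) < y"
        proof (rule ccontr)
          assume "\<not> (\<exists>q\<in>Q. dist w (ppt ?\<theta> j q) < y)"
          then have "- dist w (ppt ?\<theta> j p) \<le> - y"
            by (intro continuous_le_on_dense[OF _ Q(2,3) _ p(1), where h = "\<lambda>p. - dist w (ppt ?\<theta> j p)"])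
               (auto intro!: continuous_intros ppt_continuous simp: not_less)
          then show False using x(2) p(2) by simp
        qed
        then show ?thesis using j(2) by blast
      qed (use x in blast)
    next
      assume r: "(\<exists>x\<in>K0. dist w x < y) \<or> (\<exists>j\<in>{..<n}. \<exists>q\<in>Q. dist w (ppt ?\<theta> j q) < y)"
      have "ppt ?\<theta> j q \<in> HL_K P ?\<theta> n" if "j < n" "q \<in> Q" for j q
      proof -
        have "ppt ?\<theta> j q \<in> HL_P P ?\<theta> (Suc j)" using that Q(2) unfolding HL_P_eq by auto
        moreover have "Suc j \<in> {1..n}" using that by auto
        ultimately show ?thesis unfolding HL_K_eq by blast
      qed
      moreover have "K0 \<subseteq> HL_K P ?\<theta> n" unfolding HL_K_eq by auto
      ultimately show "\<exists>x\<in>HL_K P ?\<theta> n. dist w x < y" using r by auto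
    qed
    have Kne: "HL_K P ?\<theta> n \<noteq> {}" for n unfolding HL_K_eq by (auto simp: K0_def)
    have 2: "(\<forall>n\<le>m. \<forall>w. norm w \<le> exp (c * real n) \<longrightarrow> infdist w (HL_K P ?\<theta> n) \<le> \<epsilon> * exp (c * real n))
      \<longleftrightarrow> (\<forall>n\<in>{..m}. \<forall>w\<in>T n. \<forall>k\<in>(UNIV::nat set). K0_near w (\<epsilon> * R n + 1 / (real k + 1)) \<or>
         (\<exists>j\<in>{..<n}. \<exists>q\<in>Q. dist w (ppt ?\<theta> j q) < \<epsilon> * R n + 1 / (real k + 1)))" (is "?L = ?R")
    proof -
      have "?R \<longleftrightarrow> (\<forall>n\<in>{..m}. \<forall>w\<in>T n. infdist w (HL_K P ?\<theta> n) \<le> \<epsilon> * R n)"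
        unfolding infdist_le_iff[OF Kne] near K0_near_def by auto
      also have "\<dots> \<longleftrightarrow> ?L"
      proof
        assume r: "\<forall>n\<in>{..m}. \<forall>w\<in>T n. infdist w (HL_K P ?\<theta> n) \<le> \<epsilon> * R n"
        show ?L
        proof (intro allI impI)
          fix n and w :: complex assume n: "n \<le> m" and w: "norm w \<le> exp (c * real n)"
          show "infdist w (HL_K P ?\<theta> n) \<le> \<epsilon> * exp (c * real n)"
            by (rule continuous_le_on_dense[OF _ T(2,3), where n1 = n and h = "\<lambda>w. infdist w (HL_K P ?\<theta> n)"])
               (use r n w in \<open>auto intro!: continuous_intros simp: R_def\<close>)
        qed
      next
        assume l: ?L
        show "\<forall>n\<in>{..m}. \<forall>w\<in>T n. infdist w (HL_K P ?\<theta> n) \<le> \<epsilon> * R n"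
        proof (intro ballI)
          fix n w assume "n \<in> {..m}" "w \<in> T n"
          then show "infdist w (HL_K P ?\<theta> n) \<le> \<epsilon> * R n" using l T(2)[of n] by (auto simp: R_def)
        qed
      qed
      finally show ?thesis by blast
    qed
    show ?thesis
      unfolding HL_Omega_def HL_cap_eq Let_def G_def 1 2 3 by (rule refl)
  qed
  then have "{\<omega> \<in> space M. HL_Omega P m \<epsilon> (\<lambda>n. \<Theta> n \<omega>)} = {\<omega> \<in> space M. G \<omega>}" by simp
  then show ?thesis using Gm by (simp add: pred_def)
qed

end

section \<open>Choice of the scales\<close>

text \<open>All scales for the particle attached after \<open>n\<close> steps are expressed through
  \<open>u = (n + d powr - 6) powr (1 / 600)\<close>: a lifting time \<open>u / d\<close>, a maximal growth
  \<open>exp (u ^ 3)\<close>, a pocket of size \<open>exp (- (u ^ 4))\<close> and a net of mesh \<open>exp (- 7 * u ^ 4)\<close>.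
  Since \<open>d \<ge> u powr - 100\<close>, every error is then at most \<open>u powr - 1200\<close>, which is
  summable over \<open>n\<close>.\<close>

definition scale_ok :: "real \<Rightarrow> real \<Rightarrow> bool" where
  "scale_ok C u \<longleftrightarrow> 1 \<le> u \<and>
     16 * u ^ 700 * exp (- (3 * u ^ 4)) \<le> 1 \<and>
     2 * exp (u ^ 3 - u ^ 4) * (1 + 512 * C * u ^ 800) * u ^ 100 \<le> 1 \<and>
     2 * exp (2 * u ^ 3 - u ^ 4) * u ^ 100 \<le> 1 \<and>
     32 * C * exp (u ^ 3 - u ^ 4) * u ^ 200 \<le> 1 \<and>
     4 * exp (4 * C * (2 / cos (99/100 * pi / 2)) * u ^ 2 - 99/100 * u ^ 3) * u ^ 1200 \<le> 1 \<and>
     4 * exp (- (u / (32 * C\<^sup>2))) * u ^ 1200 \<le> 1 \<and>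
     26 * exp (14 * u ^ 4) * (4 * (u ^ 600 + 1) * exp (4 * C\<^sup>2 + 32 - u ^ 8 / 4)) * (4 * u ^ 1200) \<le> 1 \<and>
     26 * exp (14 * u ^ 4) * exp (- (u ^ 500 / (48 * C\<^sup>2))) * (4 * u ^ 1200) \<le> 1"

lemma cos_p_pos: "0 < cos (99/100 * pi / 2)"
  by (rule cos_gt_zero_pi) (use pi_gt_zero in linarith)+

lemma eventually_scale_ok:
  assumes C: "0 < C"
  shows "\<forall>\<^sub>F u in at_top. scale_ok C u"
proof -
  define B where "B = 4 * C * (2 / cos (99/100 * pi / 2))"
  have B: "0 < B" using C cos_p_pos by (simp add: B_def)
  have "\<forall>\<^sub>F u::real in at_top. 1 \<le> u" by (rule eventually_ge_at_top)
  moreover have "\<forall>\<^sub>F u::real in at_top. 16 * u ^ 700 * exp (- (3 * u ^ 4)) \<le> 1" by real_asymp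
  moreover have "\<forall>\<^sub>F u::real in at_top. 2 * exp (u ^ 3 - u ^ 4) * (1 + 512 * C * u ^ 800) * u ^ 100 \<le> 1"
    using C by real_asymp
  moreover have "\<forall>\<^sub>F u::real in at_top. 2 * exp (2 * u ^ 3 - u ^ 4) * u ^ 100 \<le> 1" by real_asymp
  moreover have "\<forall>\<^sub>F u::real in at_top. 32 * C * exp (u ^ 3 - u ^ 4) * u ^ 200 \<le> 1" using C by real_asymp
  moreover have "\<forall>\<^sub>F u::real in at_top. 4 * exp (B * u ^ 2 - 99/100 * u ^ 3) * u ^ 1200 \<le> 1" using B by real_asymp
  moreover have "\<forall>\<^sub>F u::real in at_top. 4 * exp (- (u / (32 * C\<^sup>2))) * u ^ 1200 \<le> 1" using C by real_asymp
  moreover have "\<forall>\<^sub>F u::real in at_top. 26 * exp (14 * u ^ 4) * (4 * (u ^ 600 + 1) * exp (4 * C\<^sup>2 + 32 - u ^ 8 / 4)) * (4 * u ^ 1200) \<le> 1"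
    using C by real_asymp
  moreover have "\<forall>\<^sub>F u::real in at_top. 26 * exp (14 * u ^ 4) * exp (- (u ^ 500 / (48 * C\<^sup>2))) * (4 * u ^ 1200) \<le> 1"
    using C by real_asymp
  ultimately show ?thesis
    unfolding scale_ok_def B_def by eventually_elim blast
qed

lemma le_inverse_power:
  fixes x y u :: real
  assumes "x * u ^ k \<le> 1" "1 \<le> u" "1 \<le> y * u ^ k" 
  shows "x \<le> y"
proof -
  have "x * u ^ k \<le> y * u ^ k" using assms(1,3) by (rule order_trans)
  moreover have "0 < u ^ k" using assms by simp
  ultimately show ?thesis by (simp add: mult_le_cancel_right)
qed

text \<open>Three error terms, each at most a quarter of \<open>1 / x^2 = u^-1200\<close>. As long
  as \<open>n \<le> 2 * d^-6\<close>, \<open>u\<close> is at most of order \<open>d^(-1/100)\<close>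
  and the fixed window \<open>d^(2/3)\<close> can be afforded; for later \<open>n\<close> only the
  one-sided estimate is claimed.\<close>

lemma (in hl_prob) bad_prob:
  fixes u :: real
  defines "x \<equiv> real n + d powr - 6"
  assumes u: "u = x powr (1/600)" and ok: "scale_ok C u" and c1: "c \<le> 1"
    and d4: "2 * C * d powr (1/4) \<le> 1" and d6: "2 * C * d powr (1/6) \<le> 1"
  shows "\<exists>E\<in>events. prob E \<le> 1 / x\<^sup>2 \<and> (\<forall>\<omega>\<in>space M - E.
     (real n \<le> 2 * d powr - 6 \<longrightarrow> (\<forall>\<zeta>\<in>horo d. norm (Hs f (th \<omega>) (st \<zeta> \<omega>) n - of_real (c * real n)) \<le> d powr (2/3) + d)) \<and>
     (2 * d powr - 6 < real n \<longrightarrow> (\<forall>\<zeta>\<in>horo d. 5/8 * c * real n - d \<le> Re (Hs f (th \<omega>) (st \<zeta> \<omega>) n))))"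
proof -
  \<comment> \<open>The growth over \<open>K\<close> steps costs an exponent of order
    \<open>K * d^p\<close>, that is \<open>u * d^(p - 1)\<close>. With \<open>p = 99/100\<close> and
    \<open>d^(-1/100) \<le> u\<close> this is of order \<open>u^2\<close>, which loses against
    \<open>p * ln W = p * u^3\<close>. The root of order 600 = 6 * 100 in \<open>u\<close> matches
    this choice of \<open>p\<close>.\<close>
  let ?p = "99/100 :: real"
  let ?B = "2 / cos (?p * pi / 2)"
  have B0: "0 < ?B" using cos_p_pos by simp
  have C0: "0 < C" using C_ge by simp
  have x0: "0 < x" using d_pos by (simp add: x_def add_nonneg_pos)
  have xd: "d powr - 6 \<le> x" by (simp add: x_def)
  have u1: "1 \<le> u" using ok by (simp add: scale_ok_def)
  have u600: "u ^ 600 = x" using x0 by (simp add: u powr_power)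
  have n_le: "real n \<le> u ^ 600" using d_pos by (simp add: u600 x_def)
  have du100: "1 \<le> d * u ^ 100"
  proof -
    have "(d powr - 6) powr (1/6) \<le> x powr (1/6)" by (rule powr_mono2) (use xd in auto)
    also have "x powr (1/6) = u ^ 100" using x0 by (simp add: u powr_power)
    also have "(d powr - 6) powr (1/6) = 1 / d"
    proof -
      have "(d powr - 6) powr (1/6) = d powr (- 6 * (1/6))" by (rule powr_powr)
      also have "(- 6 * (1/6)) = (- 1 :: real)" by simp
      also have "d powr - 1 = 1 / d" using d_pos by (simp add: powr_minus_divide)
      finally show ?thesis .
    qed
    finally show ?thesis using d_pos by (simp add: field_simps)
  qed
  have du: "d powr - (1/100) \<le> u"
  proof -
    have "(d powr - 6) powr (1/600) \<le> x powr (1/600)" by (rule powr_mono2) (use xd in auto)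
    then show ?thesis by (simp add: u powr_powr)
  qed
  have du200: "1 \<le> d\<^sup>2 * u ^ 200"
  proof -
    have "1 * 1 \<le> (d * u ^ 100) * (d * u ^ 100)" by (intro mult_mono du100) (use du100 in auto)
    also have "\<dots> = d\<^sup>2 * (u ^ 100 * u ^ 100)" by (simp add: power2_eq_square mult_ac)
    also have "u ^ 100 * u ^ 100 = u ^ 200" by (simp flip: power_add)
    finally show ?thesis by simp
  qed
  define \<kappa> where "\<kappa> = exp (- (u ^ 4))"
  define W where "W = exp (u ^ 3)"
  \<comment> \<open>The Lipschitz constant contains \<open>\<kappa>^-4 = exp (4 * u^4)\<close>, so
    the exponent 7 leaves \<open>exp (3 * u^4)\<close> to spare.\<close>
  define N where "N = nat \<lceil>exp (7 * u ^ 4)\<rceil>"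
  \<comment> \<open>The exponent in \<open>lower_tail\<close> is of order \<open>c * K / d\<close>;
    as \<open>c\<close> is of order \<open>d^2\<close>, this choice makes it of order
    \<open>u\<close>.\<close>
  define K where "K = nat \<lceil>u / d\<rceil>"
  have kap: "0 < \<kappa>" "\<kappa> < 1" using u1 by (auto simp: \<kappa>_def)
  have W1: "1 \<le> W" using u1 by (simp add: W_def)
  have Nlo: "exp (7 * u ^ 4) \<le> real N" by (simp add: N_def real_nat_ceiling_ge)
  have e7: "1 \<le> exp (7 * u ^ 4)" using u1 by simp
  have Nhi: "real N \<le> 2 * exp (7 * u ^ 4)"
    unfolding N_def using e7 ceiling_correct[of "exp (7 * u ^ 4)"] by linarith
  have N1: "1 \<le> N" using Nlo e7 by linarith
  have ud1: "1 \<le> u / d" using u1 d_pos d_le by (simp add: le_divide_eq)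
  have Klo: "u / d \<le> real K" by (simp add: K_def real_nat_ceiling_ge)
  have Khi: "real K \<le> 2 * (u / d)" unfolding K_def using ud1 ceiling_correct[of "u / d"] by linarith
  have K1: "1 \<le> K" using Klo ud1 by linarith
  have kW: "\<kappa> * W = exp (u ^ 3 - u ^ 4)" "\<kappa> * W\<^sup>2 = exp (2 * u ^ 3 - u ^ 4)"
    by (simp_all add: \<kappa>_def W_def exp_add[symmetric] power2_eq_square)
  have c_lo: "d\<^sup>2 / C \<le> c" using c_lower C0 by (simp add: field_simps)
  have inv_c: "1 / c \<le> C * u ^ 200"
  proof -
    have "1 \<le> C * c * u ^ 200" by (rule order_trans[OF du200 mult_right_mono[OF c_lower]]) (use u1 in simp)
    then show ?thesis using c_pos by (simp add: divide_le_eq mult_ac)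
  qed
  have eta1: "16 * c * real n / (\<kappa> ^ 4 * real N) \<le> d"
  proof (rule le_inverse_power[OF _ u1 du100])
    have k4: "\<kappa> ^ 4 = exp (- (4 * u ^ 4))" by (simp add: \<kappa>_def flip: exp_of_nat_mult)
    have "exp (3 * u ^ 4) = \<kappa> ^ 4 * exp (7 * u ^ 4)" unfolding k4 by (simp add: exp_add[symmetric])
    also have "\<dots> \<le> \<kappa> ^ 4 * real N" by (rule mult_left_mono[OF Nlo]) (use kap in auto)
    finally have den: "exp (3 * u ^ 4) \<le> \<kappa> ^ 4 * real N" .
    have "16 * c * real n / (\<kappa> ^ 4 * real N) \<le> 16 * 1 * u ^ 600 / exp (3 * u ^ 4)"
      by (intro frac_le mult_mono den n_le c1) (use c_pos u1 in auto)
    then have "16 * c * real n / (\<kappa> ^ 4 * real N) * u ^ 100 \<le> 16 * 1 * u ^ 600 / exp (3 * u ^ 4) * u ^ 100"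
      by (rule mult_right_mono) (use u1 in auto)
    also have "\<dots> = 16 * (u ^ 600 * u ^ 100) * exp (- (3 * u ^ 4))" by (simp add: exp_minus divide_inverse)
    also have "u ^ 600 * u ^ 100 = u ^ 700" by (simp flip: power_add)
    also have "16 * u ^ 700 * exp (- (3 * u ^ 4)) \<le> 1" using ok by (simp add: scale_ok_def)
    finally show "16 * c * real n / (\<kappa> ^ 4 * real N) * u ^ 100 \<le> 1" .
  qed
  have eta2: "2 * \<kappa> * W * (1 + 512 * real n / c) \<le> d"
  proof (rule le_inverse_power[OF _ u1 du100])
    have "512 * real n / c = 512 * (real n * (1 / c))" by simp
    also have "\<dots> \<le> 512 * (u ^ 600 * (C * u ^ 200))"
      by (intro mult_left_mono mult_mono n_le inv_c) (use u1 c_pos in auto)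
    also have "\<dots> = 512 * C * (u ^ 600 * u ^ 200)" by simp
    also have "u ^ 600 * u ^ 200 = u ^ 800" by (simp flip: power_add)
    finally have nc: "512 * real n / c \<le> 512 * C * u ^ 800" .
    have "2 * (\<kappa> * W) * (1 + 512 * real n / c) * u ^ 100 \<le> 2 * (\<kappa> * W) * (1 + 512 * C * u ^ 800) * u ^ 100"
      by (intro mult_right_mono mult_left_mono add_left_mono nc) (use kap W1 u1 in auto)
    also have "\<dots> \<le> 1" unfolding kW using ok by (simp add: scale_ok_def)
    finally show "2 * \<kappa> * W * (1 + 512 * real n / c) * u ^ 100 \<le> 1" by (simp only: mult.assoc)
  qed
  have small1: "2 * \<kappa> * W\<^sup>2 \<le> C * d"
  proof -
    have "2 * (\<kappa> * W\<^sup>2) \<le> d"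
      by (rule le_inverse_power[OF _ u1 du100]) (use ok in \<open>simp add: kW scale_ok_def\<close>)
    also have "\<dots> \<le> C * d" using C_ge d_pos by simp
    finally show ?thesis by (simp only: mult.assoc)
  qed
  have small2: "2 * \<kappa> * W \<le> c / 16"
  proof -
    have "32 * C * (\<kappa> * W) \<le> d\<^sup>2"
      by (rule le_inverse_power[OF _ u1 du200]) (use ok in \<open>simp add: kW scale_ok_def\<close>)
    also have "\<dots> \<le> C * c" by (rule c_lower)
    finally have "C * (32 * (\<kappa> * W)) \<le> C * c" by (simp only: mult_ac)
    then have "32 * (\<kappa> * W) \<le> c" using C0 by (simp only: mult_le_cancel_left_pos)
    then show ?thesis by simp
  qed
  have xx: "1 / x\<^sup>2 = 1 / u ^ 1200" by (simp add: u600[symmetric] flip: power_mult)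
  have quarter: "y \<le> 1 / (4 * u ^ 1200)" if "4 * y * u ^ 1200 \<le> 1" for y
    using that u1 by (simp add: le_divide_eq mult_ac)
  have T3: "exp (real K * ((2 * C * d) powr ?p * ?B) - ?p * ln W) \<le> 1 / (4 * u ^ 1200)"
  proof (rule quarter)
    have "(2 * C * d) powr ?p = (2 * C) powr ?p * d powr ?p" by (rule powr_mult)
    also have "(2 * C) powr ?p \<le> (2 * C) powr 1" by (rule powr_mono) (use C_ge in auto)
    finally have "(2 * C * d) powr ?p \<le> 2 * C * d powr ?p" using C0 by (simp add: mult_right_mono)
    then have "real K * ((2 * C * d) powr ?p * ?B) \<le> (2 * (u / d)) * ((2 * C * d powr ?p) * ?B)"
      by (intro mult_mono Khi mult_right_mono) (use B0 u1 d_pos C0 in auto)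
    also have "\<dots> = 4 * C * ?B * u * (d powr ?p / d)" by (simp add: mult_ac)
    also have "d powr ?p / d = d powr - (1/100)"
    proof -
      have "d powr ?p / d powr 1 = d powr (?p - 1)" by (rule powr_diff[symmetric])
      then show ?thesis using d_pos by simp
    qed
    also have "4 * C * ?B * u * d powr - (1/100) \<le> 4 * C * ?B * u * u"
      by (rule mult_left_mono[OF du]) (use B0 u1 C0 in auto)
    also have "\<dots> = 4 * C * ?B * u ^ 2" by (simp add: power2_eq_square)
    finally have "real K * ((2 * C * d) powr ?p * ?B) - ?p * ln W \<le> 4 * C * ?B * u ^ 2 - 99/100 * u ^ 3"
      by (simp add: W_def)
    then have "4 * exp (real K * ((2 * C * d) powr ?p * ?B) - ?p * ln W) * u ^ 1200
       \<le> 4 * exp (4 * C * ?B * u ^ 2 - 99/100 * u ^ 3) * u ^ 1200"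
      by (intro mult_right_mono mult_left_mono) (use u1 in auto)
    also have "\<dots> \<le> 1" using ok by (simp only: scale_ok_def)
    finally show "4 * exp (real K * ((2 * C * d) powr ?p * ?B) - ?p * ln W) * u ^ 1200 \<le> 1" .
  qed
  have cd: "d / C \<le> c / d" using c_lo d_pos by (simp add: power2_eq_square field_simps)
  have T4: "exp (- (c * real K) / (32 * C * d)) \<le> 1 / (4 * u ^ 1200)"
  proof (rule quarter)
    have "u / C = d / C * (u / d)" using d_pos by simp
    also have "\<dots> \<le> c / d * real K" by (intro mult_mono cd Klo) (use c_pos d_pos u1 in auto)
    finally have "u / C / (32 * C) \<le> c / d * real K / (32 * C)" using C0 by (intro divide_right_mono) auto
    then have "- (c * real K) / (32 * C * d) \<le> - (u / (32 * C\<^sup>2))" using C0 by (simp add: power2_eq_square mult_ac)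
    then have "4 * exp (- (c * real K) / (32 * C * d)) * u ^ 1200 \<le> 4 * exp (- (u / (32 * C\<^sup>2))) * u ^ 1200"
      by (intro mult_right_mono mult_left_mono) (use u1 in auto)
    also have "\<dots> \<le> 1" using ok by (simp only: scale_ok_def)
    finally show "4 * exp (- (c * real K) / (32 * C * d)) * u ^ 1200 \<le> 1" .
  qed
  have NN: "(2 * real N + 1)\<^sup>2 + 1 \<le> 26 * exp (14 * u ^ 4)"
  proof -
    have "2 * real N + 1 \<le> 5 * exp (7 * u ^ 4)" using Nhi e7 by linarith
    then have "(2 * real N + 1)\<^sup>2 \<le> (5 * exp (7 * u ^ 4))\<^sup>2" by (rule power_mono) simp
    also have "\<dots> = 25 * exp (14 * u ^ 4)" by (simp add: power_mult_distrib flip: exp_double)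
    finally have "(2 * real N + 1)\<^sup>2 \<le> 25 * exp (14 * u ^ 4)" .
    moreover have "1 \<le> exp (14 * u ^ 4)" using u1 by simp
    ultimately show ?thesis by linarith
  qed
  show ?thesis
  proof (cases "real n \<le> 2 * d powr - 6")
    case True
    \<comment> \<open>The variance \<open>k0 * d^3 + 1 / k0\<close>, up to constants, is balanced at
      \<open>k0 = d^(-3/2)\<close>, with the value \<open>d^(3/2) = l^-2\<close>. The condition
      \<open>2 * A \<le> c * real k0\<close> then holds with a factor \<open>d^(1/6)\<close> to
      spare.\<close>
    define l where "l = d powr - (3/4)"
    define A where "A = d powr (2/3)"
    define k0 where "k0 = nat \<lceil>d powr - (3/2)\<rceil>"
    have l0: "0 < l" using d_pos by (simp add: l_def)
    have l1: "2 * C * d * l \<le> 1"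
    proof -
      have "d * l = d powr 1 * d powr - (3/4)" using d_pos by (simp add: l_def)
      also have "\<dots> = d powr (1 + - (3/4))" by (simp only: powr_add)
      also have "(1 + - (3/4)) = (1/4 :: real)" by simp
      finally show ?thesis using d4 by (simp add: mult.assoc)
    qed
    have dk1: "1 \<le> d powr - (3/2)"
      using powr_mono2'[of "- (3/2)" d 1] d_pos d_le by simp
    have k0lo: "d powr - (3/2) \<le> real k0" by (simp add: k0_def real_nat_ceiling_ge)
    have k0hi: "real k0 \<le> 2 * d powr - (3/2)" unfolding k0_def using dk1 ceiling_correct[of "d powr - (3/2)"] by linarith
    have k01: "1 \<le> k0" using k0lo dk1 by linarith
    have k0A: "2 * A \<le> c * real k0"
    proof -
      have "2 * A * C = 2 * C * d powr (1/6) * d powr (1/2)" by (simp add: A_def flip: powr_add)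
      also have "\<dots> \<le> 1 * d powr (1/2)" by (rule mult_right_mono[OF d6]) simp
      also have "\<dots> = d powr 2 * d powr - (3/2)" by (simp flip: powr_add)
      also have "\<dots> \<le> C * c * real k0"
        using c_lower d_pos c_pos C0 by (intro mult_mono k0lo) auto
      finally have "C * (2 * A) \<le> C * (c * real k0)" by (simp only: mult_ac)
      then show ?thesis using C0 by (simp only: mult_le_cancel_left_pos)
    qed
    have T1: "((2 * real N + 1)\<^sup>2 + 1) * (4 * (real n + 1) * exp (l\<^sup>2 * (real k0 * (2 * C * d * c) + 32 / real k0) - l * A / 2)) \<le> 1 / (4 * u ^ 1200)"
    proof -
      have V: "l\<^sup>2 * (real k0 * (2 * C * d * c) + 32 / real k0) \<le> 4 * C\<^sup>2 + 32"
      proof -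
        have l2: "l\<^sup>2 = d powr - (3/2)" using d_pos by (simp add: l_def powr_power)
        have "real k0 * (2 * C * d * c) \<le> (2 * d powr - (3/2)) * (2 * C * d * (C * d\<^sup>2))"
          by (intro mult_mono k0hi mult_left_mono c_upper) (use C0 d_pos c_pos in auto)
        also have "\<dots> = 4 * C\<^sup>2 * (d powr - (3/2) * (d powr 1 * d powr 2))" using d_pos by (simp add: power2_eq_square)
        also have "d powr - (3/2) * (d powr 1 * d powr 2) = d powr (- (3/2) + (1 + 2))" by (simp only: powr_add)
        also have "(- (3/2) + (1 + 2)) = (3/2 :: real)" by simp
        finally have 1: "real k0 * (2 * C * d * c) \<le> 4 * C\<^sup>2 * d powr (3/2)" .
        have "32 / real k0 \<le> 32 / d powr - (3/2)" by (intro divide_left_mono mult_pos_pos) (use k0lo dk1 in linarith)+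
        also have "\<dots> = 32 * d powr (3/2)" by (simp add: powr_minus_divide)
        finally have "real k0 * (2 * C * d * c) + 32 / real k0 \<le> (4 * C\<^sup>2 + 32) * d powr (3/2)" using 1 by (simp add: algebra_simps)
        then have "l\<^sup>2 * (real k0 * (2 * C * d * c) + 32 / real k0) \<le> d powr - (3/2) * ((4 * C\<^sup>2 + 32) * d powr (3/2))"
          unfolding l2 by (rule mult_left_mono) simp
        also have "\<dots> = (4 * C\<^sup>2 + 32) * (d powr - (3/2) * d powr (3/2))" by simp
        also have "d powr - (3/2) * d powr (3/2) = 1" using d_pos by (simp flip: powr_add)
        finally show ?thesis by simp
      qed
      \<comment> \<open>\<open>l * A = d^(-1/12)\<close>, and \<open>x \<le> 3 * d^-6\<close> in
        this case. The resulting \<open>u^8\<close> dominates the \<open>14 * u^4\<close> paid for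
        the net.\<close>
      have lA: "u ^ 8 / 2 \<le> l * A"
      proof -
        have "x \<le> 3 * d powr - 6" using True by (simp add: x_def)
        also have "\<dots> \<le> 64 * d powr - 6" by simp
        finally have "x powr (1/72) \<le> (64 * d powr - 6) powr (1/72)" using x0 by (intro powr_mono2) auto
        also have "\<dots> = 64 powr (1/72) * d powr - (1/12)" using d_pos by (simp add: powr_mult powr_powr)
        also have "\<dots> \<le> 2 * d powr - (1/12)"
        proof (rule mult_right_mono)
          have "(64::real) powr (1/72) \<le> 64 powr (1/6)" by (rule powr_mono) auto
          also have "(64::real) = 2 powr 6" by simp
          also have "(2 powr 6) powr (1/6) = (2 :: real)" by (simp only: powr_powr) simp
          finally show "(64::real) powr (1/72) \<le> 2" by simp
        qed simp
        finally have "x powr (1/72) \<le> 2 * d powr - (1/12)" .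
        moreover have "u ^ 8 \<le> x powr (1/72)"
        proof -
          have x1: "1 \<le> x" using u1 by (simp add: u600[symmetric])
          have "u ^ 8 = x powr (8/600)" using x0 by (simp add: u powr_power)
          also have "\<dots> \<le> x powr (1/72)" using x1 by (intro powr_mono) auto
          finally show ?thesis .
        qed
        moreover have "l * A = d powr - (1/12)" by (simp add: l_def A_def flip: powr_add)
        ultimately show ?thesis by simp
      qed
      have "((2 * real N + 1)\<^sup>2 + 1) * (4 * (real n + 1) * exp (l\<^sup>2 * (real k0 * (2 * C * d * c) + 32 / real k0) - l * A / 2))
        \<le> 26 * exp (14 * u ^ 4) * (4 * (u ^ 600 + 1) * exp (4 * C\<^sup>2 + 32 - u ^ 8 / 4))"
      proof (rule mult_mono[OF NN])
        have "exp (l\<^sup>2 * (real k0 * (2 * C * d * c) + 32 / real k0) - l * A / 2) \<le> exp (4 * C\<^sup>2 + 32 - u ^ 8 / 4)"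
          using V lA by simp
        then show "4 * (real n + 1) * exp (l\<^sup>2 * (real k0 * (2 * C * d * c) + 32 / real k0) - l * A / 2)
           \<le> 4 * (u ^ 600 + 1) * exp (4 * C\<^sup>2 + 32 - u ^ 8 / 4)"
          using n_le u1 by (intro mult_mono) auto
      qed auto
      moreover have "4 * (26 * exp (14 * u ^ 4) * (4 * (u ^ 600 + 1) * exp (4 * C\<^sup>2 + 32 - u ^ 8 / 4))) * u ^ 1200 \<le> 1"
        using ok by (simp only: scale_ok_def mult_ac)
      ultimately show ?thesis using quarter order_trans by blast
    qed
    obtain E where E: "E \<in> events" "prob E \<le> ((2 * real N + 1)\<^sup>2 + 1)
          * (4 * (real n + 1) * exp (l\<^sup>2 * (real k0 * (2 * C * d * c) + 32 / real k0) - l * A / 2))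
       + exp (real K * ((2 * C * d) powr ?p * ?B) - ?p * ln W)
       + exp (- (c * real K) / (32 * C * d))"
      "\<forall>\<omega>\<in>space M - E. \<forall>\<zeta>\<in>horo d. norm (Hs f (th \<omega>) (st \<zeta> \<omega>) n - of_real (c * real n)) \<le> A + d"
      using particle_concentration[OF kap N1 K1 _ _ W1 c1 eta1 eta2 small1 small2 l0 l1 k01 k0A, of ?p] by auto
    have "prob E \<le> 1 / (4 * u ^ 1200) + 1 / (4 * u ^ 1200) + 1 / (4 * u ^ 1200)" using E(2) T1 T3 T4 by linarith
    also have "\<dots> \<le> 1 / x\<^sup>2" unfolding xx using u1 by (simp add: field_simps)
    finally have "prob E \<le> 1 / x\<^sup>2" .
    then show ?thesis using E True unfolding A_def by (intro bexI[of _ E]) auto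
  next
    case False
    \<comment> \<open>Now \<open>n\<close> is at least two thirds of \<open>x = u^600\<close>, and
      \<open>c / d\<close> is at least of order \<open>d\<close>, hence of order
      \<open>u^-100\<close>; this gives the exponent \<open>u^500\<close>.\<close>
    have T2: "((2 * real N + 1)\<^sup>2 + 1) * exp (- (c * real n) / (32 * C * d)) \<le> 1 / (4 * u ^ 1200)"
    proof -
      have n23: "2/3 * u ^ 600 \<le> real n" using False by (simp add: u600 x_def)
      have "1 / u ^ 100 \<le> d" using du100 u1 by (simp add: divide_le_eq)
      then have "1 / u ^ 100 / C \<le> c / d" using cd C0 by (smt (verit) divide_right_mono)
      then have "(1 / u ^ 100 / C) * (2/3 * u ^ 600) \<le> c / d * real n"
        by (intro mult_mono n23) (use c_pos d_pos u1 in auto)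
      moreover have "(1 / u ^ 100 / C) * (2/3 * u ^ 600) = 2/3 * u ^ 500 / C"
      proof -
        have gen: "(1 / y / C) * (2/3 * (z * y)) = 2/3 * z / C" if "y \<noteq> 0" for y z :: real
          using that by simp
        have "u ^ 600 = u ^ 500 * u ^ 100" by (simp flip: power_add)
        then show ?thesis using gen[of "u ^ 100" "u ^ 500"] u1 by (simp only:) simp
      qed
      ultimately have "2/3 * u ^ 500 / C / (32 * C) \<le> c / d * real n / (32 * C)" using C0 by (intro divide_right_mono) auto
      then have "- (c * real n) / (32 * C * d) \<le> - (u ^ 500 / (48 * C\<^sup>2))" using C0 by (simp add: power2_eq_square mult_ac)
      then have "((2 * real N + 1)\<^sup>2 + 1) * exp (- (c * real n) / (32 * C * d)) \<le> 26 * exp (14 * u ^ 4) * exp (- (u ^ 500 / (48 * C\<^sup>2)))"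
        by (intro mult_mono NN) auto
      moreover have "4 * (26 * exp (14 * u ^ 4) * exp (- (u ^ 500 / (48 * C\<^sup>2)))) * u ^ 1200 \<le> 1"
        using ok by (simp only: scale_ok_def mult_ac)
      ultimately show ?thesis using quarter order_trans by blast
    qed
    obtain E where E: "E \<in> events" "prob E \<le> ((2 * real N + 1)\<^sup>2 + 1) * exp (- (c * real n) / (32 * C * d))
       + exp (real K * ((2 * C * d) powr ?p * ?B) - ?p * ln W)
       + exp (- (c * real K) / (32 * C * d))"
      "\<forall>\<omega>\<in>space M - E. \<forall>\<zeta>\<in>horo d. 5/8 * c * real n - d \<le> Re (Hs f (th \<omega>) (st \<zeta> \<omega>) n)"
      using particle_lower[OF kap N1 K1 _ _ W1 c1 eta1 eta2 small1 small2, of ?p] by auto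
    have "prob E \<le> 1 / (4 * u ^ 1200) + 1 / (4 * u ^ 1200) + 1 / (4 * u ^ 1200)" using E(2) T2 T3 T4 by linarith
    also have "\<dots> \<le> 1 / x\<^sup>2" unfolding xx using u1 by (simp add: field_simps)
    finally have "prob E \<le> 1 / x\<^sup>2" .
    then show ?thesis using E False by (intro bexI[of _ E]) auto
  qed
qed

section \<open>Proof of the theorem\<close>

lemma norm_cis_diff_le: "norm (cis x - cis y) \<le> \<bar>x - y\<bar>"
proof -
  have "(norm (cis x - cis y))\<^sup>2 = (cos x - cos y)\<^sup>2 + (sin x - sin y)\<^sup>2" by (simp add: cmod_power2)
  also have "\<dots> = ((cos x)\<^sup>2 + (sin x)\<^sup>2) + ((cos y)\<^sup>2 + (sin y)\<^sup>2) - 2 * (cos x * cos y + sin x * sin y)"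
    by (simp add: power2_eq_square algebra_simps)
  also have "\<dots> = 2 - 2 * cos (x - y)" by (simp add: cos_diff)
  also have "cos (x - y) = 1 - 2 * (sin ((x - y) / 2))\<^sup>2"
    using cos_double_sin[of "(x - y) / 2"] by (simp only: nonzero_mult_div_cancel_left times_divide_eq_right)
  also have "2 - 2 * (1 - 2 * (sin ((x - y) / 2))\<^sup>2) = (2 * \<bar>sin ((x - y) / 2)\<bar>)\<^sup>2"
    by (simp add: power_mult_distrib)
  finally have "norm (cis x - cis y) = 2 * \<bar>sin ((x - y) / 2)\<bar>"
    by (rule power2_eq_imp_eq) auto
  also have "\<dots> \<le> 2 * \<bar>(x - y) / 2\<bar>" by (intro mult_left_mono abs_sin_x_le_abs_x) auto
  finally show ?thesis by simp
qed

lemma (in prob_space) indep_vars_reindex: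
  assumes X: "indep_vars (\<lambda>_. N) X UNIV" and t: "inj_on t I"
  shows "indep_vars (\<lambda>_. N) (\<lambda>i. X (t i)) I"
  unfolding indep_vars_def2
proof (intro conjI ballI indep_setsI)
  note X2 = X[unfolded indep_vars_def2]
  show "random_variable N (X (t i))" for i using X2 by blast
  then show "{X (t i) -` A \<inter> space M |A. A \<in> sets N} \<subseteq> events" for i by auto
  fix A J assume J: "J \<noteq> {}" "J \<subseteq> I" "finite J"
    and A: "\<forall>j\<in>J. A j \<in> {X (t j) -` A \<inter> space M |A. A \<in> sets N}"
  have inj: "inj_on t J" using t J(2) by (rule inj_on_subset)
  define B where "B = (\<lambda>i. A (the_inv_into J t i))"
  have B: "B (t j) = A j" if "j \<in> J" for j using the_inv_into_f_f[OF inj that] by (simp add: B_def)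
  have "prob (\<Inter>i\<in>t ` J. B i) = (\<Prod>i\<in>t ` J. prob (B i))"
  proof (rule indep_setsD)
    show "indep_sets (\<lambda>i. {X i -` A \<inter> space M |A. A \<in> sets N}) UNIV" using X2 by blast
    show "\<forall>i\<in>t ` J. B i \<in> {X i -` A \<inter> space M |A. A \<in> sets N}" using A by (simp add: B)
  qed (use J in auto)
  then show "prob (\<Inter>j\<in>J. A j) = (\<Prod>j\<in>J. prob (A j))"
    using inj by (simp add: prod.reindex B)
qed

text \<open>The circle is cut into \<open>N\<close> arcs of equal length. A fixed arc is missed by
  \<open>L\<close> independent angles with probability \<open>(1 - 1 / N)^L\<close>; the rest is a
  union over starting indices and arcs.\<close>

lemma (in prob_space) fill_prob:
  assumes indep: "indep_vars (\<lambda>_. borel) \<Theta> UNIV" and distr: "\<And>n. distr M borel (\<Theta> n) = circ"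
    and N: "1 \<le> N" and L: "1 \<le> L" and e: "2 * pi / real N \<le> e"
  shows "\<exists>E\<in>events. prob E \<le> (real m + 1) * real N * exp (- (real L / real N)) \<and>
     (\<forall>\<omega>\<in>space M - E. \<forall>i. i + L \<le> m \<longrightarrow> (\<forall>\<phi>. \<exists>j\<in>{i+1..i+L}. norm (cis \<phi> - cis (\<Theta> j \<omega>)) \<le> e))"
proof -
  have \<Theta>: "\<Theta> n \<in> borel_measurable M" for n using indep by (auto simp: indep_vars_def)
  define w where "w = 2 * pi / real N"
  have w0: "0 < w" using N by (simp add: w_def)
  have Nw: "real N * w = 2 * pi" using N by (simp add: w_def)
  define cell where "cell k = {real k * w ..< (real k + 1) * w}" for k :: nat
  define E where "E ik = (\<Inter>j\<in>{fst ik + 1..fst ik + L}. \<Theta> j -` (- cell (snd ik)) \<inter> space M)" for ik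
  let ?I = "{..m} \<times> {..<N}"
  have "E ik = (\<Inter>j\<in>{fst ik + 1..fst ik + L}. \<Theta> j -` (- cell (snd ik)) \<inter> space M) \<inter> space M" for ik
    using L by (auto simp: E_def)
  then have Em: "E ik \<in> events" for ik
    unfolding E_def using L
    by (intro sets.finite_INT) (auto intro!: measurable_sets[OF \<Theta>] simp: cell_def)
  have one: "prob (\<Theta> j -` (- cell k) \<inter> space M) = 1 - 1 / real N" if k: "k < N" for j k
  proof -
    interpret Q: prob_space circ by (rule prob_space_circ)
    have cb: "cell k \<in> sets borel" by (simp add: cell_def)
    have "prob (\<Theta> j -` (- cell k) \<inter> space M) = measure (distr M borel (\<Theta> j)) (- cell k)"
      using \<Theta> cb by (simp add: measure_distr)
    also have "\<dots> = Q.prob (space circ - cell k)" unfolding distr by (simp add: Compl_eq_Diff_UNIV)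
    also have "\<dots> = 1 - Q.prob (cell k)" by (rule Q.prob_compl) (simp add: cb)
    also have "Q.prob (cell k) = measure lborel ({0..<2*pi} \<inter> cell k) / measure lborel {0..<2*pi}"
      by (rule measure_uniform_measure) (auto simp: cb)
    also have "{0..<2*pi} \<inter> cell k = cell k"
    proof -
      have "(real k + 1) * w \<le> real N * w" using k w0 by (intro mult_right_mono) auto
      moreover have "0 \<le> real k * w" using w0 by simp
      ultimately show ?thesis unfolding cell_def Nw by auto
    qed
    also have "measure lborel (cell k) = w" using w0 by (simp add: cell_def algebra_simps)
    also have "w / measure lborel {0..<2*pi} = 1 / real N" using N by (simp add: w_def)
    finally show ?thesis .
  qed
  have Ep: "prob (E ik) \<le> exp (- (real L / real N))" if ik: "ik \<in> ?I" for ik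
  proof -
    let ?J = "{fst ik + 1..fst ik + L}"
    have "prob (E ik) = (\<Prod>j\<in>?J. prob (\<Theta> j -` (- cell (snd ik)) \<inter> space M))"
      unfolding E_def
      by (rule indep_varsD[OF indep]) (use L in \<open>auto simp: cell_def\<close>)
    also have "\<dots> = (\<Prod>j\<in>?J. 1 - 1 / real N)" by (intro prod.cong refl one) (use ik in auto)
    also have "\<dots> = (1 - 1 / real N) ^ L" by simp
    also have "\<dots> \<le> exp (- (1 / real N)) ^ L"
      using N exp_ge_add_one_self[of "- (1 / real N)"] by (intro power_mono) auto
    also have "\<dots> = exp (- (real L / real N))" by (simp flip: exp_of_nat_mult)
    finally show ?thesis .
  qed
  have "prob (\<Union>ik\<in>?I. E ik) \<le> (\<Sum>ik\<in>?I. prob (E ik))"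
    by (rule finite_measure_subadditive_finite) (use Em in auto)
  also have "\<dots> \<le> (\<Sum>ik\<in>?I. exp (- (real L / real N)))" by (rule sum_mono[OF Ep])
  also have "\<dots> = (real m + 1) * real N * exp (- (real L / real N))" by (simp add: algebra_simps)
  finally have P: "prob (\<Union>ik\<in>?I. E ik) \<le> (real m + 1) * real N * exp (- (real L / real N))" .
  have "\<exists>j\<in>{i+1..i+L}. norm (cis \<phi> - cis (\<Theta> j \<omega>)) \<le> e"
    if om: "\<omega> \<in> space M - (\<Union>ik\<in>?I. E ik)" and i: "i + L \<le> m" for \<omega> i \<phi>
  proof -
    define \<psi> where "\<psi> = Arg2pi (cis \<phi>)"
    have psi: "0 \<le> \<psi>" "\<psi> < 2 * pi" "cis \<psi> = cis \<phi>"
      using Arg2pi[of "cis \<phi>"] by (auto simp: \<psi>_def is_Arg_def cis_conv_exp)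
    define k where "k = nat \<lfloor>\<psi> / w\<rfloor>"
    have "0 \<le> \<psi> / w" using psi w0 by simp
    then have k: "real k \<le> \<psi> / w" "\<psi> / w < real k + 1" unfolding k_def by linarith+
    have kN: "k < N"
    proof -
      have "\<psi> / w < real N" using psi(2) w0 Nw by (simp add: divide_less_eq mult.commute)
      then have "real k < real N" using k(1) by linarith
      then show ?thesis by simp
    qed
    have psic: "real k * w \<le> \<psi>" "\<psi> < (real k + 1) * w" using k w0 by (auto simp: field_simps)
    have "\<omega> \<notin> E (i, k)" using om i kN by auto
    moreover have "\<omega> \<in> space M" using om by blast
    ultimately have "\<not> (\<forall>j\<in>{i+1..i+L}. \<Theta> j \<omega> \<notin> cell k)" unfolding E_def using L by auto
    then obtain j where j: "j \<in> {i+1..i+L}" "\<Theta> j \<omega> \<in> cell k" by blast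
    have "\<bar>\<psi> - \<Theta> j \<omega>\<bar> \<le> w" using j(2) psic unfolding cell_def by (auto simp: algebra_simps)
    then have "norm (cis \<phi> - cis (\<Theta> j \<omega>)) \<le> e"
      using norm_cis_diff_le[of \<psi> "\<Theta> j \<omega>"] psi(3) e by (simp add: w_def)
    then show ?thesis using j(1) by blast
  qed
  then show ?thesis using P Em by (intro bexI[of _ "\<Union>ik\<in>?I. E ik"]) auto
qed

lemma sum_inverse_squares_shifted:
  fixes D :: real
  assumes D: "2 \<le> D"
  shows "summable (\<lambda>n. 1 / (real n + D)\<^sup>2)" "(\<Sum>n. 1 / (real n + D)\<^sup>2) \<le> 2 / D"
proof -
  define h where "h n = 1 / (real n + D - 1)" for n
  have le: "1 / (real n + D)\<^sup>2 \<le> h n - h (Suc n)" for n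
  proof -
    have "h n - h (Suc n) = 1 / ((real n + D - 1) * (real n + D))"
      using D by (simp add: h_def field_simps)
    moreover have "1 / (real n + D)\<^sup>2 \<le> 1 / ((real n + D - 1) * (real n + D))"
      using D by (intro divide_left_mono) (auto simp: power2_eq_square)
    ultimately show ?thesis by simp
  qed
  have "h \<longlonglongrightarrow> 0" unfolding h_def by real_asymp
  from telescope_sums'[OF this] have s: "(\<lambda>n. h n - h (Suc n)) sums h 0" by simp
  show sm: "summable (\<lambda>n. 1 / (real n + D)\<^sup>2)"
    by (rule summable_comparison_test'[OF sums_summable[OF s], of 0]) (use le in auto)
  have "(\<Sum>n. 1 / (real n + D)\<^sup>2) \<le> (\<Sum>n. h n - h (Suc n))"
    by (rule suminf_le[OF le sm sums_summable[OF s]])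
  also have "\<dots> = 1 / (D - 1)" using sums_unique[OF s] by (simp add: h_def)
  also have "\<dots> \<le> 2 / D" using D by (simp add: field_simps)
  finally show "(\<Sum>n. 1 / (real n + D)\<^sup>2) \<le> 2 / D" .
qed

text \<open>The first term comes from summing \<open>1 / x^2\<close> over all \<open>n\<close>, the
  second from the failure of filling.\<close>

definition error_bound :: "real \<Rightarrow> real" where
  "error_bound d = 2 * d ^ 6 + (d powr - 6 + 1) * (7 * d powr - (2/3) + 1) * exp (- (d powr - (2/3) / 8))"

definition small_enough :: "real \<Rightarrow> real \<Rightarrow> bool" where
  "small_enough C d \<longleftrightarrow> 0 < d \<and> d \<le> 1/2 \<and> (\<forall>u\<ge>d powr - (1/100). scale_ok C u) \<and> C * d\<^sup>2 \<le> 1 \<and>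
     2 * C * d powr (1/4) \<le> 1 \<and> 2 * C * d powr (1/6) \<le> 1 \<and> 3 * C * d powr (2/3) \<le> 1 \<and>
     d powr (2/3) + d \<le> 1/2 \<and>
     (5 + 6 * C) * d powr (2/3) + 5 * d + 2 * C * d\<^sup>2 \<le> d powr (2/3) * (ln (1/d)) ^ 8"

lemma eventually_small_enough:
  assumes C: "0 < C"
  shows "\<forall>\<^sub>F d in at_right 0. small_enough C d"
proof -
  obtain u0 where u0: "\<And>u. u0 \<le> u \<Longrightarrow> scale_ok C u"
    using eventually_scale_ok[OF C] by (auto simp: eventually_at_top_linorder)
  have "\<forall>\<^sub>F d :: real in at_right 0. 0 < d" by (simp add: eventually_at_filter)
  moreover have "\<forall>\<^sub>F d :: real in at_right 0. d \<le> 1/2" by real_asymp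
  moreover have "\<forall>\<^sub>F d :: real in at_right 0. \<bar>u0\<bar> + 1 \<le> d powr - (1/100)"
  proof -
    have "0 < \<bar>u0\<bar> + 1" by simp
    then show ?thesis by real_asymp
  qed
  moreover have "\<forall>\<^sub>F d :: real in at_right 0. C * d\<^sup>2 \<le> 1" using C by real_asymp
  moreover have "\<forall>\<^sub>F d :: real in at_right 0. 2 * C * d powr (1/4) \<le> 1" using C by real_asymp
  moreover have "\<forall>\<^sub>F d :: real in at_right 0. 2 * C * d powr (1/6) \<le> 1" using C by real_asymp
  moreover have "\<forall>\<^sub>F d :: real in at_right 0. 3 * C * d powr (2/3) \<le> 1" using C by real_asymp
  moreover have "\<forall>\<^sub>F d :: real in at_right 0. d powr (2/3) + d \<le> 1/2" by real_asymp
  moreover have "\<forall>\<^sub>F d :: real in at_right 0.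
      (5 + 6 * C) * d powr (2/3) + 5 * d + 2 * C * d\<^sup>2 \<le> d powr (2/3) * (ln (1/d)) ^ 8" using C by real_asymp
  ultimately show ?thesis
    unfolding small_enough_def by eventually_elim (use u0 in auto)
qed

lemma HL_Omega_prob:
  fixes M :: "'a measure" and \<Theta> :: "nat \<Rightarrow> 'a \<Rightarrow> real"
  assumes M: "prob_space M" and \<Theta>: "\<And>n. \<Theta> n \<in> borel_measurable M"
    and indep: "prob_space.indep_vars M (\<lambda>_. borel) \<Theta> UNIV" and distr: "\<And>n. distr M borel (\<Theta> n) = circ"
    and hp: "hl_particle f c C d a b P" and sm: "small_enough C d"
  shows "1 - error_bound d \<le> measure M {\<omega> \<in> space M. HL_Omega P (nat \<lfloor>d powr (-6)\<rfloor>) (d powr (2/3) * (ln (1/d)) ^ 8) (\<lambda>n. \<Theta> n \<omega>)}"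
proof -
  interpret prob_space M by (rule M)
  interpret hl_particle f c C d a b P by (rule hp)
  define m where "m = nat \<lfloor>d powr (-6)\<rfloor>"
  define \<epsilon> where "\<epsilon> = d powr (2/3) * (ln (1/d)) ^ 8"
  define e where "e = d powr (2/3) + d"
  \<comment> \<open>\<open>c * L\<close> is of order \<open>d^(2/3)\<close>, the error allowed,
    while \<open>L / N\<close> is of order \<open>d^(-2/3)\<close>, which makes a missed arc
    exponentially unlikely.\<close>
  define L where "L = nat \<lceil>d powr - (4/3)\<rceil>"
  \<comment> \<open>7 exceeds \<open>2 * pi\<close>, so the arcs have length at most
    \<open>d^(2/3)\<close>.\<close>
  define N where "N = nat \<lceil>7 * d powr - (2/3)\<rceil>"
  have c1: "c \<le> 1" using c_upper sm by (simp add: small_enough_def)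
  have C0: "0 < C" using C_ge by simp
  have p1: "1 \<le> d powr - r" if "0 \<le> r" for r using powr_mono2'[of "- r" d 1] d_pos d_le that by simp
  have m_le: "real m \<le> d powr - 6" unfolding m_def using p1[of 6] by linarith
  have d62: "2 \<le> d powr - 6"
  proof -
    have "(1/2) powr - 6 \<le> d powr - 6" by (rule powr_mono2') (use sm d_pos in \<open>auto simp: small_enough_def\<close>)
    moreover have "(1/2 :: real) powr - 6 = 64" by (simp add: powr_minus_divide power_divide)
    ultimately show ?thesis by simp
  qed
  define x where "x n = real n + d powr - 6" for n
  have "\<exists>E\<in>events. prob E \<le> 1 / (x n)\<^sup>2 \<and> (\<forall>\<omega>\<in>space M - E.
     (real n \<le> 2 * d powr - 6 \<longrightarrow> good_at (\<lambda>n. \<Theta> n \<omega>) e n) \<and>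
     (2 * d powr - 6 < real n \<longrightarrow> high_at (\<lambda>n. \<Theta> n \<omega>) (5/8 * c * real n - d) n))" for n
  proof -
    \<comment> \<open>\<open>X 0\<close> is \<open>\<Theta> (Suc n)\<close>, the angle of the new
      particle, and \<open>X 1\<close> to \<open>X n\<close> run back from \<open>\<Theta> n\<close>
      to \<open>\<Theta> 1\<close>; on \<open>{..n}\<close> the subtraction is injective.\<close>
    interpret I: hl_prob f c C d a b M "\<lambda>k. \<Theta> (Suc n - k)" n
    proof
      show "indep_vars (\<lambda>_. borel) (\<lambda>k. \<Theta> (Suc n - k)) {..n}"
        by (rule indep_vars_reindex[OF indep]) (auto simp: inj_on_def)
    qed (use \<Theta> distr in auto)
    have "scale_ok C (x n powr (1/600))"
    proof -
      have "(d powr - 6) powr (1/600) \<le> x n powr (1/600)" by (rule powr_mono2) (auto simp: x_def)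
      then show ?thesis using sm by (simp add: small_enough_def powr_powr)
    qed
    from I.bad_prob[OF _ this[unfolded x_def] c1] sm show ?thesis
      by (simp add: small_enough_def x_def good_at_def high_at_def e_def)
  qed
  then obtain E where E: "\<And>n. E n \<in> events" "\<And>n. prob (E n) \<le> 1 / (x n)\<^sup>2"
    "\<And>n \<omega>. \<omega> \<in> space M - E n \<Longrightarrow> real n \<le> 2 * d powr - 6 \<Longrightarrow> good_at (\<lambda>n. \<Theta> n \<omega>) e n"
    "\<And>n \<omega>. \<omega> \<in> space M - E n \<Longrightarrow> 2 * d powr - 6 < real n \<Longrightarrow> high_at (\<lambda>n. \<Theta> n \<omega>) (5/8 * c * real n - d) n"
    by metis
  note sums = sum_inverse_squares_shifted[OF d62, folded x_def]
  have sE: "summable (\<lambda>n. prob (E n))"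
    by (rule summable_comparison_test'[OF sums(1), of 0]) (use E(2) in auto)
  have "prob (\<Union>n. E n) \<le> (\<Sum>n. prob (E n))"
    by (rule finite_measure_subadditive_countably) (use E(1) sE in auto)
  also have "\<dots> \<le> (\<Sum>n. 1 / (x n)\<^sup>2)" by (rule suminf_le[OF E(2) sE sums(1)])
  also have "\<dots> \<le> 2 / d powr - 6" by (rule sums(2))
  also have "\<dots> = 2 * d ^ 6" using d_pos by (simp add: powr_minus_divide)
  finally have PE: "prob (\<Union>n. E n) \<le> 2 * d ^ 6" .
  have Llo: "d powr - (4/3) \<le> real L" by (simp add: L_def real_nat_ceiling_ge)
  have Lhi: "real L \<le> d powr - (4/3) + 1" unfolding L_def using p1[of "4/3"] by linarith
  have Nlo: "7 * d powr - (2/3) \<le> real N" by (simp add: N_def real_nat_ceiling_ge)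
  have Nhi: "real N \<le> 7 * d powr - (2/3) + 1" unfolding N_def using p1[of "2/3"] by linarith
  have L1: "1 \<le> L" using Llo p1[of "4/3"] by linarith
  have N1: "1 \<le> N" using Nlo p1[of "2/3"] by linarith
  have Ne: "2 * pi / real N \<le> d powr (2/3)"
  proof -
    have "2 * pi \<le> 7" using pi_approx by simp
    also have "7 = 7 * d powr - (2/3) * d powr (2/3)" using d_pos by (simp flip: powr_add)
    also have "\<dots> \<le> real N * d powr (2/3)" by (rule mult_right_mono[OF Nlo]) simp
    finally show ?thesis using N1 by (simp add: divide_le_eq mult.commute)
  qed
  obtain F where F: "F \<in> events" "prob F \<le> (real m + 1) * real N * exp (- (real L / real N))"
    "\<And>\<omega>. \<omega> \<in> space M - F \<Longrightarrow> fills (\<lambda>n. \<Theta> n \<omega>) m L (d powr (2/3))"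
    using fill_prob[OF indep distr N1 L1 Ne, of m] unfolding fills_def by blast
  have PF: "prob F \<le> (d powr - 6 + 1) * (7 * d powr - (2/3) + 1) * exp (- (d powr - (2/3) / 8))"
  proof -
    have LN: "d powr - (2/3) / 8 \<le> real L / real N"
    proof -
      have "d powr - (2/3) / 8 = d powr - (4/3) / (8 * d powr - (2/3))"
      proof -
        have "d powr - (4/3) = d powr - (2/3) * d powr - (2/3)" by (simp flip: powr_add)
        then show ?thesis using d_pos by simp
      qed
      also have "\<dots> \<le> real L / real N"
        using Llo Nhi p1[of "2/3"] N1 by (intro frac_le) auto
      finally show ?thesis .
    qed
    note F(2)
    also have "(real m + 1) * real N * exp (- (real L / real N))
      \<le> (d powr - 6 + 1) * (7 * d powr - (2/3) + 1) * exp (- (d powr - (2/3) / 8))"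
      by (intro mult_mono add_mono m_le Nhi) (use LN in auto)
    finally show ?thesis .
  qed
  let ?G = "{\<omega> \<in> space M. HL_Omega P m \<epsilon> (\<lambda>n. \<Theta> n \<omega>)}"
  have G: "?G \<in> events" by (rule HL_Omega_measurable[OF \<Theta>])
  have good: "HL_Omega P m \<epsilon> (\<lambda>n. \<Theta> n \<omega>)" if w: "\<omega> \<in> space M - ((\<Union>n. E n) \<union> F)" for \<omega>
  proof (rule HL_Omega_of_good[where L = L and e = e and e' = "d powr (2/3)"])
    have wE: "\<omega> \<in> space M - E n" for n using w by auto
    show "good_at (\<lambda>n. \<Theta> n \<omega>) e n" if "n < m" for n
      by (rule E(3)[OF wE]) (use that m_le p1[of 6] in linarith)
    have e0: "0 \<le> e" using d_pos by (simp add: e_def)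
    show "high_at (\<lambda>n. \<Theta> n \<omega>) (c * real m - e) n" if mn: "m \<le> n" for n
    \<comment> \<open>Up to \<open>2 * d^-6\<close> the two-sided estimate gives the lower bound;
      beyond, \<open>m \<le> d^-6 < n / 2\<close> leaves room for the factor 5/8.\<close>
    proof (cases "real n \<le> 2 * d powr - 6")
      case True
      have cm: "c * real m \<le> c * real n" using mn c_pos by (intro mult_left_mono) auto
      show ?thesis
        unfolding high_at_def
      proof
        fix \<zeta> assume z: "\<zeta> \<in> horo d"
        let ?H = "Hs f (\<lambda>j. \<Theta> (n - j) \<omega>) (cis (- \<Theta> (Suc n) \<omega>) * \<zeta>) n"
        have "norm (?H - of_real (c * real n)) \<le> e" using E(3)[OF wE True] z unfolding good_at_def by blast
        then show "c * real m - e \<le> Re ?H"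
          using abs_Re_le_cmod[of "?H - of_real (c * real n)"] cm by simp
      qed
    next
      case False
      then have "real m \<le> 5/8 * real n" using m_le p1[of 6] by linarith
      then have "c * real m \<le> c * (5/8 * real n)" using c_pos by (intro mult_left_mono) auto
      moreover have "d \<le> e" by (simp add: e_def)
      ultimately have "c * real m - e \<le> 5/8 * c * real n - d" by simp
      moreover have "high_at (\<lambda>n. \<Theta> n \<omega>) (5/8 * c * real n - d) n" by (rule E(4)[OF wE]) (use False in simp)
      ultimately show ?thesis unfolding high_at_def by (meson order_trans)
    qed
    show "fills (\<lambda>n. \<Theta> n \<omega>) m L (d powr (2/3))" using F(3) w by blast
    show "0 \<le> e" by (rule e0)
    show "e \<le> 1/2" using sm by (simp add: e_def small_enough_def)
    show "0 \<le> d powr (2/3)" by simp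
    have cL: "c * (real L + 1) \<le> 3 * C * d powr (2/3)"
    proof -
      have "c * (real L + 1) \<le> (C * d\<^sup>2) * (3 * d powr - (4/3))"
        using Lhi p1[of "4/3"] C0 by (intro mult_mono c_upper) auto
      also have "\<dots> = 3 * C * (d powr 2 * d powr - (4/3))" using d_pos by simp
      also have "d powr 2 * d powr - (4/3) = d powr (2 + - (4/3))" by (simp only: powr_add)
      also have "(2 + - (4/3)) = (2/3 :: real)" by simp
      finally show ?thesis .
    qed
    then show "c * (real L + 1) \<le> 1" using sm by (simp add: small_enough_def)
    have "4 * e + d + 2 * c + 2 * c * (real L + 1) + d powr (2/3)
       \<le> 4 * (d powr (2/3) + d) + d + 2 * (C * d\<^sup>2) + 2 * (3 * C * d powr (2/3)) + d powr (2/3)"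
      using c_upper cL by (simp add: e_def)
    also have "\<dots> = (5 + 6 * C) * d powr (2/3) + 5 * d + 2 * C * d\<^sup>2" by (simp add: algebra_simps)
    also have "\<dots> \<le> \<epsilon>" using sm by (simp add: small_enough_def \<epsilon>_def)
    finally show "4 * e + d + 2 * c + 2 * c * (real L + 1) + d powr (2/3) \<le> \<epsilon>" .
  qed
  have Um: "(\<Union>n. E n) \<union> F \<in> events" using E(1) F(1) by auto
  have "1 - error_bound d \<le> 1 - prob ((\<Union>n. E n) \<union> F)"
  proof -
    have "prob ((\<Union>n. E n) \<union> F) \<le> prob (\<Union>n. E n) + prob F" by (rule measure_Un_le) (use E(1) F(1) in auto)
    then show ?thesis using PE PF unfolding error_bound_def by linarith
  qed
  also have "\<dots> = prob (space M - ((\<Union>n. E n) \<union> F))" by (rule prob_compl[OF Um, symmetric])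
  also have "\<dots> \<le> prob ?G" by (rule finite_measure_mono[OF _ G]) (use good in blast)
  finally show ?thesis unfolding m_def \<epsilon>_def .
qed

theorem theorem3p1:
  fixes M :: "'a measure" and \<Theta> :: "nat \<Rightarrow> 'a \<Rightarrow> real" and slit :: bool
  assumes "prob_space M"
    and "\<And>n. \<Theta> n \<in> borel_measurable M"
    and "prob_space.indep_vars M (\<lambda>_. borel) \<Theta> UNIV"
    and "\<And>n. distr M borel (\<Theta> n) = uniform_measure lborel {0..<2 * pi}"
  shows "((\<lambda>\<delta>. measure M {\<omega> \<in> space M.
            HL_Omega (if slit then slit_particle \<delta> else disc_particle \<delta>)
                     (nat \<lfloor>\<delta> powr (-6)\<rfloor>)
                     (\<delta> powr (2/3) * (ln (1/\<delta>)) ^ 8)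
                     (\<lambda>n. \<Theta> n \<omega>)})
          \<longlongrightarrow> 1) (at_right 0)"
proof -
  interpret prob_space M by fact
  define C where "C = (if slit then 72 else 4000 :: real)"
  let ?P = "\<lambda>\<delta>. if slit then slit_particle \<delta> else disc_particle \<delta>"
  have est: "\<exists>c f. hl_map_est (?P \<delta>) C \<delta> c f" if "0 < \<delta>" "\<delta> \<le> 1 / 2000" for \<delta>
    using slit_estimates[of \<delta>] disc_estimates[of \<delta>] that by (auto simp: C_def)
  have C1: "1 \<le> C" by (simp add: C_def)
  have "\<forall>\<^sub>F \<delta> :: real in at_right 0. 0 < \<delta>" by (simp add: eventually_at_filter)
  moreover have "\<forall>\<^sub>F \<delta> :: real in at_right 0. \<delta> \<le> 1 / 2000" by real_asymp
  moreover have "\<forall>\<^sub>F \<delta> in at_right 0. small_enough C \<delta>" by (rule eventually_small_enough) (use C1 in simp)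
  ultimately have lower: "\<forall>\<^sub>F \<delta> in at_right 0. 1 - error_bound \<delta> \<le> measure M {\<omega> \<in> space M.
      HL_Omega (?P \<delta>) (nat \<lfloor>\<delta> powr (-6)\<rfloor>) (\<delta> powr (2/3) * (ln (1/\<delta>)) ^ 8) (\<lambda>n. \<Theta> n \<omega>)}"
  proof eventually_elim
    case (elim \<delta>)
    obtain c f where cf: "hl_map_est (?P \<delta>) C \<delta> c f" using est elim by blast
    obtain a b where ab: "hl_map f c C \<delta> a b" using hl_map_est_locale[OF cf] elim C1 by auto
    have "?P \<delta> \<subseteq> disc_particle \<delta>" using slit_subset_disc[OF elim(1)] by auto
    moreover have "?P \<delta> \<noteq> {}"
    proof -
      have "of_real (1 + \<delta>) \<in> slit_particle \<delta>"
        unfolding slit_particle_def using elim(1) by (intro CollectI exI[of _ "1 + \<delta>"]) auto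
      then show ?thesis using slit_subset_disc[OF elim(1)] by auto
    qed
    ultimately have "hl_particle f c C \<delta> a b (?P \<delta>)"
      using ab cf unfolding hl_particle_def hl_particle_axioms_def hl_map_est_def by blast
    from HL_Omega_prob[OF assms this elim(3)] show ?case .
  qed
  \<comment> \<open>The negative powers of \<open>d\<close> lose against
    \<open>exp (- (d powr - (2/3) / 8))\<close>.\<close>
  have "((\<lambda>d. 1 - error_bound d) \<longlongrightarrow> 1) (at_right 0)" unfolding error_bound_def by real_asymp
  from tendsto_sandwich[OF lower always_eventually this tendsto_const]
  show ?thesis by simp
qed

end
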